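(* Let $(R,\mathfrak m)$ be a Noetherian local ring, $\mathfrak a$ a proper ideal of $R$, and suppose $R$ is relative Cohen-Macaulay with respect to $\mathfrak a$ with $\operatorname{cd}(\mathfrak a,R)=c$. Then for all $0\le i\le c$, the $R$-module $K^i_{\mathfrak a}(R)$ is either zero or an $i$-cohomological dimensional relative Cohen-Macaulay module with respect to $\mathfrak a$.
   Context: $H^i_{\mathfrak a}(-)$ denotes local cohomology with respect to $\mathfrak a$ and $\operatorname{cd}(\mathfrak a,M)=\sup\{i\in\mathbb Z\mid H^i_{\mathfrak a}(M)\neq0\}$. For a local ring $(R,\mathfrak m,k)$, $K^i_{\mathfrak a}(M)=\operatorname{Hom}_R(H^i_{\mathfrak a}(M),E_R(k))$, where $E_R(k)$ is the injective hull of $k=R/\mathfrak m$. An $R$-module $N$ is relative Cohen-Macaulay with respect to $\mathfrak a$ if there is precisely one $j$ with $H^j_{\mathfrak a}(N)\neq0$; it is $i$-cohomological dimensional if $\operatorname{cd}(\mathfrak a,N)=i$. So the conclusion says that, when $K^i_{\mathfrak a}(R)\ne0$, $H^j_{\mathfrak a}(K^i_{\mathfrak a}(R))\neq 0$ exactly for $j=i$. *)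

theory Defs
  imports "HOL-Algebra.Module" "HOL-Algebra.Ideal_Product" "HOL-Algebra.Ring_Divisibility" "HOL-Library.Extended_Real"
begin

section \<open>Modules\<close>

text \<open>The fields \<open>mult\<close> and \<open>one\<close>, which the record type of modules inherits from rings, carry no
  information for a module and are left \<^const>\<open>undefined\<close> below.\<close>

definition module_homs ::
    "('r, 'x) ring_scheme \<Rightarrow> ('r, 'm, 'y) module_scheme \<Rightarrow> ('r, 'n, 'z) module_scheme \<Rightarrow> ('m \<Rightarrow> 'n) set"
  where "module_homs R M N =
    {f \<in> carrier M \<rightarrow> carrier N.
      (\<forall>x\<in>carrier M. \<forall>y\<in>carrier M. f (x \<oplus>\<^bsub>M\<^esub> y) = f x \<oplus>\<^bsub>N\<^esub> f y) \<and>
      (\<forall>r\<in>carrier R. \<forall>x\<in>carrier M. f (r \<odot>\<^bsub>M\<^esub> x) = r \<odot>\<^bsub>N\<^esub> f x)}"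

definition zero_module :: "('r, 'm, 'y) module_scheme \<Rightarrow> bool"
  where "zero_module M \<longleftrightarrow> carrier M = {\<zero>\<^bsub>M\<^esub>}"

definition regular_module :: "('r, 'x) ring_scheme \<Rightarrow> ('r, 'r) module"
  where "regular_module R =
    \<lparr>carrier = carrier R, monoid.mult = undefined, one = undefined, zero = \<zero>\<^bsub>R\<^esub>, add = add R,
     smult = monoid.mult R\<rparr>"

definition quotient_module :: "('r, 'm, 'y) module_scheme \<Rightarrow> 'm set \<Rightarrow> ('r, 'm set) module"
  where "quotient_module M N =
    \<lparr>carrier = a_rcosets\<^bsub>M\<^esub> N, monoid.mult = undefined, one = undefined, zero = N, add = set_add M,
     smult = (\<lambda>r X. \<Union>x\<in>X. N +>\<^bsub>M\<^esub> (r \<odot>\<^bsub>M\<^esub> x))\<rparr>"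

text \<open>Homomorphisms are made extensional so that two elements of \<open>Hom\<^sub>R(M, N)\<close> are equal iff they
  agree on \<open>M\<close>.\<close>

definition Hom_module ::
    "('r, 'x) ring_scheme \<Rightarrow> ('r, 'm, 'y) module_scheme \<Rightarrow> ('r, 'n, 'z) module_scheme \<Rightarrow> ('r, 'm \<Rightarrow> 'n) module"
  where "Hom_module R M N =
    \<lparr>carrier = module_homs R M N \<inter> extensional (carrier M), monoid.mult = undefined, one = undefined,
     zero = (\<lambda>x\<in>carrier M. \<zero>\<^bsub>N\<^esub>),
     add = (\<lambda>f g. \<lambda>x\<in>carrier M. f x \<oplus>\<^bsub>N\<^esub> g x),
     smult = (\<lambda>r f. \<lambda>x\<in>carrier M. r \<odot>\<^bsub>N\<^esub> f x)\<rparr>"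

lemma module_homsD:
  assumes "f \<in> module_homs R M N"
  shows "x \<in> carrier M \<Longrightarrow> f x \<in> carrier N"
    and "x \<in> carrier M \<Longrightarrow> y \<in> carrier M \<Longrightarrow> f (x \<oplus>\<^bsub>M\<^esub> y) = f x \<oplus>\<^bsub>N\<^esub> f y"
    and "r \<in> carrier R \<Longrightarrow> x \<in> carrier M \<Longrightarrow> f (r \<odot>\<^bsub>M\<^esub> x) = r \<odot>\<^bsub>N\<^esub> f x"
  using assms by (auto simp: module_homs_def)

lemma regular_module_is_module:
  assumes "cring R"
  shows "module R (regular_module R)"
proof -
  interpret cring R by fact
  have "abelian_group (regular_module R)"
    by (rule abelian_groupI)
      (auto simp: regular_module_def add.m_ac intro: l_neg)
  then show ?thesis
    by (intro moduleI) (auto simp: regular_module_def assms m_assoc l_distr r_distr)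
qed

lemma quotient_module_is_module:
  fixes R :: "('r, 'x) ring_scheme" and M :: "('r, 'm, 'y) module_scheme"
  assumes "module R M" and "submodule N R M"
  shows "module R (quotient_module M N)"
proof -
  interpret module R M by fact
  interpret N: submodule N R M by fact
  have "additive_subgroup N M"
    by (rule additive_subgroup.intro) (rule N.subgroup_axioms)
  then interpret S: abelian_subgroup N M
    by (rule abelian_subgroupI3) (rule M.abelian_group_axioms)
  have sm: "(\<Union>z\<in>N +>\<^bsub>M\<^esub> x. N +>\<^bsub>M\<^esub> (r \<odot>\<^bsub>M\<^esub> z)) = N +>\<^bsub>M\<^esub> (r \<odot>\<^bsub>M\<^esub> x)"
    if r: "r \<in> carrier R" and x: "x \<in> carrier M" for r x
  proof -
    have "N +>\<^bsub>M\<^esub> (r \<odot>\<^bsub>M\<^esub> z) = N +>\<^bsub>M\<^esub> (r \<odot>\<^bsub>M\<^esub> x)" if z: "z \<in> N +>\<^bsub>M\<^esub> x" for z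
    proof -
      obtain n where n: "n \<in> N" "z = n \<oplus>\<^bsub>M\<^esub> x" using z by (auto simp: a_r_coset_def')
      have nM: "n \<in> carrier M" using n S.a_subset by auto
      have "r \<odot>\<^bsub>M\<^esub> z = r \<odot>\<^bsub>M\<^esub> n \<oplus>\<^bsub>M\<^esub> r \<odot>\<^bsub>M\<^esub> x"
        using n nM r x by (simp add: smult_r_distr)
      then have "r \<odot>\<^bsub>M\<^esub> z \<in> N +>\<^bsub>M\<^esub> (r \<odot>\<^bsub>M\<^esub> x)"
        using N.smult_closed[OF r n(1)] by (auto simp: a_r_coset_def')
      then show ?thesis
        using S.a_repr_independence' r x smult_closed S.a_subgroup by metis
    qed
    moreover have "x \<in> N +>\<^bsub>M\<^esub> x" using x S.a_rcos_self by blast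
    ultimately show ?thesis by blast
  qed
  have N0: "N +>\<^bsub>M\<^esub> \<zero>\<^bsub>M\<^esub> = N" using S.a_subset by (rule M.a_coset_add_zero)
  let ?Q = "quotient_module M N"
  have Qcarr: "carrier ?Q = (\<lambda>x. N +>\<^bsub>M\<^esub> x) ` carrier M"
    by (auto simp: quotient_module_def A_RCOSETS_def')
  have Qadd: "(N +>\<^bsub>M\<^esub> x) \<oplus>\<^bsub>?Q\<^esub> (N +>\<^bsub>M\<^esub> y) = N +>\<^bsub>M\<^esub> (x \<oplus>\<^bsub>M\<^esub> y)"
    if "x \<in> carrier M" "y \<in> carrier M" for x y
    using S.a_rcos_sum[OF that] by (simp add: quotient_module_def)
  have Qsm: "r \<odot>\<^bsub>?Q\<^esub> (N +>\<^bsub>M\<^esub> x) = N +>\<^bsub>M\<^esub> (r \<odot>\<^bsub>M\<^esub> x)"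
    if "r \<in> carrier R" "x \<in> carrier M" for r x
    using sm[OF that] by (simp add: quotient_module_def)
  have Qzero: "\<zero>\<^bsub>?Q\<^esub> = N +>\<^bsub>M\<^esub> \<zero>\<^bsub>M\<^esub>"
    by (simp add: quotient_module_def N0)
  show ?thesis
  proof (intro moduleI abelian_groupI)
    show "cring R" by (rule R.is_cring)
  next
    fix X assume "X \<in> carrier ?Q"
    then obtain x where x: "x \<in> carrier M" "X = N +>\<^bsub>M\<^esub> x" by (auto simp: Qcarr)
    then have "(N +>\<^bsub>M\<^esub> \<ominus>\<^bsub>M\<^esub> x) \<oplus>\<^bsub>?Q\<^esub> X = \<zero>\<^bsub>?Q\<^esub>"
      by (simp add: Qadd Qzero M.l_neg)
    then show "\<exists>Y\<in>carrier ?Q. Y \<oplus>\<^bsub>?Q\<^esub> X = \<zero>\<^bsub>?Q\<^esub>"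
      using x by (auto simp: Qcarr)
  qed (auto simp: Qcarr Qadd Qsm Qzero M.add.m_ac smult_l_distr smult_r_distr smult_assoc1)
qed

lemma Hom_module_is_module:
  fixes R :: "('r, 'x) ring_scheme"
  assumes "module R M" and "module R N"
  shows "module R (Hom_module R M N)"
proof -
  interpret M: module R M by fact
  interpret N: module R N by fact
  let ?H = "Hom_module R M N"
  have D: "f x \<in> carrier N" if "f \<in> carrier ?H" "x \<in> carrier M" for f x
    using that module_homsD(1)[of f R M N] by (simp add: Hom_module_def)
  have Dadd: "f (x \<oplus>\<^bsub>M\<^esub> y) = f x \<oplus>\<^bsub>N\<^esub> f y"
    if "f \<in> carrier ?H" "x \<in> carrier M" "y \<in> carrier M" for f x y
    using that module_homsD(2)[of f R M N] by (simp add: Hom_module_def)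
  have Dsm: "f (r \<odot>\<^bsub>M\<^esub> x) = r \<odot>\<^bsub>N\<^esub> f x"
    if "f \<in> carrier ?H" "r \<in> carrier R" "x \<in> carrier M" for f r x
    using that module_homsD(3)[of f R M N] by (simp add: Hom_module_def)
  have Dext: "restrict f (carrier M) = f" if "f \<in> carrier ?H" for f
    using that by (simp add: Hom_module_def extensional_restrict)
  have I: "(\<lambda>x\<in>carrier M. t x) \<in> carrier ?H"
    if "\<And>x. x \<in> carrier M \<Longrightarrow> t x \<in> carrier N"
      "\<And>x y. x \<in> carrier M \<Longrightarrow> y \<in> carrier M \<Longrightarrow> t (x \<oplus>\<^bsub>M\<^esub> y) = t x \<oplus>\<^bsub>N\<^esub> t y"
      "\<And>r x. r \<in> carrier R \<Longrightarrow> x \<in> carrier M \<Longrightarrow> t (r \<odot>\<^bsub>M\<^esub> x) = r \<odot>\<^bsub>N\<^esub> t x" for t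
    using that by (simp add: Hom_module_def module_homs_def)
  have add: "f \<oplus>\<^bsub>?H\<^esub> g = (\<lambda>x\<in>carrier M. f x \<oplus>\<^bsub>N\<^esub> g x)" for f g
    by (simp add: Hom_module_def)
  have sm: "r \<odot>\<^bsub>?H\<^esub> f = (\<lambda>x\<in>carrier M. r \<odot>\<^bsub>N\<^esub> f x)" for r f
    by (simp add: Hom_module_def)
  have zero: "\<zero>\<^bsub>?H\<^esub> = (\<lambda>x\<in>carrier M. \<zero>\<^bsub>N\<^esub>)"
    by (simp add: Hom_module_def)
  show ?thesis
  proof (intro moduleI abelian_groupI)
    show "cring R" by (rule M.R.is_cring)
  next
    fix f assume f: "f \<in> carrier ?H"
    have "(\<lambda>x\<in>carrier M. \<ominus>\<^bsub>N\<^esub> f x) \<in> carrier ?H"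
      using f by (intro I) (simp_all add: D Dadd Dsm N.smult_r_minus N.M.minus_add)
    moreover have "(\<lambda>x\<in>carrier M. \<ominus>\<^bsub>N\<^esub> f x) \<oplus>\<^bsub>?H\<^esub> f = \<zero>\<^bsub>?H\<^esub>"
      unfolding add zero using f by (intro restrict_ext) (simp add: D N.M.l_neg)
    ultimately show "\<exists>g\<in>carrier ?H. g \<oplus>\<^bsub>?H\<^esub> f = \<zero>\<^bsub>?H\<^esub>" by blast
  next
    fix f g assume "f \<in> carrier ?H" "g \<in> carrier ?H"
    then show "f \<oplus>\<^bsub>?H\<^esub> g \<in> carrier ?H"
      unfolding add by (intro I) (simp_all add: D Dadd Dsm N.smult_r_distr N.M.add.m_ac)
  next
    fix r f assume "r \<in> carrier R" "f \<in> carrier ?H"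
    then show "r \<odot>\<^bsub>?H\<^esub> f \<in> carrier ?H"
      unfolding sm
      by (intro I) (simp_all add: D Dadd Dsm N.smult_r_distr N.smult_assoc1[symmetric] M.R.m_comm)
  next
    show "\<zero>\<^bsub>?H\<^esub> \<in> carrier ?H"
      unfolding zero by (intro I) simp_all
  next
    fix f assume f: "f \<in> carrier ?H"
    have "(\<lambda>x\<in>carrier M. \<zero>\<^bsub>?H\<^esub> x \<oplus>\<^bsub>N\<^esub> f x) = restrict f (carrier M)"
      using f by (intro restrict_ext) (simp add: zero D)
    then show "\<zero>\<^bsub>?H\<^esub> \<oplus>\<^bsub>?H\<^esub> f = f" using f by (simp add: add Dext)
    have "(\<lambda>x\<in>carrier M. \<one>\<^bsub>R\<^esub> \<odot>\<^bsub>N\<^esub> f x) = restrict f (carrier M)"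
      using f by (intro restrict_ext) (simp add: D)
    then show "\<one>\<^bsub>R\<^esub> \<odot>\<^bsub>?H\<^esub> f = f" using f by (simp add: sm Dext)
  qed (simp_all add: add sm D N.M.add.m_ac N.smult_l_distr N.smult_r_distr N.smult_assoc1
      cong: restrict_cong)
qed

section \<open>Injective modules, injective hulls, injective resolutions\<close>

text \<open>A definition cannot quantify over all types, so the extension property is demanded for modules
  on the carrier type of the ring only. This is no restriction: \<open>injective_module_extends\<close> below
  proves the extension property for modules on arbitrary types.\<close>

definition injective_module :: "('r, 'x) ring_scheme \<Rightarrow> ('r, 'e, 'y) module_scheme \<Rightarrow> bool"
  where "injective_module R E \<longleftrightarrow> module R E \<and>
    (\<forall>(A :: ('r, 'r) module) (B :: ('r, 'r) module) f g.
      module R A \<longrightarrow> module R B \<longrightarrow> f \<in> module_homs R A B \<longrightarrow> inj_on f (carrier A) \<longrightarrow>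
      g \<in> module_homs R A E \<longrightarrow>
      (\<exists>h\<in>module_homs R B E. \<forall>x\<in>carrier A. h (f x) = g x))"

lemma injective_module_extends:
  fixes R :: "('r, 'x) ring_scheme" and A :: "('r, 'a, 'p) module_scheme"
    and B :: "('r, 'b, 'q) module_scheme" and E :: "('r, 'e, 'y) module_scheme"
  assumes inj: "injective_module R E" and A: "module R A" and B: "module R B"
    and f: "f \<in> module_homs R A B" and f_inj: "inj_on f (carrier A)" and g: "g \<in> module_homs R A E"
  shows "\<exists>h\<in>module_homs R B E. \<forall>x\<in>carrier A. h (f x) = g x"
proof -
  interpret A: module R A by fact
  interpret B: module R B by fact
  interpret E: module R E using inj by (simp add: injective_module_def)
  define P where "P G \<longleftrightarrow> G \<subseteq> carrier B \<times> carrier E \<and> (\<forall>x\<in>carrier A. (f x, g x) \<in> G) \<and>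
      (\<forall>x y x' y'. (x, y) \<in> G \<longrightarrow> (x', y') \<in> G \<longrightarrow> (x \<oplus>\<^bsub>B\<^esub> x', y \<oplus>\<^bsub>E\<^esub> y') \<in> G) \<and>
      (\<forall>r\<in>carrier R. \<forall>x y. (x, y) \<in> G \<longrightarrow> (r \<odot>\<^bsub>B\<^esub> x, r \<odot>\<^bsub>E\<^esub> y) \<in> G) \<and>
      (\<forall>y. (\<zero>\<^bsub>B\<^esub>, y) \<in> G \<longrightarrow> y = \<zero>\<^bsub>E\<^esub>)" for G
  have f0: "f \<zero>\<^bsub>A\<^esub> = \<zero>\<^bsub>B\<^esub>" and g0: "g \<zero>\<^bsub>A\<^esub> = \<zero>\<^bsub>E\<^esub>"
    using module_homsD(3)[OF f, of "\<zero>\<^bsub>R\<^esub>" "\<zero>\<^bsub>A\<^esub>"] module_homsD(3)[OF g, of "\<zero>\<^bsub>R\<^esub>" "\<zero>\<^bsub>A\<^esub>"]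
    by (simp_all add: module_homsD(1)[OF f] module_homsD(1)[OF g])
  have "P ((\<lambda>x. (f x, g x)) ` carrier A)"
    unfolding P_def
  proof (intro conjI allI impI ballI)
    fix y assume "(\<zero>\<^bsub>B\<^esub>, y) \<in> (\<lambda>x. (f x, g x)) ` carrier A"
    then obtain x where x: "x \<in> carrier A" "f x = \<zero>\<^bsub>B\<^esub>" "y = g x" by auto
    then have "x = \<zero>\<^bsub>A\<^esub>" using f0 f_inj by (metis A.M.zero_closed inj_onD)
    then show "y = \<zero>\<^bsub>E\<^esub>" using x g0 by simp
  next
    fix x y x' y'
    assume "(x, y) \<in> (\<lambda>x. (f x, g x)) ` carrier A" "(x', y') \<in> (\<lambda>x. (f x, g x)) ` carrier A"
    then show "(x \<oplus>\<^bsub>B\<^esub> x', y \<oplus>\<^bsub>E\<^esub> y') \<in> (\<lambda>x. (f x, g x)) ` carrier A"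
      by (auto simp: module_homsD(2)[OF f, symmetric] module_homsD(2)[OF g, symmetric])
  next
    fix r x y assume "r \<in> carrier R" "(x, y) \<in> (\<lambda>x. (f x, g x)) ` carrier A"
    then show "(r \<odot>\<^bsub>B\<^esub> x, r \<odot>\<^bsub>E\<^esub> y) \<in> (\<lambda>x. (f x, g x)) ` carrier A"
      by (auto simp: module_homsD(3)[OF f, symmetric] module_homsD(3)[OF g, symmetric])
  qed (auto simp: module_homsD(1)[OF f] module_homsD(1)[OF g])
  then have ne: "Collect P \<noteq> {}" by blast
  have "\<Union>C \<in> Collect P" if C: "C \<noteq> {}" "subset.chain (Collect P) C" for C
  proof -
    have PC: "P G" if "G \<in> C" for G using C(2) that by (auto simp: subset.chain_def)
    have pair: "(x \<oplus>\<^bsub>B\<^esub> x', y \<oplus>\<^bsub>E\<^esub> y') \<in> \<Union>C"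
      if mem: "(x, y) \<in> G" "G \<in> C" "(x', y') \<in> G'" "G' \<in> C" for x y x' y' G G'
    proof -
      from C(2) mem have "G \<subseteq> G' \<or> G' \<subseteq> G" by (auto simp: subset.chain_def)
      then obtain H where "H \<in> C" "(x, y) \<in> H" "(x', y') \<in> H" using mem by blast
      then show ?thesis using PC[of H] unfolding P_def by blast
    qed
    have "P (\<Union>C)"
      unfolding P_def
    proof (intro conjI allI impI ballI)
      show "\<Union>C \<subseteq> carrier B \<times> carrier E" using PC unfolding P_def by blast
      show "(f x, g x) \<in> \<Union>C" if "x \<in> carrier A" for x using PC C(1) that unfolding P_def by blast
      show "(x \<oplus>\<^bsub>B\<^esub> x', y \<oplus>\<^bsub>E\<^esub> y') \<in> \<Union>C" if "(x, y) \<in> \<Union>C" "(x', y') \<in> \<Union>C" for x y x' y'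
        using that pair by blast
      show "(r \<odot>\<^bsub>B\<^esub> x, r \<odot>\<^bsub>E\<^esub> y) \<in> \<Union>C" if "r \<in> carrier R" "(x, y) \<in> \<Union>C" for r x y
        using that PC unfolding P_def by blast
      show "y = \<zero>\<^bsub>E\<^esub>" if "(\<zero>\<^bsub>B\<^esub>, y) \<in> \<Union>C" for y using that PC unfolding P_def by blast
    qed
    then show ?thesis by simp
  qed
  from subset_Zorn_nonempty[OF ne this]
  obtain G where PG: "P G" and maximal: "\<And>X. P X \<Longrightarrow> G \<subseteq> X \<Longrightarrow> X = G" by auto
  have GB: "x \<in> carrier B" and GE: "y \<in> carrier E" if "(x, y) \<in> G" for x y
    using PG that unfolding P_def by auto
  have Gfg: "(f x, g x) \<in> G" if "x \<in> carrier A" for x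
    using PG that unfolding P_def by blast
  have Gadd: "(x \<oplus>\<^bsub>B\<^esub> x', y \<oplus>\<^bsub>E\<^esub> y') \<in> G" if "(x, y) \<in> G" "(x', y') \<in> G" for x y x' y'
    using PG that unfolding P_def by blast
  have Gsm: "(r \<odot>\<^bsub>B\<^esub> x, r \<odot>\<^bsub>E\<^esub> y) \<in> G" if "r \<in> carrier R" "(x, y) \<in> G" for r x y
    using PG that unfolding P_def by blast
  have G0: "y = \<zero>\<^bsub>E\<^esub>" if "(\<zero>\<^bsub>B\<^esub>, y) \<in> G" for y
    using PG that unfolding P_def by blast
  have Gneg: "(\<ominus>\<^bsub>B\<^esub> x, \<ominus>\<^bsub>E\<^esub> y) \<in> G" if "(x, y) \<in> G" for x y
    using Gsm[of "\<ominus>\<^bsub>R\<^esub> \<one>\<^bsub>R\<^esub>", OF _ that] GB[OF that] GE[OF that]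
    by (simp add: B.smult_l_minus E.smult_l_minus)
  have G00: "(\<zero>\<^bsub>B\<^esub>, \<zero>\<^bsub>E\<^esub>) \<in> G" using Gfg[of "\<zero>\<^bsub>A\<^esub>"] by (simp add: f0 g0)
  have Guniq: "y = y'" if "(x, y) \<in> G" "(x, y') \<in> G" for x y y'
  proof -
    have "(\<zero>\<^bsub>B\<^esub>, y \<oplus>\<^bsub>E\<^esub> \<ominus>\<^bsub>E\<^esub> y') \<in> G"
      using Gadd[OF that(1) Gneg[OF that(2)]] GB[OF that(1)] by (simp add: B.M.r_neg)
    then have "\<ominus>\<^bsub>E\<^esub> (\<ominus>\<^bsub>E\<^esub> y') = y"
      using G0 GE that by (intro E.M.minus_equality) auto
    then show ?thesis using GE[OF that(2)] by simp
  qed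
  have total: "\<exists>y. (b, y) \<in> G" if b: "b \<in> carrier B" for b
  proof -
    define L where "L = {r \<in> carrier R. \<exists>y. (r \<odot>\<^bsub>B\<^esub> b, y) \<in> G}"
    define \<phi> where "\<phi> r = (SOME y. (r \<odot>\<^bsub>B\<^esub> b, y) \<in> G)" for r
    have \<phi>: "(r \<odot>\<^bsub>B\<^esub> b, \<phi> r) \<in> G" if "r \<in> L" for r
      using that someI_ex[of "\<lambda>y. (r \<odot>\<^bsub>B\<^esub> b, y) \<in> G"] unfolding L_def \<phi>_def by simp
    have LI: "r \<in> L" if "r \<in> carrier R" "(r \<odot>\<^bsub>B\<^esub> b, y) \<in> G" for r y
      using that unfolding L_def by blast
    have LR: "r \<in> L \<Longrightarrow> r \<in> carrier R" for r by (simp add: L_def)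
    have add_b: "((r \<oplus>\<^bsub>R\<^esub> s) \<odot>\<^bsub>B\<^esub> b, \<phi> r \<oplus>\<^bsub>E\<^esub> \<phi> s) \<in> G" if "r \<in> L" "s \<in> L" for r s
      using Gadd[OF \<phi>[OF that(1)] \<phi>[OF that(2)]] b that LR by (simp add: B.smult_l_distr)
    have sm_b: "((r \<otimes>\<^bsub>R\<^esub> s) \<odot>\<^bsub>B\<^esub> b, r \<odot>\<^bsub>E\<^esub> \<phi> s) \<in> G" if "r \<in> carrier R" "s \<in> L" for r s
      using Gsm[OF that(1) \<phi>[OF that(2)]] b that LR by (simp add: B.smult_assoc1)
    interpret RR: module R "regular_module R" by (rule regular_module_is_module) (rule A.R.is_cring)
    have "submodule L R (regular_module R)"
    proof (rule RR.submoduleI)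
      show "L \<subseteq> carrier (regular_module R)" by (auto simp: L_def regular_module_def)
      show zL: "\<zero>\<^bsub>regular_module R\<^esub> \<in> L"
        using G00 b by (auto simp: regular_module_def intro!: LI)
      show sL: "r \<odot>\<^bsub>regular_module R\<^esub> x \<in> L" if "r \<in> carrier R" "x \<in> L" for r x
        using sm_b[OF that] that LR by (auto simp: regular_module_def intro!: LI)
      show "x \<oplus>\<^bsub>regular_module R\<^esub> y \<in> L" if "x \<in> L" "y \<in> L" for x y
        using add_b[OF that] that LR by (auto simp: regular_module_def intro!: LI)
      show "\<ominus>\<^bsub>regular_module R\<^esub> x \<in> L" if "x \<in> L" for x
      proof -
        have "x \<in> carrier (regular_module R)" using LR[OF that] by (simp add: regular_module_def)
        then have "\<ominus>\<^bsub>regular_module R\<^esub> x = (\<ominus>\<^bsub>R\<^esub> \<one>\<^bsub>R\<^esub>) \<odot>\<^bsub>regular_module R\<^esub> x"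
          by (simp add: RR.smult_l_minus)
        then show ?thesis using sL[of "\<ominus>\<^bsub>R\<^esub> \<one>\<^bsub>R\<^esub>", OF _ that] by simp
      qed
    qed
    then have modL: "module R ((regular_module R)\<lparr>carrier := L\<rparr>)"
      by (rule submodule.submodule_is_module) (rule RR.module_axioms)
    have sum_L: "r \<oplus>\<^bsub>R\<^esub> s \<in> L" if "r \<in> L" "s \<in> L" for r s
      using add_b[OF that] that LR by (auto intro!: LI)
    have prod_L: "r \<otimes>\<^bsub>R\<^esub> s \<in> L" if "r \<in> carrier R" "s \<in> L" for r s
      using sm_b[OF that] that LR by (auto intro!: LI)
    have "\<phi> \<in> module_homs R ((regular_module R)\<lparr>carrier := L\<rparr>) E"
      using GE[OF \<phi>] Guniq[OF \<phi>[OF sum_L] add_b] Guniq[OF \<phi>[OF prod_L] sm_b]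
      by (auto simp: module_homs_def regular_module_def)
    moreover have "(\<lambda>r. r) \<in> module_homs R ((regular_module R)\<lparr>carrier := L\<rparr>) (regular_module R)"
      by (auto simp: module_homs_def regular_module_def LR)
    ultimately have "\<exists>h\<in>module_homs R (regular_module R) E.
        \<forall>r\<in>carrier ((regular_module R)\<lparr>carrier := L\<rparr>). h r = \<phi> r"
      using inj[unfolded injective_module_def, THEN conjunct2, rule_format,
          OF modL RR.module_axioms, of "\<lambda>r. r" \<phi>] by (simp add: inj_on_def)
    then obtain h where h: "h \<in> module_homs R (regular_module R) E" and h\<phi>: "\<forall>r\<in>L. h r = \<phi> r"
      by auto
    define e where "e = h \<one>\<^bsub>R\<^esub>"
    have e: "e \<in> carrier E"
      using module_homsD(1)[OF h] by (simp add: e_def regular_module_def)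
    have "h r = r \<odot>\<^bsub>E\<^esub> e" if "r \<in> carrier R" for r
      using module_homsD(3)[OF h that, of "\<one>\<^bsub>R\<^esub>"] that by (simp add: e_def regular_module_def)
    then have Ge: "(r \<odot>\<^bsub>B\<^esub> b, r \<odot>\<^bsub>E\<^esub> e) \<in> G" if "r \<in> L" for r
      using \<phi>[OF that] h\<phi> that LR by auto
    define G' where "G' = {(x \<oplus>\<^bsub>B\<^esub> r \<odot>\<^bsub>B\<^esub> b, y \<oplus>\<^bsub>E\<^esub> r \<odot>\<^bsub>E\<^esub> e) | x y r. (x, y) \<in> G \<and> r \<in> carrier R}"
    have G'I: "(x, y) \<in> G \<Longrightarrow> r \<in> carrier R \<Longrightarrow> u = x \<oplus>\<^bsub>B\<^esub> r \<odot>\<^bsub>B\<^esub> b \<Longrightarrow> v = y \<oplus>\<^bsub>E\<^esub> r \<odot>\<^bsub>E\<^esub> e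
        \<Longrightarrow> (u, v) \<in> G'" for u v x y r
      unfolding G'_def by blast
    have sub: "G \<subseteq> G'"
    proof
      fix p assume p: "p \<in> G"
      then show "p \<in> G'"
        using GB[of "fst p" "snd p"] GE[of "fst p" "snd p"] b e
          G'I[of "fst p" "snd p" "\<zero>\<^bsub>R\<^esub>" "fst p" "snd p"] by simp
    qed
    have "P G'"
      unfolding P_def
    proof (intro conjI allI impI ballI)
      show "G' \<subseteq> carrier B \<times> carrier E" using GB GE b e by (auto simp: G'_def)
      show "(f x, g x) \<in> G'" if "x \<in> carrier A" for x using Gfg[OF that] sub by blast
    next
      fix u v u' v' assume "(u, v) \<in> G'" "(u', v') \<in> G'"
      then obtain x y r x' y' r' where *: "(x, y) \<in> G" "r \<in> carrier R" "u = x \<oplus>\<^bsub>B\<^esub> r \<odot>\<^bsub>B\<^esub> b"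
          "v = y \<oplus>\<^bsub>E\<^esub> r \<odot>\<^bsub>E\<^esub> e" "(x', y') \<in> G" "r' \<in> carrier R"
          "u' = x' \<oplus>\<^bsub>B\<^esub> r' \<odot>\<^bsub>B\<^esub> b" "v' = y' \<oplus>\<^bsub>E\<^esub> r' \<odot>\<^bsub>E\<^esub> e"
        unfolding G'_def by blast
      show "(u \<oplus>\<^bsub>B\<^esub> u', v \<oplus>\<^bsub>E\<^esub> v') \<in> G'"
        using Gadd[OF *(1,5)] b e * GB[OF *(1)] GE[OF *(1)] GB[OF *(5)] GE[OF *(5)]
        by (intro G'I[of "x \<oplus>\<^bsub>B\<^esub> x'" "y \<oplus>\<^bsub>E\<^esub> y'" "r \<oplus>\<^bsub>R\<^esub> r'"])
          (simp_all add: B.smult_l_distr E.smult_l_distr B.M.add.m_ac E.M.add.m_ac)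
    next
      fix s u v assume s: "s \<in> carrier R" and "(u, v) \<in> G'"
      then obtain x y r where *: "(x, y) \<in> G" "r \<in> carrier R" "u = x \<oplus>\<^bsub>B\<^esub> r \<odot>\<^bsub>B\<^esub> b"
          "v = y \<oplus>\<^bsub>E\<^esub> r \<odot>\<^bsub>E\<^esub> e"
        unfolding G'_def by blast
      show "(s \<odot>\<^bsub>B\<^esub> u, s \<odot>\<^bsub>E\<^esub> v) \<in> G'"
        using Gsm[OF s *(1)] b e s * GB[OF *(1)] GE[OF *(1)]
        by (intro G'I[of "s \<odot>\<^bsub>B\<^esub> x" "s \<odot>\<^bsub>E\<^esub> y" "s \<otimes>\<^bsub>R\<^esub> r"])
          (simp_all add: B.smult_r_distr E.smult_r_distr B.smult_assoc1 E.smult_assoc1)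
    next
      fix v assume "(\<zero>\<^bsub>B\<^esub>, v) \<in> G'"
      then obtain x y r where *: "(x, y) \<in> G" "r \<in> carrier R" "\<zero>\<^bsub>B\<^esub> = x \<oplus>\<^bsub>B\<^esub> r \<odot>\<^bsub>B\<^esub> b"
          "v = y \<oplus>\<^bsub>E\<^esub> r \<odot>\<^bsub>E\<^esub> e"
        unfolding G'_def by blast
      have rb: "r \<odot>\<^bsub>B\<^esub> b = \<ominus>\<^bsub>B\<^esub> x"
        using *(2,3) GB[OF *(1)] b B.M.add.inv_equality[of "r \<odot>\<^bsub>B\<^esub> b" x] B.M.a_comm
        by (metis B.smult_closed)
      have "(r \<odot>\<^bsub>B\<^esub> b, \<ominus>\<^bsub>E\<^esub> y) \<in> G" using Gneg[OF *(1)] rb by simp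
      then have "r \<odot>\<^bsub>E\<^esub> e = \<ominus>\<^bsub>E\<^esub> y" using Guniq Ge LI[OF *(2)] by blast
      then show "v = \<zero>\<^bsub>E\<^esub>" using * GE[OF *(1)] by (simp add: E.M.r_neg)
    qed
    then have "G' = G" using maximal sub by blast
    moreover have "(b, e) \<in> G'" using b e by (intro G'I[OF G00, of "\<one>\<^bsub>R\<^esub>"]) simp_all
    ultimately show ?thesis by blast
  qed
  define h where "h b = (SOME y. (b, y) \<in> G)" for b
  have h: "(b, h b) \<in> G" if "b \<in> carrier B" for b
    using total[OF that] unfolding h_def by (rule someI_ex)
  have "h \<in> module_homs R B E"
    using GE[OF h] Guniq[OF h Gadd[OF h h]] Guniq[OF h Gsm[OF _ h]] by (auto simp: module_homs_def)
  moreover have "\<forall>x\<in>carrier A. h (f x) = g x"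
    using Guniq[OF h Gfg] module_homsD(1)[OF f] by blast
  ultimately show ?thesis by blast
qed

definition injective_hull ::
    "('r, 'x) ring_scheme \<Rightarrow> ('r, 'm, 'y) module_scheme \<Rightarrow> ('r, 'e, 'z) module_scheme \<Rightarrow> ('m \<Rightarrow> 'e) \<Rightarrow> bool"
  where "injective_hull R M E \<epsilon> \<longleftrightarrow>
    module R M \<and> injective_module R E \<and> \<epsilon> \<in> module_homs R M E \<and> inj_on \<epsilon> (carrier M) \<and>
    (\<forall>N. submodule N R E \<longrightarrow> N \<noteq> {\<zero>\<^bsub>E\<^esub>} \<longrightarrow> N \<inter> \<epsilon> ` carrier M \<noteq> {\<zero>\<^bsub>E\<^esub>})"

text \<open>Exactness of \<open>0 \<rightarrow> M \<rightarrow> I\<^sup>0 \<rightarrow> I\<^sup>1 \<rightarrow> \<dots>\<close> with all \<open>I\<^sup>n\<close> injective; \<open>d n\<close> is the map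
  \<open>I\<^sup>n \<rightarrow> I\<^sup>n\<^sup>+\<^sup>1\<close>.\<close>

definition injective_resolution ::
    "('r, 'x) ring_scheme \<Rightarrow> ('r, 'm, 'y) module_scheme \<Rightarrow>
     (nat \<Rightarrow> ('r, 'i, 'z) module_scheme) \<Rightarrow> (nat \<Rightarrow> 'i \<Rightarrow> 'i) \<Rightarrow> ('m \<Rightarrow> 'i) \<Rightarrow> bool"
  where "injective_resolution R M I d \<eta> \<longleftrightarrow>
    module R M \<and> (\<forall>n. injective_module R (I n)) \<and>
    \<eta> \<in> module_homs R M (I 0) \<and> (\<forall>n. d n \<in> module_homs R (I n) (I (Suc n))) \<and>
    inj_on \<eta> (carrier M) \<and>
    \<eta> ` carrier M = a_kernel (I 0) (I 1) (d 0) \<and>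
    (\<forall>n. d n ` carrier (I n) = a_kernel (I (Suc n)) (I (Suc (Suc n))) (d (Suc n)))"

section \<open>Local cohomology\<close>

fun coboundaries :: "(nat \<Rightarrow> ('r, 'i, 'z) module_scheme) \<Rightarrow> (nat \<Rightarrow> 'i \<Rightarrow> 'i) \<Rightarrow> nat \<Rightarrow> 'i set"
  where
    "coboundaries C d 0 = {\<zero>\<^bsub>C 0\<^esub>}"
  | "coboundaries C d (Suc n) = d n ` carrier (C n)"

definition cohomology ::
    "(nat \<Rightarrow> ('r, 'i, 'z) module_scheme) \<Rightarrow> (nat \<Rightarrow> 'i \<Rightarrow> 'i) \<Rightarrow> nat \<Rightarrow> ('r, 'i set) module"
  where "cohomology C d n =
    quotient_module ((C n)\<lparr>carrier := a_kernel (C n) (C (Suc n)) (d n)\<rparr>) (coboundaries C d n)"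

definition torsion_submodule ::
    "('r, 'x) ring_scheme \<Rightarrow> 'r set \<Rightarrow> ('r, 'm, 'y) module_scheme \<Rightarrow> ('r, 'm, 'y) module_scheme"
  where "torsion_submodule R \<aa> M = M\<lparr>carrier :=
    {x \<in> carrier M. \<exists>n::nat. \<forall>r \<in> \<aa> [^]\<^bsub>ideals_set R\<^esub> n. r \<odot>\<^bsub>M\<^esub> x = \<zero>\<^bsub>M\<^esub>}\<rparr>"

text \<open>Local cohomology is the right derived functor of the torsion functor: \<open>H\<^sup>i\<^sub>\<aa>(M)\<close> is the cohomology
  of \<open>\<Gamma>\<^sub>\<aa>(I)\<close> for an injective resolution \<open>I\<close> of \<open>M\<close>, and vanishes for negative \<open>i\<close>. A resolution
  lives on a type that is not determined by the type of \<open>M\<close>, so the resolution is an explicit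
  argument, in place of \<open>M\<close>, of the derived notions; up to isomorphism they depend on \<open>M\<close> only.\<close>

definition local_cohomology ::
    "('r, 'x) ring_scheme \<Rightarrow> 'r set \<Rightarrow> (nat \<Rightarrow> ('r, 'i, 'z) module_scheme) \<Rightarrow> (nat \<Rightarrow> 'i \<Rightarrow> 'i) \<Rightarrow> nat \<Rightarrow>
     ('r, 'i set) module"
  where "local_cohomology R \<aa> I d i = cohomology (\<lambda>n. torsion_submodule R \<aa> (I n)) d i"

definition relative_Cohen_Macaulay ::
    "('r, 'x) ring_scheme \<Rightarrow> 'r set \<Rightarrow> (nat \<Rightarrow> ('r, 'i, 'z) module_scheme) \<Rightarrow> (nat \<Rightarrow> 'i \<Rightarrow> 'i) \<Rightarrow> bool"
  where "relative_Cohen_Macaulay R \<aa> I d \<longleftrightarrow> (\<exists>!j. \<not> zero_module (local_cohomology R \<aa> I d j))"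

text \<open>The supremum is taken in \<^typ>\<open>ereal\<close> so that it is \<open>-\<infinity>\<close> if all local cohomology vanishes.\<close>

definition cohomological_dimension ::
    "('r, 'x) ring_scheme \<Rightarrow> 'r set \<Rightarrow> (nat \<Rightarrow> ('r, 'i, 'z) module_scheme) \<Rightarrow> (nat \<Rightarrow> 'i \<Rightarrow> 'i) \<Rightarrow> ereal"
  where "cohomological_dimension R \<aa> I d =
    (SUP j \<in> {j. \<not> zero_module (local_cohomology R \<aa> I d j)}. ereal (real j))"

section \<open>Noetherian local rings\<close>

definition noetherian_local_ring :: "('r, 'x) ring_scheme \<Rightarrow> 'r set \<Rightarrow> bool"
  where "noetherian_local_ring R \<mm> \<longleftrightarrow>
    cring R \<and> noetherian_ring R \<and> maximalideal \<mm> R \<and> (\<forall>\<nn>. maximalideal \<nn> R \<longrightarrow> \<nn> = \<mm>)"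

definition residue_field :: "('r, 'x) ring_scheme \<Rightarrow> 'r set \<Rightarrow> ('r, 'r set) module"
  where "residue_field R \<mm> = quotient_module (regular_module R) \<mm>"

text \<open>\<open>K\<^sup>i\<^sub>\<aa>(M) = Hom\<^sub>R(H\<^sup>i\<^sub>\<aa>(M), E)\<close> for an injective resolution \<open>I\<close> of \<open>M\<close> and an injective hull
  \<open>E\<close> of the residue field.\<close>

definition dual_local_cohomology ::
    "('r, 'x) ring_scheme \<Rightarrow> 'r set \<Rightarrow> ('r, 'e, 'y) module_scheme \<Rightarrow>
     (nat \<Rightarrow> ('r, 'i, 'z) module_scheme) \<Rightarrow> (nat \<Rightarrow> 'i \<Rightarrow> 'i) \<Rightarrow> nat \<Rightarrow> ('r, 'i set \<Rightarrow> 'e) module"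
  where "dual_local_cohomology R \<aa> E I d i = Hom_module R (local_cohomology R \<aa> I d i) E"

end

theory Submission
  imports Defs
begin

text \<open>
  Only \<open>i = c\<close> is at stake, since \<open>H\<^sup>i\<^sub>\<aa>(R) = 0\<close> otherwise. Write \<open>H = H\<^sup>c\<^sub>\<aa>(R)\<close> and \<open>K = Hom(H, E)\<close>. For an
  ideal \<open>b \<supseteq> \<aa>\<^sup>n\<close> the heart of the matter is that \<open>Tor\<^sub>j(R/b, H)\<close> is \<open>R/b\<close> for \<open>j = c\<close> and \<open>0\<close> otherwise.
  By duality \<open>Ext\<^sup>j(R/b, K) = Hom(Tor\<^sub>j(R/b, H), E)\<close>, so this determines where \<open>J[b] = Hom(R/b, J)\<close> has
  cohomology, and \<open>\<Gamma>\<^sub>\<aa>(J)\<close> is the union of the complexes \<open>J[\<aa>\<^sup>n]\<close>.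

  To compute the Tor modules, let \<open>\<aa> = (x\<^sub>0, \<dots>, x\<^sub>p\<^sub>-\<^sub>1)\<close> and let \<open>C\<^sub>k \<subseteq> I\<close> be the subcomplex of elements that are
  torsion for \<open>x\<^sub>0, \<dots>, x\<^sub>k\<^sub>-\<^sub>1\<close>. As \<open>R\<close> is Noetherian and \<open>I\<close> is injective, \<open>x\<^sub>k\<close> acts bijectively on \<open>C\<^sub>k/C\<^sub>k\<^sub>+\<^sub>1\<close>,
  whereas a power of \<open>x\<^sub>k\<close> annihilates \<open>R/b\<close>. Hence \<open>Tor(R/b, I/\<Gamma>\<^sub>\<aa>(I)) = 0\<close> in each degree of the complex, and
  likewise for the cocycles of \<open>I/\<Gamma>\<^sub>\<aa>(I)\<close> in high degrees. Dimension shifting along the complexes \<open>I\<close>, which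
  resolves \<open>R\<close>, and \<open>\<Gamma>\<^sub>\<aa>(I)\<close>, whose only cohomology is \<open>H\<close>, gives \<open>Tor\<^sub>j(R/b, H) = Tor\<^sub>j\<^sub>-\<^sub>c(R/b, R)\<close>.
\<close>

section \<open>Linear combinations\<close>

text \<open>Only the vanishing of Tor and Ext is ever recorded, as solvability of linear systems
  over a finite free resolution of \<open>R/b\<close>; the isomorphisms of the overview become
  equivalences between vanishing statements. No tensor products have to be formed. Why
  \<open>x k\<close> acts bijectively on \<open>C k / C (k+1)\<close>: for \<open>m\<close> in an
  injective module the annihilators of the elements \<open>y^k m\<close> become stationary, and from
  then on \<open>y^(k+1) m' = y^k m\<close> can be solved for \<open>m'\<close>. Each further
  generator costs one degree of acyclicity of \<open>C k\<close>, whence the restriction to high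
  degrees for the cocycles; a descending induction carries the vanishing down to degree
  \<open>c\<close>. Exactness of all \<open>J[\<aa>^n]\<close> passes to their union, but a nonzero
  class of one of them might die there. Excluding this is the reason for treating every ideal
  \<open>b\<close> that contains some \<open>\<aa>^n\<close>, and not just the powers: annihilators
  of torsion elements of \<open>J\<close> take the place of \<open>b\<close>. Locality makes the
  hull of the residue field a cogenerator, so that vanishing of Ext for the dual gives back
  vanishing of Tor.\<close>

primrec lin :: "('r, 'm, 'y) module_scheme \<Rightarrow> nat \<Rightarrow> (nat \<Rightarrow> 'r) \<Rightarrow> (nat \<Rightarrow> 'm) \<Rightarrow> 'm"
  where
    "lin M 0 v z = \<zero>\<^bsub>M\<^esub>"
  | "lin M (Suc n) v z = lin M n v z \<oplus>\<^bsub>M\<^esub> v n \<odot>\<^bsub>M\<^esub> z n"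

text \<open>Vectors are total functions whose entries from \<open>n\<close> on are junk; this rule
  is what permits changing those entries, for example by restriction or by padding with
  zeros.\<close>

lemma lin_cong:
  "(\<And>l. l < n \<Longrightarrow> v l = v' l) \<Longrightarrow> (\<And>l. l < n \<Longrightarrow> z l = z' l) \<Longrightarrow> lin M n v z = lin M n v' z'"
  by (induction n) auto

context module
begin

lemma submoduleD:
  assumes "submodule B R M"
  shows "x \<in> B \<Longrightarrow> x \<in> carrier M" "\<zero>\<^bsub>M\<^esub> \<in> B" "x \<in> B \<Longrightarrow> y \<in> B \<Longrightarrow> x \<oplus>\<^bsub>M\<^esub> y \<in> B"
    "x \<in> B \<Longrightarrow> \<ominus>\<^bsub>M\<^esub> x \<in> B" "x \<in> B \<Longrightarrow> y \<in> B \<Longrightarrow> x \<ominus>\<^bsub>M\<^esub> y \<in> B"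
    "s \<in> carrier R \<Longrightarrow> x \<in> B \<Longrightarrow> s \<odot>\<^bsub>M\<^esub> x \<in> B"
proof -
  show "\<zero>\<^bsub>M\<^esub> \<in> B"
    using subgroup.one_closed[OF submodule.axioms(1)[OF assms]] by simp
qed (use submoduleE[OF assms] in \<open>auto simp: a_minus_def\<close>)

lemma submodule_if_closed:
  assumes sub: "A \<subseteq> carrier M" and "\<zero>\<^bsub>M\<^esub> \<in> A"
    and "\<And>x y. x \<in> A \<Longrightarrow> y \<in> A \<Longrightarrow> x \<oplus>\<^bsub>M\<^esub> y \<in> A"
    and smult: "\<And>s x. s \<in> carrier R \<Longrightarrow> x \<in> A \<Longrightarrow> s \<odot>\<^bsub>M\<^esub> x \<in> A"
  shows "submodule A R M"
proof (rule submoduleI)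
  show "\<ominus>\<^bsub>M\<^esub> x \<in> A" if "x \<in> A" for x
    using smult[of "\<ominus>\<^bsub>R\<^esub> \<one>\<^bsub>R\<^esub>" x] smult_l_minus[of "\<one>\<^bsub>R\<^esub>" x] that sub by auto
qed (use assms in auto)

lemma submodule_zero: "submodule {\<zero>\<^bsub>M\<^esub>} R M"
  by (rule submoduleI) auto

lemma submodule_inter: "submodule A R M \<Longrightarrow> submodule B R M \<Longrightarrow> submodule (A \<inter> B) R M"
  by (rule submoduleI) (auto dest: submoduleD)

lemma smult_minus:
  assumes "s \<in> carrier R" "x \<in> carrier M" "y \<in> carrier M"
  shows "s \<odot>\<^bsub>M\<^esub> (x \<ominus>\<^bsub>M\<^esub> y) = s \<odot>\<^bsub>M\<^esub> x \<ominus>\<^bsub>M\<^esub> s \<odot>\<^bsub>M\<^esub> y"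
  using assms by (simp add: a_minus_def smult_r_distr smult_r_minus)

lemma add_minus_cancel:
  assumes "x \<in> carrier M" "y \<in> carrier M"
  shows "(x \<ominus>\<^bsub>M\<^esub> y) \<oplus>\<^bsub>M\<^esub> y = x" "(x \<oplus>\<^bsub>M\<^esub> y) \<ominus>\<^bsub>M\<^esub> y = x" "x \<ominus>\<^bsub>M\<^esub> (x \<ominus>\<^bsub>M\<^esub> y) = y"
    "(x \<ominus>\<^bsub>M\<^esub> y = \<zero>\<^bsub>M\<^esub>) = (x = y)" "x \<oplus>\<^bsub>M\<^esub> (y \<ominus>\<^bsub>M\<^esub> x) = y"
proof -
  show 1: "(x \<ominus>\<^bsub>M\<^esub> y) \<oplus>\<^bsub>M\<^esub> y = x" "(x \<oplus>\<^bsub>M\<^esub> y) \<ominus>\<^bsub>M\<^esub> y = x"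
    using assms by (simp_all add: a_minus_def M.a_assoc M.l_neg M.r_neg)
  show "x \<ominus>\<^bsub>M\<^esub> (x \<ominus>\<^bsub>M\<^esub> y) = y" "x \<oplus>\<^bsub>M\<^esub> (y \<ominus>\<^bsub>M\<^esub> x) = y"
    using assms by (simp_all add: a_minus_def M.minus_add M.a_assoc[symmetric] M.r_neg)
      (simp add: M.a_comm[of x] M.a_assoc M.r_neg)
  show "(x \<ominus>\<^bsub>M\<^esub> y = \<zero>\<^bsub>M\<^esub>) = (x = y)"
  proof
    assume "x \<ominus>\<^bsub>M\<^esub> y = \<zero>\<^bsub>M\<^esub>"
    then show "x = y" using 1 assms by simp
  qed (use assms in \<open>simp add: a_minus_def M.r_neg\<close>)
qed

lemma diff_trans:
  assumes "submodule B R M" and c: "x \<in> carrier M" "y \<in> carrier M" "z \<in> carrier M"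
    and "x \<ominus>\<^bsub>M\<^esub> y \<in> B" "y \<ominus>\<^bsub>M\<^esub> z \<in> B"
  shows "x \<ominus>\<^bsub>M\<^esub> z \<in> B"
proof -
  have "x \<ominus>\<^bsub>M\<^esub> z = (x \<ominus>\<^bsub>M\<^esub> y) \<oplus>\<^bsub>M\<^esub> (y \<ominus>\<^bsub>M\<^esub> z)"
    using c by (simp add: a_minus_def M.a_assoc M.r_neg1)
  then show ?thesis using submoduleD(3)[OF assms(1)] assms by simp
qed

lemma diff_mem_iff:
  assumes B: "submodule B R M" and c: "x \<in> carrier M" "y \<in> carrier M" and d: "x \<ominus>\<^bsub>M\<^esub> y \<in> B"
  shows "x \<in> B \<longleftrightarrow> y \<in> B"
  using add_minus_cancel[OF c] submoduleD(3)[OF B d, of y] submoduleD(5)[OF B _ d, of x] by auto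

lemma lin_closed [simp, intro]:
  "(\<And>l. l < n \<Longrightarrow> v l \<in> carrier R) \<Longrightarrow> (\<And>l. l < n \<Longrightarrow> z l \<in> carrier M) \<Longrightarrow> lin M n v z \<in> carrier M"
  by (induction n) auto

lemma lin_submodule:
  assumes "submodule B R M"
  shows "(\<And>l. l < n \<Longrightarrow> v l \<in> carrier R) \<Longrightarrow> (\<And>l. l < n \<Longrightarrow> z l \<in> B) \<Longrightarrow> lin M n v z \<in> B"
  by (induction n) (auto intro: submoduleD[OF assms])

lemma lin_zero_right [simp]:
  "(\<And>l. l < n \<Longrightarrow> v l \<in> carrier R) \<Longrightarrow> lin M n v (\<lambda>l. \<zero>\<^bsub>M\<^esub>) = \<zero>\<^bsub>M\<^esub>"
  by (induction n) auto

lemma lin_add_right: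
  "(\<And>l. l < n \<Longrightarrow> v l \<in> carrier R) \<Longrightarrow> (\<And>l. l < n \<Longrightarrow> z l \<in> carrier M) \<Longrightarrow>
   (\<And>l. l < n \<Longrightarrow> z' l \<in> carrier M) \<Longrightarrow>
   lin M n v (\<lambda>l. z l \<oplus>\<^bsub>M\<^esub> z' l) = lin M n v z \<oplus>\<^bsub>M\<^esub> lin M n v z'"
  by (induction n) (simp_all add: smult_r_distr M.add.m_ac)

lemma lin_minus_right:
  "(\<And>l. l < n \<Longrightarrow> v l \<in> carrier R) \<Longrightarrow> (\<And>l. l < n \<Longrightarrow> z l \<in> carrier M) \<Longrightarrow>
   (\<And>l. l < n \<Longrightarrow> z' l \<in> carrier M) \<Longrightarrow>
   lin M n v (\<lambda>l. z l \<ominus>\<^bsub>M\<^esub> z' l) = lin M n v z \<ominus>\<^bsub>M\<^esub> lin M n v z'"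
  by (induction n) (simp_all add: smult_r_distr smult_r_minus a_minus_def M.minus_add M.add.m_ac M.r_neg)

lemma lin_smult_right:
  "(\<And>l. l < n \<Longrightarrow> v l \<in> carrier R) \<Longrightarrow> (\<And>l. l < n \<Longrightarrow> z l \<in> carrier M) \<Longrightarrow> s \<in> carrier R \<Longrightarrow>
   lin M n v (\<lambda>l. s \<odot>\<^bsub>M\<^esub> z l) = s \<odot>\<^bsub>M\<^esub> lin M n v z"
  by (induction n) (simp_all add: smult_r_distr smult_assoc1[symmetric] R.m_comm)

lemma lin_add_left:
  "(\<And>l. l < n \<Longrightarrow> v l \<in> carrier R) \<Longrightarrow> (\<And>l. l < n \<Longrightarrow> v' l \<in> carrier R) \<Longrightarrow>
   (\<And>l. l < n \<Longrightarrow> z l \<in> carrier M) \<Longrightarrow>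
   lin M n (\<lambda>l. v l \<oplus>\<^bsub>R\<^esub> v' l) z = lin M n v z \<oplus>\<^bsub>M\<^esub> lin M n v' z"
  by (induction n) (simp_all add: smult_l_distr M.add.m_ac)

lemma lin_smult_left:
  "(\<And>l. l < n \<Longrightarrow> v l \<in> carrier R) \<Longrightarrow> (\<And>l. l < n \<Longrightarrow> z l \<in> carrier M) \<Longrightarrow> s \<in> carrier R \<Longrightarrow>
   lin M n (\<lambda>l. s \<otimes>\<^bsub>R\<^esub> v l) z = s \<odot>\<^bsub>M\<^esub> lin M n v z"
  by (induction n) (simp_all add: smult_r_distr smult_assoc1)

lemma lin_zero_left [simp]:
  "(\<And>l. l < n \<Longrightarrow> z l \<in> carrier M) \<Longrightarrow> lin M n (\<lambda>l. \<zero>\<^bsub>R\<^esub>) z = \<zero>\<^bsub>M\<^esub>"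
  by (induction n) auto

lemma lin_unit:
  "i < n \<Longrightarrow> (\<And>l. l < n \<Longrightarrow> v l \<in> carrier R) \<Longrightarrow> m \<in> carrier M \<Longrightarrow>
   lin M n v (\<lambda>l. if l = i then m else \<zero>\<^bsub>M\<^esub>) = v i \<odot>\<^bsub>M\<^esub> m"
proof (induction n)
  case (Suc n)
  show ?case
  proof (cases "i = n")
    case True
    have "lin M n v (\<lambda>l. if l = i then m else \<zero>\<^bsub>M\<^esub>) = lin M n v (\<lambda>l. \<zero>\<^bsub>M\<^esub>)"
      using True by (intro lin_cong) auto
    then show ?thesis using Suc.prems True by simp
  qed (use Suc in auto)
qed simp

text \<open>With all coefficients \<open>\<one>\<close>, \<open>lin\<close> is the plain finite sum.
  Sums of values of several homomorphisms are written in this way below, and the rule turns them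
  back into linear combinations.\<close>

lemma lin_one:
  "(\<And>l. l < n \<Longrightarrow> v l \<in> carrier R) \<Longrightarrow> (\<And>l. l < n \<Longrightarrow> z l \<in> carrier M) \<Longrightarrow>
   lin M n (\<lambda>_. \<one>\<^bsub>R\<^esub>) (\<lambda>l. v l \<odot>\<^bsub>M\<^esub> z l) = lin M n v z"
  by (induction n) auto

lemma lin_unit_left:
  assumes "i < n" "s \<in> carrier R" "\<And>l. l < n \<Longrightarrow> z l \<in> carrier M"
  shows "lin M n (\<lambda>l. if l = i then s else \<zero>\<^bsub>R\<^esub>) z = s \<odot>\<^bsub>M\<^esub> z i"
proof -
  have "lin M n (\<lambda>l. if l = i then s else \<zero>\<^bsub>R\<^esub>) z =
      lin M n (\<lambda>_. \<one>\<^bsub>R\<^esub>) (\<lambda>l. if l = i then s \<odot>\<^bsub>M\<^esub> z i else \<zero>\<^bsub>M\<^esub>)"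
    using assms by (subst lin_one[symmetric]) (auto intro!: lin_cong)
  then show ?thesis using assms lin_unit[of i n "\<lambda>_. \<one>\<^bsub>R\<^esub>" "s \<odot>\<^bsub>M\<^esub> z i"] by simp
qed

lemma lin_append:
  "(\<And>l. l < m + n \<Longrightarrow> v l \<in> carrier R) \<Longrightarrow> (\<And>l. l < m + n \<Longrightarrow> z l \<in> carrier M) \<Longrightarrow>
   lin M (m + n) v z = lin M m v z \<oplus>\<^bsub>M\<^esub> lin M n (\<lambda>l. v (m + l)) (\<lambda>l. z (m + l))"
  by (induction n) (simp_all add: M.a_assoc)

end

section \<open>Homomorphisms, and factorization of maps into injective modules\<close>

lemma module_homs_zero:
  assumes "module R M" "module R N" "f \<in> module_homs R M N"
  shows "f \<zero>\<^bsub>M\<^esub> = \<zero>\<^bsub>N\<^esub>"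
proof -
  interpret M: module R M by fact
  interpret N: module R N by fact
  show ?thesis
    using module_homsD(3)[OF assms(3), of "\<zero>\<^bsub>R\<^esub>" "\<zero>\<^bsub>M\<^esub>"]
      module_homsD(1)[OF assms(3), of "\<zero>\<^bsub>M\<^esub>"] by simp
qed

lemma module_homs_uminus:
  assumes "module R M" "module R N" "f \<in> module_homs R M N" "x \<in> carrier M"
  shows "f (\<ominus>\<^bsub>M\<^esub> x) = \<ominus>\<^bsub>N\<^esub> f x"
proof -
  interpret M: module R M by fact
  interpret N: module R N by fact
  have "f (\<ominus>\<^bsub>M\<^esub> x) \<oplus>\<^bsub>N\<^esub> f x = \<zero>\<^bsub>N\<^esub>"
    using module_homsD(2)[OF assms(3), of "\<ominus>\<^bsub>M\<^esub> x" x] module_homs_zero[OF assms(1-3)] assms(4)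
    by (simp add: M.M.l_neg)
  then show ?thesis
    using N.M.minus_equality[of "f (\<ominus>\<^bsub>M\<^esub> x)" "f x"] module_homsD(1)[OF assms(3)] assms(4) by simp
qed

lemma module_homs_minus:
  assumes "module R M" "module R N" "f \<in> module_homs R M N" "x \<in> carrier M" "y \<in> carrier M"
  shows "f (x \<ominus>\<^bsub>M\<^esub> y) = f x \<ominus>\<^bsub>N\<^esub> f y"
proof -
  interpret M: module R M by fact
  show ?thesis
    using assms module_homs_uminus[OF assms(1-3)] module_homsD(2)[OF assms(3)]
    by (simp add: a_minus_def)
qed

lemma module_homs_comp:
  "f \<in> module_homs R A B \<Longrightarrow> g \<in> module_homs R B C \<Longrightarrow> (\<lambda>x. g (f x)) \<in> module_homs R A C"
  by (auto simp: module_homs_def Pi_def)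

lemma image_submodule:
  assumes "module R A" "module R B" and f: "f \<in> module_homs R A B" and S: "submodule S R A"
  shows "submodule (f ` S) R B"
proof -
  interpret A: module R A by fact
  interpret B: module R B by fact
  note SD = A.submoduleD[OF S]
  show ?thesis
  proof (rule B.submodule_if_closed)
    show "\<zero>\<^bsub>B\<^esub> \<in> f ` S" using module_homs_zero[OF assms(1-3)] SD(2) by (metis image_eqI)
    show "x \<oplus>\<^bsub>B\<^esub> y \<in> f ` S" if xy: "x \<in> f ` S" "y \<in> f ` S" for x y
    proof -
      obtain u v where "u \<in> S" "v \<in> S" "x = f u" "y = f v" using xy by blast
      then show ?thesis using SD(1,3) module_homsD(2)[OF f] by (intro image_eqI[of _ _ "u \<oplus>\<^bsub>A\<^esub> v"]) auto
    qed
    show "s \<odot>\<^bsub>B\<^esub> x \<in> f ` S" if s: "s \<in> carrier R" and x: "x \<in> f ` S" for s x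
    proof -
      obtain u where "u \<in> S" "x = f u" using x by blast
      then show ?thesis using SD(1,6) s module_homsD(3)[OF f] by (intro image_eqI[of _ _ "s \<odot>\<^bsub>A\<^esub> u"]) auto
    qed
  qed (use module_homsD(1)[OF f] SD(1) in auto)
qed

text \<open>A map that kills the kernel of \<open>f\<close> descends to the image of
  \<open>f\<close>, and injectivity of \<open>E\<close> extends it from there to \<open>B\<close>.
  In this form \<open>f\<close> itself need not be injective, which is how exactness of
  \<open>Hom(-, E)\<close> is used.\<close>

lemma injective_factor:
  assumes E: "injective_module R E" and A: "module R A" and B: "module R B"
    and f: "f \<in> module_homs R A B" and g: "g \<in> module_homs R A E"
    and ker: "\<And>x. x \<in> carrier A \<Longrightarrow> f x = \<zero>\<^bsub>B\<^esub> \<Longrightarrow> g x = \<zero>\<^bsub>E\<^esub>"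
  obtains h where "h \<in> module_homs R B E" "\<And>x. x \<in> carrier A \<Longrightarrow> h (f x) = g x"
proof -
  interpret A: module R A by fact
  interpret B: module R B by fact
  interpret E: module R E using E by (simp add: injective_module_def)
  let ?D = "B\<lparr>carrier := f ` carrier A\<rparr>"
  note D = image_submodule[OF A B f A.carrier_is_submodule]
  \<comment> \<open>An arbitrary preimage will do: two of them differ by an element of the kernel of
    \<open>f\<close>, which \<open>g\<close> kills.\<close>
  define g' where "g' u = g (SOME x. x \<in> carrier A \<and> f x = u)" for u
  have g': "g' (f x) = g x" if x: "x \<in> carrier A" for x
  proof -
    let ?y = "SOME y. y \<in> carrier A \<and> f y = f x"
    have y: "?y \<in> carrier A \<and> f ?y = f x" by (rule someI_ex) (use x in blast)
    then have "f (?y \<ominus>\<^bsub>A\<^esub> x) = \<zero>\<^bsub>B\<^esub>"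
      using module_homs_minus[OF A B f, of ?y x] B.add_minus_cancel(4)[of "f x" "f x"]
        module_homsD(1)[OF f x] x by simp
    then have "g (?y \<ominus>\<^bsub>A\<^esub> x) = \<zero>\<^bsub>E\<^esub>" using ker y x by simp
    then show ?thesis
      using module_homs_minus[OF A E.module_axioms g, of ?y x] E.add_minus_cancel(4)[of "g ?y" "g x"]
        module_homsD(1)[OF g] y x by (simp add: g'_def)
  qed
  have "g' \<in> module_homs R ?D E"
    using module_homsD[OF g] g' module_homsD(2,3)[OF f, symmetric] by (auto simp: module_homs_def)
  moreover have "(\<lambda>u. u) \<in> module_homs R ?D B"
    using module_homsD(1)[OF f] by (auto simp: module_homs_def)
  ultimately obtain h where "h \<in> module_homs R B E" "\<forall>u\<in>f ` carrier A. h u = g' u"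
    using injective_module_extends[OF E submodule.submodule_is_module[OF D B] B, of "\<lambda>u. u" g']
    by (auto simp: inj_on_def)
  then show thesis using that[of h] g' by simp
qed

lemma module_homs_lin:
  assumes "module R M" "module R N" and f: "f \<in> module_homs R M N"
  shows "(\<And>l. l < n \<Longrightarrow> v l \<in> carrier R) \<Longrightarrow> (\<And>l. l < n \<Longrightarrow> z l \<in> carrier M) \<Longrightarrow>
    f (lin M n v z) = lin N n v (\<lambda>l. f (z l))"
proof (induction n)
  case 0
  then show ?case using module_homs_zero[OF assms] by simp
next
  case (Suc n)
  interpret M: module R M by fact
  from Suc show ?case
    by (simp add: module_homsD(2)[OF f] module_homsD(3)[OF f])
qed

lemma regular_module_simps [simp]:
  "carrier (regular_module R) = carrier R" "\<zero>\<^bsub>regular_module R\<^esub> = \<zero>\<^bsub>R\<^esub>"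
  "x \<oplus>\<^bsub>regular_module R\<^esub> y = x \<oplus>\<^bsub>R\<^esub> y" "x \<odot>\<^bsub>regular_module R\<^esub> y = x \<otimes>\<^bsub>R\<^esub> y"
  "\<ominus>\<^bsub>regular_module R\<^esub> x = \<ominus>\<^bsub>R\<^esub> x" "x \<ominus>\<^bsub>regular_module R\<^esub> y = x \<ominus>\<^bsub>R\<^esub> y"
  by (simp_all add: regular_module_def a_inv_def m_inv_def a_minus_def)

section \<open>Matrix calculus over the ring\<close>

context module
begin

lemma regular: "module R (regular_module R)"
  by (rule regular_module_is_module) (rule R.is_cring)

lemma orbit_hom: "z \<in> carrier M \<Longrightarrow> (\<lambda>s. s \<odot>\<^bsub>M\<^esub> z) \<in> module_homs R (regular_module R) M"
  by (auto simp: module_homs_def smult_l_distr smult_assoc1)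

lemma lin_regular_closed [simp, intro]:
  "(\<And>l. l < n \<Longrightarrow> v l \<in> carrier R) \<Longrightarrow> (\<And>l. l < n \<Longrightarrow> z l \<in> carrier R) \<Longrightarrow>
   lin (regular_module R) n v z \<in> carrier R"
  using module.lin_closed[OF regular, of n v z] by simp

lemma lin_smult_lin:
  assumes "\<And>l. l < n \<Longrightarrow> v l \<in> carrier R" "\<And>l. l < n \<Longrightarrow> w l \<in> carrier R" "z \<in> carrier M"
  shows "lin (regular_module R) n v w \<odot>\<^bsub>M\<^esub> z = lin M n v (\<lambda>l. w l \<odot>\<^bsub>M\<^esub> z)"
  using module_homs_lin[OF regular module_axioms orbit_hom[OF assms(3)], of n v w] assms by simp

text \<open>Interchange of two finite sums, that is, associativity of the action of matrices on
  vectors with entries in \<open>M\<close>.\<close>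

lemma lin_lin:
  "(\<And>l. l < n \<Longrightarrow> v l \<in> carrier R) \<Longrightarrow> (\<And>l k. l < n \<Longrightarrow> k < m \<Longrightarrow> B l k \<in> carrier R) \<Longrightarrow>
   (\<And>k. k < m \<Longrightarrow> z k \<in> carrier M) \<Longrightarrow>
   lin M n v (\<lambda>l. lin M m (B l) z) = lin M m (\<lambda>k. lin (regular_module R) n v (\<lambda>l. B l k)) z"
proof (induction m)
  case (Suc m)
  then show ?case
    using lin_add_right[of n v "\<lambda>l. lin M m (B l) z" "\<lambda>l. B l m \<odot>\<^bsub>M\<^esub> z m"]
      lin_smult_lin[of n v "\<lambda>l. B l m" "z m"] by simp
qed simp

lemma lin_regular_commute:
  "(\<And>l. l < n \<Longrightarrow> v l \<in> carrier R) \<Longrightarrow> (\<And>l. l < n \<Longrightarrow> w l \<in> carrier R) \<Longrightarrow>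
   lin (regular_module R) n v w = lin (regular_module R) n w v"
  by (induction n) (simp_all add: R.m_comm)

end

section \<open>Noetherian rings and finite free resolutions\<close>

text \<open>The maximum condition, through which all later arguments use that the ring is
  Noetherian. The union of a chain of ideals belongs to the chain, so Zorn's lemma applies to any
  nonempty set of ideals.\<close>

lemma (in noetherian_ring) exists_maximal_ideal_in:
  assumes "S \<noteq> {}" and ideals: "\<And>L. L \<in> S \<Longrightarrow> ideal L R"
  obtains L where "L \<in> S" "\<And>L'. L' \<in> S \<Longrightarrow> L \<subseteq> L' \<Longrightarrow> L' = L"
proof -
  have "\<exists>L\<in>S. \<forall>L'\<in>S. L \<subseteq> L' \<longrightarrow> L' = L"
  proof (rule subset_Zorn_nonempty)
    fix C assume C: "C \<noteq> {}" "subset.chain S C"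
    then have "subset.chain {L. ideal L R} C" using ideals by (auto simp: subset.chain_def)
    then show "\<Union>C \<in> S" using ideal_chain_is_trivial[OF C(1)] C(2) by (auto simp: subset.chain_def)
  qed fact
  then show thesis using that by blast
qed

lemma (in cring) ideal_if_closed:
  assumes sub: "A \<subseteq> carrier R" and zero: "\<zero> \<in> A"
    and add: "\<And>x y. x \<in> A \<Longrightarrow> y \<in> A \<Longrightarrow> x \<oplus> y \<in> A"
    and mult: "\<And>s x. s \<in> carrier R \<Longrightarrow> x \<in> A \<Longrightarrow> s \<otimes> x \<in> A"
  shows "ideal A R"
proof (rule idealI)
  have "\<ominus> x \<in> A" if "x \<in> A" for x
    using mult[of "\<ominus> \<one>" x] that sub by (auto simp: l_minus)
  then show "subgroup A (add_monoid R)"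
    using assms by (auto intro!: add.subgroupI simp: a_inv_def)
  show "x \<otimes> s \<in> A" if "s \<in> carrier R" "x \<in> A" for s x
    using mult[OF that] that sub m_comm[of s x] by auto
qed (use ring_axioms mult in auto)

lemma (in cring) idealD:
  assumes "ideal A R"
  shows "x \<in> A \<Longrightarrow> x \<in> carrier R" "\<zero> \<in> A" "x \<in> A \<Longrightarrow> y \<in> A \<Longrightarrow> x \<oplus> y \<in> A"
    "s \<in> carrier R \<Longrightarrow> x \<in> A \<Longrightarrow> s \<otimes> x \<in> A" "x \<in> A \<Longrightarrow> \<ominus> x \<in> A" "x \<in> A \<Longrightarrow> y \<in> A \<Longrightarrow> x \<ominus> y \<in> A"
proof -
  interpret A: ideal A R by fact
  show "x \<in> A \<Longrightarrow> x \<in> carrier R" "\<zero> \<in> A" "x \<in> A \<Longrightarrow> y \<in> A \<Longrightarrow> x \<oplus> y \<in> A"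
    "s \<in> carrier R \<Longrightarrow> x \<in> A \<Longrightarrow> s \<otimes> x \<in> A" "x \<in> A \<Longrightarrow> \<ominus> x \<in> A" "x \<in> A \<Longrightarrow> y \<in> A \<Longrightarrow> x \<ominus> y \<in> A"
    using A.a_subset A.zero_closed A.a_closed A.I_l_closed A.a_inv_closed
    by (auto simp: a_minus_def)
qed

abbreviation (in cring) RM :: "('a, 'a) module"
  where "RM \<equiv> regular_module R"

abbreviation (in cring) ideal_power :: "'a set \<Rightarrow> nat \<Rightarrow> 'a set"
  where "ideal_power A n \<equiv> A [^]\<^bsub>ideals_set R\<^esub> n"

locale noetherian_cring = cring R + noetherian_ring R for R (structure)
begin

sublocale RR: module R "regular_module R"
  by (rule regular_module_is_module) (rule is_cring)

text \<open>Take \<open>K\<close> maximal among the ideals generated by finitely many elements of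
  \<open>L\<close>. Adjoining \<open>y \<in> L\<close> as one more generator cannot enlarge
  \<open>K\<close>, hence \<open>y \<in> K\<close>.\<close>

lemma ideal_generators:
  assumes L: "ideal L R"
  obtains p x where "\<And>l. l < p \<Longrightarrow> x l \<in> L"
    "\<And>y. y \<in> L \<Longrightarrow> \<exists>w. (\<forall>l<p. w l \<in> carrier R) \<and> y = lin RM p w x"
proof -
  define G where "G p x = {lin RM p w x | w. \<forall>l<p. w l \<in> carrier R}" for p x
  define S where "S = {G p x | p x. \<forall>l<p. x l \<in> L}"
  have idl: "ideal K R" if "K \<in> S" for K
  proof -
    from that obtain p x where K: "K = G p x" and x: "\<And>l. l < p \<Longrightarrow> x l \<in> carrier R"
      using idealD(1)[OF L] by (auto simp: S_def)
    show ?thesis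
    proof (rule ideal_if_closed)
      show "K \<subseteq> carrier R" using x by (auto simp: K G_def)
      show "\<zero> \<in> K"
        unfolding K G_def using x RR.lin_zero_left[of p x] by (auto intro!: exI[of _ "\<lambda>l. \<zero>"])
    next
      fix u v assume "u \<in> K" "v \<in> K"
      then obtain w w' where "\<forall>l<p. w l \<in> carrier R" "u = lin RM p w x"
        "\<forall>l<p. w' l \<in> carrier R" "v = lin RM p w' x" by (auto simp: K G_def)
      then show "u \<oplus> v \<in> K"
        unfolding K G_def using x RR.lin_add_left[of p w w' x]
        by (auto intro!: exI[of _ "\<lambda>l. w l \<oplus> w' l"])
    next
      fix s u assume "s \<in> carrier R" "u \<in> K"
      then obtain w where "s \<in> carrier R" "\<forall>l<p. w l \<in> carrier R" "u = lin RM p w x"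
        by (auto simp: K G_def)
      then show "s \<otimes> u \<in> K"
        unfolding K G_def using x RR.lin_smult_left[of p w x s]
        by (auto intro!: exI[of _ "\<lambda>l. s \<otimes> w l"])
    qed
  qed
  have "G 0 (\<lambda>l. \<zero>) \<in> S" by (auto simp: S_def)
  then obtain K where "K \<in> S" and max: "\<And>K'. K' \<in> S \<Longrightarrow> K \<subseteq> K' \<Longrightarrow> K' = K"
    using exists_maximal_ideal_in[of S] idl by blast
  then obtain p x where K: "K = G p x" and x: "\<And>l. l < p \<Longrightarrow> x l \<in> L" by (auto simp: S_def)
  have "y \<in> K" if y: "y \<in> L" for y
  proof -
    have xR: "\<And>l. l < p \<Longrightarrow> x l \<in> carrier R" and yR: "y \<in> carrier R" using x y idealD(1)[OF L] by auto
    have eq: "lin RM p w (x(p := y)) = lin RM p w' x"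
      if "\<And>l. l < p \<Longrightarrow> w l = w' l" for w w'
      using that by (intro lin_cong) auto
    have "\<forall>l<Suc p. (x(p := y)) l \<in> L" using x y by (auto simp: less_Suc_eq)
    then have "G (Suc p) (x(p := y)) \<in> S" unfolding S_def by blast
    moreover have "K \<subseteq> G (Suc p) (x(p := y))"
    proof
      fix u assume "u \<in> K"
      then obtain w where w: "\<forall>l<p. w l \<in> carrier R" "u = lin RM p w x"
        by (auto simp: K G_def)
      then have "u = lin RM (Suc p) (w(p := \<zero>)) (x(p := y))"
        using eq[of "w(p := \<zero>)" w] xR yR by simp
      then show "u \<in> G (Suc p) (x(p := y))"
        using w unfolding G_def by (auto simp: less_Suc_eq intro!: exI[of _ "w(p := \<zero>)"])
    qed
    ultimately have "G (Suc p) (x(p := y)) = K" using max by blast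
    moreover have "y = lin RM (Suc p) ((\<lambda>l. \<zero>)(p := \<one>)) (x(p := y))"
      using eq[of "(\<lambda>l. \<zero>)(p := \<one>)" "\<lambda>l. \<zero>"] xR yR RR.lin_zero_left[of p x] by simp
    then have "y \<in> G (Suc p) (x(p := y))"
      unfolding G_def by (auto intro!: exI[of _ "(\<lambda>l. \<zero>)(p := \<one>)"])
    ultimately show ?thesis by simp
  qed
  then show thesis using that[of p x] x by (auto simp: K G_def)
qed

text \<open>Finite generation of submodules of \<open>R^n\<close>, by splitting off the last
  coordinate: generators of the vectors with last coordinate zero, together with lifts of generators
  of the ideal of all last coordinates. Elements of \<open>S\<close> are total functions, but are
  compared in the first \<open>n\<close> places only.\<close>

lemma vector_submodule_generators:
  fixes n :: nat
  assumes "\<And>v i. v \<in> S \<Longrightarrow> v i \<in> carrier R" and "(\<lambda>i. \<zero>) \<in> S"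
    and "\<And>u v. u \<in> S \<Longrightarrow> v \<in> S \<Longrightarrow> (\<lambda>i. u i \<oplus> v i) \<in> S"
    and "\<And>s v. s \<in> carrier R \<Longrightarrow> v \<in> S \<Longrightarrow> (\<lambda>i. s \<otimes> v i) \<in> S"
  shows "\<exists>m g. (\<forall>l<m. g l \<in> S) \<and> (\<forall>v\<in>S. \<exists>w. (\<forall>l<m. w l \<in> carrier R) \<and>
    (\<forall>i<n. v i = lin RM m w (\<lambda>l. g l i)))"
  using assms
proof (induction n arbitrary: S)
  case 0
  then show ?case by (intro exI[of _ 0]) auto
next
  case (Suc n)
  note SR = Suc.prems(1) and S0 = Suc.prems(2) and Sadd = Suc.prems(3) and Ssm = Suc.prems(4)
  have "\<exists>m g. (\<forall>l<m. g l \<in> {v \<in> S. v n = \<zero>}) \<and> (\<forall>v\<in>{v \<in> S. v n = \<zero>}. \<exists>w. (\<forall>l<m. w l \<in> carrier R) \<and>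
    (\<forall>i<n. v i = lin RM m w (\<lambda>l. g l i)))"
    by (rule Suc.IH) (auto intro: Suc.prems)
  then obtain m g where g: "\<And>l. l < m \<Longrightarrow> g l \<in> S" "\<And>l. l < m \<Longrightarrow> g l n = \<zero>"
    and gen: "\<And>v. v \<in> S \<Longrightarrow> v n = \<zero> \<Longrightarrow> \<exists>w. (\<forall>l<m. w l \<in> carrier R) \<and>
      (\<forall>i<n. v i = lin RM m w (\<lambda>l. g l i))"
    by auto
  have "ideal ((\<lambda>v. v n) ` S) R"
  proof (rule ideal_if_closed)
    show "\<zero> \<in> (\<lambda>v. v n) ` S" using S0 by (rule rev_image_eqI) simp
    show "x \<oplus> y \<in> (\<lambda>v. v n) ` S" if "x \<in> (\<lambda>v. v n) ` S" "y \<in> (\<lambda>v. v n) ` S" for x y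
    proof -
      from that obtain u v where "u \<in> S" "v \<in> S" "x = u n" "y = v n" by blast
      then show ?thesis by (intro rev_image_eqI[OF Sadd[of u v]]) auto
    qed
    show "s \<otimes> x \<in> (\<lambda>v. v n) ` S" if "s \<in> carrier R" "x \<in> (\<lambda>v. v n) ` S" for s x
      using that by (auto intro!: rev_image_eqI[OF Ssm])
  qed (use SR in auto)
  then obtain p x where x: "\<And>l. l < p \<Longrightarrow> x l \<in> (\<lambda>v. v n) ` S"
    and xgen: "\<And>y. y \<in> (\<lambda>v. v n) ` S \<Longrightarrow>
      \<exists>w. (\<forall>l<p. w l \<in> carrier R) \<and> y = lin RM p w x"
    by (rule ideal_generators) blast
  have "\<exists>u. \<forall>l. l < p \<longrightarrow> u l \<in> S \<and> u l n = x l"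
    by (rule choice) (use x in fastforce)
  then obtain u where u: "\<And>l. l < p \<Longrightarrow> u l \<in> S" "\<And>l. l < p \<Longrightarrow> u l n = x l" by blast
  have comb: "(\<lambda>i. lin RM q w (\<lambda>l. u l i)) \<in> S"
    if "q \<le> p" "\<forall>l<q. w l \<in> carrier R" for q w
    using that
  proof (induction q)
    case (Suc q)
    then show ?case using Sadd[OF _ Ssm[of "w q" "u q"]] u by simp
  qed (simp add: S0)
  define G where "G l = (if l < m then g l else u (l - m))" for l
  have GS: "G l \<in> S" if "l < m + p" for l using that g u by (auto simp: G_def)
  have "\<exists>w. (\<forall>l<m + p. w l \<in> carrier R) \<and>
      (\<forall>i<Suc n. v i = lin RM (m + p) w (\<lambda>l. G l i))" if v: "v \<in> S" for v
  proof -
    obtain w where w: "\<forall>l<p. w l \<in> carrier R" "v n = lin RM p w x"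
      using xgen[of "v n"] v by auto
    define t where "t i = lin RM p w (\<lambda>l. u l i)" for i
    have tS: "t \<in> S" using comb[of p w] w by (simp add: t_def[abs_def])
    have tn: "t n = v n" using u(2) unfolding t_def w(2) by (intro lin_cong) auto
    \<comment> \<open>\<open>t\<close> has the same last coordinate as \<open>v\<close>, so the
      difference falls under the induction hypothesis. It is written with the scalar
      \<open>\<ominus> \<one>\<close> to fit the closure properties of \<open>S\<close>.\<close>
    have "(\<lambda>i. v i \<oplus> \<ominus> \<one> \<otimes> t i) \<in> S" using Sadd[OF v Ssm[OF _ tS]] by simp
    moreover have "v n \<oplus> \<ominus> \<one> \<otimes> t n = \<zero>" using SR[OF v] by (simp add: tn l_minus r_neg)
    ultimately obtain w0 where w0: "\<forall>l<m. w0 l \<in> carrier R"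
      "\<And>i. i < n \<Longrightarrow> v i \<oplus> \<ominus> \<one> \<otimes> t i = lin RM m w0 (\<lambda>l. g l i)"
      using gen[of "\<lambda>i. v i \<oplus> \<ominus> \<one> \<otimes> t i"] by auto
    define W where "W l = (if l < m then w0 l else w (l - m))" for l
    have W: "W l \<in> carrier R" if "l < m + p" for l using that w0(1) w(1) by (auto simp: W_def)
    have "v i = lin RM (m + p) W (\<lambda>l. G l i)" if i: "i < Suc n" for i
    proof -
      have "lin RM m W (\<lambda>l. G l i) = lin RM m w0 (\<lambda>l. g l i)"
        "lin RM p (\<lambda>l. W (m + l)) (\<lambda>l. G (m + l) i) = t i"
        unfolding t_def by (auto intro!: lin_cong simp: W_def G_def)
      then have *: "lin RM (m + p) W (\<lambda>l. G l i) =
          lin RM m w0 (\<lambda>l. g l i) \<oplus> t i"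
        using RR.lin_append[of m p W "\<lambda>l. G l i"] W SR[OF GS] by simp
      show ?thesis
      proof (cases "i = n")
        case True
        have "lin RM m w0 (\<lambda>l. g l i) = lin RM m w0 (\<lambda>l. \<zero>)"
          using g(2) True by (intro lin_cong) auto
        then show ?thesis using * tn True SR[OF v] w0(1) RR.lin_zero_right[of m w0] by simp
      next
        case False
        then show ?thesis using * w0(2)[of i, symmetric] i SR[OF v] SR[OF tS]
          by (simp add: l_minus a_assoc l_neg)
      qed
    qed
    then show ?thesis using W by blast
  qed
  then show ?case using GS by blast
qed

text \<open>The kernel of a matrix is a submodule of \<open>R^m\<close>, hence finitely generated;
  the generators are the columns of \<open>B\<close>. Iterating this builds a free
  resolution.\<close>

lemma matrix_kernel_generators:
  assumes A: "\<And>i l. i < n \<Longrightarrow> l < m \<Longrightarrow> A i l \<in> carrier R"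
  shows "\<exists>p B. (\<forall>l<m. \<forall>k<p. B l k \<in> carrier R) \<and>
    (\<forall>i<n. \<forall>k<p. lin RM m (A i) (\<lambda>l. B l k) = \<zero>) \<and>
    (\<forall>v. (\<forall>l<m. v l \<in> carrier R) \<longrightarrow> (\<forall>i<n. lin RM m (A i) v = \<zero>) \<longrightarrow>
      (\<exists>w. (\<forall>k<p. w k \<in> carrier R) \<and> (\<forall>l<m. v l = lin RM p (B l) w)))"
proof -
  define S where "S = {v. (\<forall>l. v l \<in> carrier R) \<and> (\<forall>i<n. lin RM m (A i) v = \<zero>)}"
  have "\<exists>p g. (\<forall>k<p. g k \<in> S) \<and> (\<forall>v\<in>S. \<exists>w. (\<forall>k<p. w k \<in> carrier R) \<and>
      (\<forall>l<m. v l = lin RM p w (\<lambda>k. g k l)))"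
  proof (rule vector_submodule_generators)
    show "(\<lambda>i. \<zero>) \<in> S" using RR.lin_zero_right[of m] A by (auto simp: S_def)
    show "(\<lambda>i. u i \<oplus> v i) \<in> S" if "u \<in> S" "v \<in> S" for u v
      using RR.lin_add_right[of m _ u v] A that by (auto simp: S_def)
    show "(\<lambda>i. s \<otimes> v i) \<in> S" if "s \<in> carrier R" "v \<in> S" for s v
      using RR.lin_smult_right[of m _ v s] A that by (auto simp: S_def)
  qed (auto simp: S_def)
  then obtain p g where g: "\<And>k. k < p \<Longrightarrow> g k \<in> S"
    and gen: "\<And>v. v \<in> S \<Longrightarrow> \<exists>w. (\<forall>k<p. w k \<in> carrier R) \<and>
      (\<forall>l<m. v l = lin RM p w (\<lambda>k. g k l))"
    by blast
  have "\<exists>w. (\<forall>k<p. w k \<in> carrier R) \<and> (\<forall>l<m. v l = lin RM p (\<lambda>k. g k l) w)"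
    if v: "\<forall>l<m. v l \<in> carrier R" "\<forall>i<n. lin RM m (A i) v = \<zero>" for v
  proof -
    \<comment> \<open>Members of \<open>S\<close> must have all their entries in the ring, so the
      junk entries of \<open>v\<close> are first replaced by zero.\<close>
    have "lin RM m (A i) (\<lambda>l. if l < m then v l else \<zero>) =
        lin RM m (A i) v" for i
      by (rule lin_cong) auto
    then have "(\<lambda>l. if l < m then v l else \<zero>) \<in> S" using v by (auto simp: S_def)
    from gen[OF this] obtain w where w: "\<forall>k<p. w k \<in> carrier R"
      "\<forall>l<m. v l = lin RM p w (\<lambda>k. g k l)" by auto
    moreover have "g k l \<in> carrier R" if "k < p" for k l using g[OF that] by (simp add: S_def)
    ultimately have "v l = lin RM p (\<lambda>k. g k l) w" if "l < m" for l
      using that RR.lin_regular_commute[of p w "\<lambda>k. g k l"] by simp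
    then show ?thesis using w by blast
  qed
  then show ?thesis
    using g by (intro exI[of _ p] exI[of _ "\<lambda>l k. g k l"]) (auto simp: S_def)
qed

end

text \<open>A resolution of \<open>R/b\<close> by finite free modules, given by the matrices \<open>a j\<close> of the maps
  \<open>R\<^sup>r\<^sup>(\<^sup>j\<^sup>+\<^sup>1\<^sup>) \<rightarrow> R\<^sup>r\<^sup>(\<^sup>j\<^sup>)\<close>. The index is shifted by two, with two zero modules in front, so that degree
  \<open>-1\<close> of the derived functors is available in the dimension shifting arguments.\<close>

locale free_resolution = cring R for R (structure) +
  fixes b :: "'a set" and r :: "nat \<Rightarrow> nat" and a :: "nat \<Rightarrow> nat \<Rightarrow> nat \<Rightarrow> 'a"
  assumes rank: "r 0 = 0" "r (Suc 0) = 0" "r (Suc (Suc 0)) = 1"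
    and a_closed [simp]: "i < r j \<Longrightarrow> l < r (Suc j) \<Longrightarrow> a j i l \<in> carrier R"
    and a_a: "i < r j \<Longrightarrow> k < r (Suc (Suc j)) \<Longrightarrow>
      lin RM (r (Suc j)) (a j i) (\<lambda>l. a (Suc j) l k) = \<zero>"
    and exact: "j \<noteq> 1 \<Longrightarrow> (\<And>l. l < r (Suc j) \<Longrightarrow> v l \<in> carrier R) \<Longrightarrow>
      (\<And>i. i < r j \<Longrightarrow> lin RM (r (Suc j)) (a j i) v = \<zero>) \<Longrightarrow>
      \<exists>w. (\<forall>k<r (Suc (Suc j)). w k \<in> carrier R) \<and>
        (\<forall>l<r (Suc j). v l = lin RM (r (Suc (Suc j))) (a (Suc j) l) w)"
    and augmentation: "y \<in> b \<longleftrightarrow> (\<exists>w. (\<forall>k<r (Suc (Suc (Suc 0))). w k \<in> carrier R) \<and>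
        y = lin RM (r (Suc (Suc (Suc 0)))) (a (Suc (Suc 0)) 0) w)"

lemma (in noetherian_cring) free_resolution_exists:
  assumes b: "ideal b R"
  obtains r a where "free_resolution R b r a"
proof -
  \<comment> \<open>A state of the dependent choice consists of the numbers of rows and columns and
    a matrix. \<open>P\<close> makes the first matrix a single row generating \<open>b\<close>;
    \<open>Q\<close> says that the columns of the next matrix generate the kernel of the current
    one.\<close>
  define P :: "nat \<Rightarrow> nat \<times> nat \<times> (nat \<Rightarrow> nat \<Rightarrow> 'a) \<Rightarrow> bool" where
    "P k = (\<lambda>(m, n, A). (\<forall>i<m. \<forall>l<n. A i l \<in> carrier R) \<and> (k = 0 \<longrightarrow> m = 1 \<and>
      (\<forall>y. y \<in> b \<longleftrightarrow> (\<exists>w. (\<forall>l<n. w l \<in> carrier R) \<and> y = lin RM n (A 0) w))))" for k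
  define Q :: "nat \<Rightarrow> nat \<times> nat \<times> (nat \<Rightarrow> nat \<Rightarrow> 'a) \<Rightarrow> nat \<times> nat \<times> (nat \<Rightarrow> nat \<Rightarrow> 'a) \<Rightarrow> bool" where
    "Q k = (\<lambda>(n, m, A) (m', p, B). m' = m \<and>
      (\<forall>i<n. \<forall>k<p. lin RM m (A i) (\<lambda>l. B l k) = \<zero>) \<and>
      (\<forall>v. (\<forall>l<m. v l \<in> carrier R) \<longrightarrow> (\<forall>i<n. lin RM m (A i) v = \<zero>) \<longrightarrow>
      (\<exists>w. (\<forall>k<p. w k \<in> carrier R) \<and> (\<forall>l<m. v l = lin RM p (B l) w))))" for k
  have "\<exists>T. \<forall>k. P k (T k) \<and> Q k (T k) (T (Suc k))"
  proof (rule dependent_nat_choice)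
    obtain p x where x: "\<And>l. l < p \<Longrightarrow> x l \<in> b"
      and gen: "\<And>y. y \<in> b \<Longrightarrow> \<exists>w. (\<forall>l<p. w l \<in> carrier R) \<and> y = lin RM p w x"
      using ideal_generators[OF b] by blast
    have xR: "\<And>l. l < p \<Longrightarrow> x l \<in> carrier R" using x idealD(1)[OF b] by blast
    have bsub: "submodule b R RM"
      by (rule RR.submoduleI) (auto intro: idealD[OF b])
    have "y \<in> b \<longleftrightarrow> (\<exists>w. (\<forall>l<p. w l \<in> carrier R) \<and> y = lin RM p x w)" for y
    proof
      assume "y \<in> b"
      then show "\<exists>w. (\<forall>l<p. w l \<in> carrier R) \<and> y = lin RM p x w"
        using gen[of y] RR.lin_regular_commute[of p _ x] xR by metis
    next
      assume "\<exists>w. (\<forall>l<p. w l \<in> carrier R) \<and> y = lin RM p x w"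
      then show "y \<in> b"
        using RR.lin_submodule[OF bsub, of p _ x] RR.lin_regular_commute[of p _ x] xR x by metis
    qed
    then have "P 0 (1, p, \<lambda>i. x)" using xR by (auto simp: P_def)
    then show "\<exists>x. P 0 x" by blast
  next
    fix T k assume P: "P k T"
    obtain n m A where T: "T = (n, m, A)" by (cases T) auto
    have A: "\<And>i l. i < n \<Longrightarrow> l < m \<Longrightarrow> A i l \<in> carrier R" using P by (auto simp: P_def T)
    from matrix_kernel_generators[of n m A, OF A] obtain p B where
      "\<forall>l<m. \<forall>k<p. B l k \<in> carrier R"
      "\<forall>i<n. \<forall>k<p. lin RM m (A i) (\<lambda>l. B l k) = \<zero>"
      "\<forall>v. (\<forall>l<m. v l \<in> carrier R) \<longrightarrow> (\<forall>i<n. lin RM m (A i) v = \<zero>) \<longrightarrow>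
      (\<exists>w. (\<forall>k<p. w k \<in> carrier R) \<and> (\<forall>l<m. v l = lin RM p (B l) w))"
      by blast
    then have "P (Suc k) (m, p, B) \<and> Q k T (m, p, B)"
      unfolding P_def Q_def T by simp
    then show "\<exists>T'. P (Suc k) T' \<and> Q k T T'" by blast
  qed
  then obtain T where P: "\<And>k. P k (T k)" and Q: "\<And>k. Q k (T k) (T (Suc k))" by blast
  \<comment> \<open>The two zero ranks realize the shift by two. Truncated subtraction makes
    \<open>a 0\<close> and \<open>a 1\<close> copies of the first matrix, but they have no entries
    in range because \<open>r 0\<close> and \<open>r 1\<close> are zero.\<close>
  define r where "r j = (case j of 0 \<Rightarrow> 0 | Suc 0 \<Rightarrow> 0 | Suc (Suc k) \<Rightarrow> fst (T k))" for j
  define a where "a j = snd (snd (T (j - 2)))" for j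
  have Teq: "T k = (r (Suc (Suc k)), r (Suc (Suc (Suc k))), a (Suc (Suc k)))" for k
    using Q[of k] by (cases "T k", cases "T (Suc k)") (auto simp: r_def a_def Q_def)
  note P' = P[unfolded Teq P_def, simplified] and Q' = Q[unfolded Teq Q_def, simplified]
  have r: "r 0 = 0" "r (Suc 0) = 0" by (simp_all add: r_def)
  have "free_resolution R b r a"
  proof
    show "r 0 = 0" "r (Suc 0) = 0" "r (Suc (Suc 0)) = 1" using P'[of 0] by (auto simp: r)
  next
    fix i j l assume "i < r j" "l < r (Suc j)"
    then show "a j i l \<in> carrier R"
      using P'[of "j - 2"] r by (cases j; cases "j - 1") auto
  next
    fix i j k assume "i < r j" "k < r (Suc (Suc j))"
    then show "lin RM (r (Suc j)) (a j i) (\<lambda>l. a (Suc j) l k) = \<zero>"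
      using Q'[of "j - 2"] r by (cases j; cases "j - 1") auto
  next
    fix j and v assume "j \<noteq> 1" "\<And>l. l < r (Suc j) \<Longrightarrow> v l \<in> carrier R"
      "\<And>i. i < r j \<Longrightarrow> lin RM (r (Suc j)) (a j i) v = \<zero>"
    then show "\<exists>w. (\<forall>k<r (Suc (Suc j)). w k \<in> carrier R) \<and>
        (\<forall>l<r (Suc j). v l = lin RM (r (Suc (Suc j))) (a (Suc j) l) w)"
      using Q'[of "j - 2"] r by (cases j; cases "j - 1") auto
  next
    fix y
    show "y \<in> b \<longleftrightarrow> (\<exists>w. (\<forall>k<r (Suc (Suc (Suc 0))). w k \<in> carrier R) \<and>
        y = lin RM (r (Suc (Suc (Suc 0)))) (a (Suc (Suc 0)) 0) w)"
      using P'[of 0] by simp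
  qed
  then show thesis using that by blast
qed

section \<open>Vanishing of Tor\<close>

context free_resolution
begin

sublocale RR: module R "regular_module R"
  by (rule regular_module_is_module) (rule is_cring)

text \<open>The terms of the resolution are finite free, so tensoring with \<open>M\<close> and
  taking \<open>Hom\<close> into \<open>M\<close> both give powers of \<open>M\<close>. The rows of
  \<open>a j\<close> describe the differential of the tensor product and the columns that of
  \<open>Hom\<close>, which runs in the opposite direction.\<close>

abbreviation bnd :: "('a, 'm, 'y) module_scheme \<Rightarrow> nat \<Rightarrow> (nat \<Rightarrow> 'm) \<Rightarrow> nat \<Rightarrow> 'm"
  where "bnd M j z i \<equiv> lin M (r (Suc j)) (a j i) z"

abbreviation cobnd :: "('a, 'm, 'y) module_scheme \<Rightarrow> nat \<Rightarrow> (nat \<Rightarrow> 'm) \<Rightarrow> nat \<Rightarrow> 'm"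
  where "cobnd M j w l \<equiv> lin M (r j) (\<lambda>i. a j i l) w"

lemma bnd_bnd:
  assumes "module R M" and "i < r j" and w: "\<And>k. k < r (Suc (Suc j)) \<Longrightarrow> w k \<in> carrier M"
  shows "bnd M j (\<lambda>l. bnd M (Suc j) w l) i = \<zero>\<^bsub>M\<^esub>"
proof -
  interpret M: module R M by fact
  have "bnd M j (\<lambda>l. bnd M (Suc j) w l) i =
      lin M (r (Suc (Suc j))) (\<lambda>k. bnd RM j (\<lambda>l. a (Suc j) l k) i) w"
    by (rule M.lin_lin) (use assms in auto)
  also have "\<dots> = lin M (r (Suc (Suc j))) (\<lambda>k. \<zero>) w"
    using assms by (intro lin_cong) (auto intro: a_a)
  finally show ?thesis using w by simp
qed

text \<open>\<open>tor_zero M A B (j + 1)\<close> says that \<open>Tor\<^sub>j(R/b, A/B) = 0\<close> for submodules \<open>B \<subseteq> A\<close> of \<open>M\<close>.\<close>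

definition tor_zero :: "('a, 'm, 'y) module_scheme \<Rightarrow> 'm set \<Rightarrow> 'm set \<Rightarrow> nat \<Rightarrow> bool"
  where "tor_zero M A B j \<longleftrightarrow> (\<forall>z. (\<forall>i<r (Suc j). z i \<in> A) \<longrightarrow>
    (\<forall>i<r j. bnd M j z i \<in> B) \<longrightarrow>
    (\<exists>w. (\<forall>k<r (Suc (Suc j)). w k \<in> A) \<and>
      (\<forall>i<r (Suc j). z i \<ominus>\<^bsub>M\<^esub> bnd M (Suc j) w i \<in> B)))"

lemma tor_zeroI:
  assumes "\<And>z. (\<And>i. i < r (Suc j) \<Longrightarrow> z i \<in> A) \<Longrightarrow>
    (\<And>i. i < r j \<Longrightarrow> bnd M j z i \<in> B) \<Longrightarrow>
    \<exists>w. (\<forall>k<r (Suc (Suc j)). w k \<in> A) \<and>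
      (\<forall>i<r (Suc j). z i \<ominus>\<^bsub>M\<^esub> bnd M (Suc j) w i \<in> B)"
  shows "tor_zero M A B j"
  using assms unfolding tor_zero_def by blast

lemma tor_zeroE:
  assumes "tor_zero M A B j" "\<And>i. i < r (Suc j) \<Longrightarrow> z i \<in> A"
    "\<And>i. i < r j \<Longrightarrow> bnd M j z i \<in> B"
  obtains w where "\<And>k. k < r (Suc (Suc j)) \<Longrightarrow> w k \<in> A"
    "\<And>i. i < r (Suc j) \<Longrightarrow> z i \<ominus>\<^bsub>M\<^esub> bnd M (Suc j) w i \<in> B"
  using assms unfolding tor_zero_def by blast

text \<open>This is degree -1, where \<open>r 1 = 0\<close> leaves nothing to lift. It is the
  starting point of the dimension shift.\<close>

lemma tor_zero_0:
  assumes "\<zero>\<^bsub>M\<^esub> \<in> A"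
  shows "tor_zero M A B 0"
  unfolding tor_zero_def using rank assms by (auto intro!: exI[of _ "\<lambda>_. \<zero>\<^bsub>M\<^esub>"])

section \<open>The long exact sequence of Tor for
  \<open>B \<subseteq> A' \<subseteq> A\<close>\<close>

context
  fixes M :: "('a, 'm, 'y) module_scheme" and A A' B :: "'m set"
  assumes M: "module R M" and A: "submodule A R M" and A': "submodule A' R M" and B: "submodule B R M"
    and sub: "B \<subseteq> A'" "A' \<subseteq> A"
begin

interpretation M: module R M by (rule M)

private lemmas carr = M.submoduleD(1)[OF A] M.submoduleD(1)[OF A'] M.submoduleD(1)[OF B]

text \<open>Exactness at the middle term \<open>A/B\<close>: subtracting a boundary moves the cycle
  into \<open>A'\<close>, and subtracting a second one moves it into \<open>B\<close>.\<close>

lemma tor_zero_extension: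
  assumes "tor_zero M A' B j" "tor_zero M A A' j"
  shows "tor_zero M A B j"
proof (rule tor_zeroI)
  let ?n = "r (Suc j)" and ?p = "r (Suc (Suc j))"
  fix z assume z: "\<And>i. i < ?n \<Longrightarrow> z i \<in> A" and dz: "\<And>i. i < r j \<Longrightarrow> bnd M j z i \<in> B"
  obtain w where w: "\<And>k. k < ?p \<Longrightarrow> w k \<in> A"
    and zw: "\<And>i. i < ?n \<Longrightarrow> z i \<ominus>\<^bsub>M\<^esub> bnd M (Suc j) w i \<in> A'"
    by (rule tor_zeroE[OF assms(2), of z]) (use z dz sub in auto)
  have "bnd M j (\<lambda>i. z i \<ominus>\<^bsub>M\<^esub> bnd M (Suc j) w i) i = bnd M j z i" if "i < r j" for i
    using that z w by (subst M.lin_minus_right) (auto simp: carr bnd_bnd[OF M] M.M.minus_eq)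
  then obtain w' where w': "\<And>k. k < ?p \<Longrightarrow> w' k \<in> A'"
    and zw': "\<And>i. i < ?n \<Longrightarrow> z i \<ominus>\<^bsub>M\<^esub> bnd M (Suc j) w i \<ominus>\<^bsub>M\<^esub> bnd M (Suc j) w' i \<in> B"
    using tor_zeroE[OF assms(1), of "\<lambda>i. z i \<ominus>\<^bsub>M\<^esub> bnd M (Suc j) w i"] zw dz by auto
  have "z i \<ominus>\<^bsub>M\<^esub> bnd M (Suc j) (\<lambda>k. w k \<oplus>\<^bsub>M\<^esub> w' k) i =
      z i \<ominus>\<^bsub>M\<^esub> bnd M (Suc j) w i \<ominus>\<^bsub>M\<^esub> bnd M (Suc j) w' i" if "i < ?n" for i
    using that w w' z
    by (subst M.lin_add_right) (auto simp: carr a_minus_def M.M.minus_add M.M.a_assoc)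
  then show "\<exists>w. (\<forall>k<?p. w k \<in> A) \<and> (\<forall>i<?n. z i \<ominus>\<^bsub>M\<^esub> bnd M (Suc j) w i \<in> B)"
    using zw' w w' sub by (intro exI[of _ "\<lambda>k. w k \<oplus>\<^bsub>M\<^esub> w' k"]) (auto intro!: M.submoduleD(3)[OF A])
qed

text \<open>A cycle of \<open>A'/B\<close> bounds some \<open>w\<close> in \<open>A/B\<close>. This
  \<open>w\<close> is a cycle modulo \<open>A'\<close>, so subtracting a boundary from it brings it
  into \<open>A'\<close> without changing what it bounds.\<close>

lemma tor_zero_sub:
  assumes "tor_zero M A B j" "tor_zero M A A' (Suc j)"
  shows "tor_zero M A' B j"
proof (rule tor_zeroI)
  let ?n = "r (Suc j)" and ?p = "r (Suc (Suc j))" and ?q = "r (Suc (Suc (Suc j)))"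
  fix z assume z: "\<And>i. i < ?n \<Longrightarrow> z i \<in> A'" and dz: "\<And>i. i < r j \<Longrightarrow> bnd M j z i \<in> B"
  obtain w where w: "\<And>k. k < ?p \<Longrightarrow> w k \<in> A"
    and zw: "\<And>i. i < ?n \<Longrightarrow> z i \<ominus>\<^bsub>M\<^esub> bnd M (Suc j) w i \<in> B"
    by (rule tor_zeroE[OF assms(1), of z]) (use z dz sub in auto)
  have "bnd M (Suc j) w i \<in> A'" if i: "i < ?n" for i
    using M.diff_mem_iff[OF A', of "z i" "bnd M (Suc j) w i"] zw[OF i] z[OF i] sub w i
    by (auto simp: carr)
  then obtain v where v: "\<And>k. k < ?q \<Longrightarrow> v k \<in> A"
    and wv: "\<And>i. i < ?p \<Longrightarrow> w i \<ominus>\<^bsub>M\<^esub> bnd M (Suc (Suc j)) v i \<in> A'"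
    using tor_zeroE[OF assms(2), of w] w by auto
  have "bnd M (Suc j) (\<lambda>i. w i \<ominus>\<^bsub>M\<^esub> bnd M (Suc (Suc j)) v i) i =
      bnd M (Suc j) w i" if "i < ?n" for i
    using that v w by (subst M.lin_minus_right) (auto simp: carr bnd_bnd[OF M] M.M.minus_eq)
  then show "\<exists>w. (\<forall>k<?p. w k \<in> A') \<and> (\<forall>i<?n. z i \<ominus>\<^bsub>M\<^esub> bnd M (Suc j) w i \<in> B)"
    using zw wv by (intro exI[of _ "\<lambda>i. w i \<ominus>\<^bsub>M\<^esub> bnd M (Suc (Suc j)) v i"]) auto
qed

text \<open>The boundary of a cycle of \<open>A/A'\<close> has entries in \<open>A'\<close> and
  bounds some \<open>w\<close> there, modulo \<open>B\<close>; then \<open>z\<close> minus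
  \<open>w\<close> is a cycle of \<open>A/B\<close>, and \<open>w\<close> vanishes modulo
  \<open>A'\<close>.\<close>

lemma tor_zero_quotient:
  assumes "tor_zero M A B (Suc j)" "tor_zero M A' B j"
  shows "tor_zero M A A' (Suc j)"
proof (rule tor_zeroI)
  let ?n = "r (Suc j)" and ?p = "r (Suc (Suc j))" and ?q = "r (Suc (Suc (Suc j)))"
  fix z assume z: "\<And>i. i < ?p \<Longrightarrow> z i \<in> A" and dz: "\<And>i. i < ?n \<Longrightarrow> bnd M (Suc j) z i \<in> A'"
  obtain w where w: "\<And>k. k < ?p \<Longrightarrow> w k \<in> A'"
    and zw: "\<And>i. i < ?n \<Longrightarrow> bnd M (Suc j) z i \<ominus>\<^bsub>M\<^esub> bnd M (Suc j) w i \<in> B"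
    by (rule tor_zeroE[OF assms(2), of "\<lambda>i. bnd M (Suc j) z i"])
      (use z dz in \<open>auto simp: bnd_bnd[OF M] carr M.submoduleD(2)[OF B]\<close>)
  have "bnd M (Suc j) (\<lambda>i. z i \<ominus>\<^bsub>M\<^esub> w i) i \<in> B" if "i < ?n" for i
    using that z w zw by (subst M.lin_minus_right) (auto simp: carr)
  moreover have "z i \<ominus>\<^bsub>M\<^esub> w i \<in> A" if "i < ?p" for i
    using z[OF that] w[OF that] sub by (auto intro: M.submoduleD(5)[OF A])
  ultimately obtain v where v: "\<And>k. k < ?q \<Longrightarrow> v k \<in> A"
    and zv: "\<And>i. i < ?p \<Longrightarrow> z i \<ominus>\<^bsub>M\<^esub> w i \<ominus>\<^bsub>M\<^esub> bnd M (Suc (Suc j)) v i \<in> B"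
    using tor_zeroE[OF assms(1), of "\<lambda>i. z i \<ominus>\<^bsub>M\<^esub> w i"] by auto
  have "z i \<ominus>\<^bsub>M\<^esub> bnd M (Suc (Suc j)) v i \<in> A'" if i: "i < ?p" for i
  proof (rule M.diff_trans[OF A', of _ "z i \<ominus>\<^bsub>M\<^esub> w i"])
    show "z i \<ominus>\<^bsub>M\<^esub> (z i \<ominus>\<^bsub>M\<^esub> w i) \<in> A'"
      using M.add_minus_cancel(3)[of "z i" "w i"] z[OF i] w[OF i] by (simp add: carr)
  qed (use z w v zv sub i carr in auto)
  then show "\<exists>w. (\<forall>k<?q. w k \<in> A) \<and> (\<forall>i<?p. z i \<ominus>\<^bsub>M\<^esub> bnd M (Suc (Suc j)) w i \<in> A')"
    using v by blast
qed

end

text \<open>The last three hypotheses say that \<open>f\<close> induces an isomorphism from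
  \<open>A/B\<close> to \<open>A'/B'\<close>. No inverse homomorphism is available, so vectors over
  \<open>A'\<close> are lifted entry by entry, up to \<open>B'\<close>.\<close>

lemma tor_zero_iso:
  assumes M: "module R M" and M': "module R M'" and f: "f \<in> module_homs R M M'"
    and A: "submodule A R M" and A': "submodule A' R M'" and B': "submodule B' R M'"
    and into: "\<And>z. z \<in> A \<Longrightarrow> f z \<in> A'"
    and onto: "\<And>z'. z' \<in> A' \<Longrightarrow> \<exists>z\<in>A. z' \<ominus>\<^bsub>M'\<^esub> f z \<in> B'"
    and mem: "\<And>z. z \<in> A \<Longrightarrow> z \<in> B \<longleftrightarrow> f z \<in> B'"
  shows "tor_zero M A B j \<longleftrightarrow> tor_zero M' A' B' j"
proof -
  interpret M: module R M by fact
  interpret M': module R M' by fact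
  let ?n = "r (Suc j)" and ?p = "r (Suc (Suc j))"
  note carr = M.submoduleD(1)[OF A] M'.submoduleD(1)[OF A'] M'.submoduleD(1)[OF B']
  have lift: "\<exists>z. \<forall>i<n. z i \<in> A \<and> z' i \<ominus>\<^bsub>M'\<^esub> f (z i) \<in> B'" if "\<And>i. i < n \<Longrightarrow> z' i \<in> A'" for z' and n :: nat
    using onto[OF that] by (intro choice allI) blast
  have lin_f: "f (lin M n v z) = lin M' n v (\<lambda>i. f (z i))"
    if "\<And>i. i < n \<Longrightarrow> v i \<in> carrier R" "\<And>i. i < n \<Longrightarrow> z i \<in> A" for n v z
    using module_homs_lin[OF M M' f, of n v z] that carr by auto
  have diff_f: "f (x \<ominus>\<^bsub>M\<^esub> y) = f x \<ominus>\<^bsub>M'\<^esub> f y" if "x \<in> A" "y \<in> A" for x y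
    using module_homs_minus[OF M M' f] that carr by auto
  have lin_diff: "lin M' n v z' \<ominus>\<^bsub>M'\<^esub> lin M' n v z \<in> B'"
    if "\<And>i. i < n \<Longrightarrow> v i \<in> carrier R" "\<And>i. i < n \<Longrightarrow> z' i \<in> A'" "\<And>i. i < n \<Longrightarrow> z i \<in> A'"
      "\<And>i. i < n \<Longrightarrow> z' i \<ominus>\<^bsub>M'\<^esub> z i \<in> B'" for n v z z'
    using M'.lin_minus_right[of n v z' z] that M'.lin_submodule[OF B', of n v "\<lambda>i. z' i \<ominus>\<^bsub>M'\<^esub> z i"] carr
    by auto
  show ?thesis
  proof
    assume T: "tor_zero M A B j"
    show "tor_zero M' A' B' j"
    proof (rule tor_zeroI)
      fix z' assume z': "\<And>i. i < ?n \<Longrightarrow> z' i \<in> A'"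
        and dz': "\<And>i. i < r j \<Longrightarrow> bnd M' j z' i \<in> B'"
      obtain z where z: "\<And>i. i < ?n \<Longrightarrow> z i \<in> A" "\<And>i. i < ?n \<Longrightarrow> z' i \<ominus>\<^bsub>M'\<^esub> f (z i) \<in> B'"
        using lift[of ?n z'] z' by blast
      have "bnd M j z i \<in> B" if i: "i < r j" for i
      proof -
        have "bnd M' j z' i \<ominus>\<^bsub>M'\<^esub> bnd M' j (\<lambda>i. f (z i)) i \<in> B'"
          using i z z' into by (intro lin_diff) auto
        then have "bnd M' j (\<lambda>i. f (z i)) i \<in> B'"
          using dz'[OF i] M'.diff_mem_iff[OF B', of "bnd M' j z' i" "bnd M' j (\<lambda>i. f (z i)) i"]
            z z' into i carr by auto
        then show ?thesis
          using lin_f[of ?n "a j i" z] mem[of "bnd M j z i"] M.lin_submodule[OF A, of ?n "a j i" z] i z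
          by auto
      qed
      then obtain w where w: "\<And>k. k < ?p \<Longrightarrow> w k \<in> A"
        and zw: "\<And>i. i < ?n \<Longrightarrow> z i \<ominus>\<^bsub>M\<^esub> bnd M (Suc j) w i \<in> B"
        using tor_zeroE[OF T, of z] z by auto
      have "z' i \<ominus>\<^bsub>M'\<^esub> bnd M' (Suc j) (\<lambda>k. f (w k)) i \<in> B'" if i: "i < ?n" for i
      proof (rule M'.diff_trans[OF B', of _ "f (z i)"])
        have l: "bnd M (Suc j) w i \<in> A" using i w by (intro M.lin_submodule[OF A]) auto
        then have "f (z i \<ominus>\<^bsub>M\<^esub> bnd M (Suc j) w i) \<in> B'"
          using zw[OF i] mem z(1)[OF i] M.submoduleD(5)[OF A] by auto
        then show "f (z i) \<ominus>\<^bsub>M'\<^esub> bnd M' (Suc j) (\<lambda>k. f (w k)) i \<in> B'"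
          using diff_f[OF z(1)[OF i] l] lin_f[of ?p "a (Suc j) i" w] i w by auto
      qed (use z z' w i into carr in auto)
      then show "\<exists>w. (\<forall>k<?p. w k \<in> A') \<and> (\<forall>i<?n. z' i \<ominus>\<^bsub>M'\<^esub> bnd M' (Suc j) w i \<in> B')"
        using w into by (intro exI[of _ "\<lambda>k. f (w k)"]) auto
    qed
  next
    assume T: "tor_zero M' A' B' j"
    show "tor_zero M A B j"
    proof (rule tor_zeroI)
      fix z assume z: "\<And>i. i < ?n \<Longrightarrow> z i \<in> A"
        and dz: "\<And>i. i < r j \<Longrightarrow> bnd M j z i \<in> B"
      have "bnd M' j (\<lambda>i. f (z i)) i \<in> B'" if i: "i < r j" for i
        using dz[OF i] mem[of "bnd M j z i"] lin_f[of ?n "a j i" z]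
          M.lin_submodule[OF A, of ?n "a j i" z] i z by auto
      then obtain w' where w': "\<And>k. k < ?p \<Longrightarrow> w' k \<in> A'"
        and zw': "\<And>i. i < ?n \<Longrightarrow> f (z i) \<ominus>\<^bsub>M'\<^esub> bnd M' (Suc j) w' i \<in> B'"
        using tor_zeroE[OF T, of "\<lambda>i. f (z i)"] z into by auto
      obtain w where w: "\<And>i. i < ?p \<Longrightarrow> w i \<in> A" "\<And>i. i < ?p \<Longrightarrow> w' i \<ominus>\<^bsub>M'\<^esub> f (w i) \<in> B'"
        using lift[of ?p w'] w' by blast
      have "z i \<ominus>\<^bsub>M\<^esub> bnd M (Suc j) w i \<in> B" if i: "i < ?n" for i
      proof -
        have l: "bnd M (Suc j) w i \<in> A" using i w by (intro M.lin_submodule[OF A]) auto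
        have "f (z i) \<ominus>\<^bsub>M'\<^esub> bnd M' (Suc j) (\<lambda>k. f (w k)) i \<in> B'"
        proof (rule M'.diff_trans[OF B', of _ "bnd M' (Suc j) w' i"])
          show "bnd M' (Suc j) w' i \<ominus>\<^bsub>M'\<^esub> bnd M' (Suc j) (\<lambda>k. f (w k)) i \<in> B'"
            using i w w' into by (intro lin_diff) auto
        qed (use zw' w' z w i into carr in auto)
        then show ?thesis
          using diff_f[OF z[OF i] l] lin_f[of ?p "a (Suc j) i" w] i w mem M.submoduleD(5)[OF A z[OF i] l]
          by auto
      qed
      then show "\<exists>w. (\<forall>k<?p. w k \<in> A) \<and> (\<forall>i<?n. z i \<ominus>\<^bsub>M\<^esub> bnd M (Suc j) w i \<in> B)"
        using w by blast
    qed
  qed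
qed

text \<open>Multiplication by \<open>y \<in> b\<close> is zero on \<open>R/b\<close>, hence null homotopic on its resolution.\<close>

lemma null_homotopy:
  assumes y: "y \<in> b"
  obtains h where "\<And>j l i. l < r (Suc (Suc j)) \<Longrightarrow> i < r (Suc j) \<Longrightarrow> h j l i \<in> carrier R"
    and "\<And>j i i'. i < r (Suc (Suc j)) \<Longrightarrow> i' < r (Suc (Suc j)) \<Longrightarrow>
      bnd RM (Suc (Suc j)) (\<lambda>l. h (Suc j) l i') i =
      (if i' = i then y else \<zero>) \<ominus> lin RM (r (Suc j)) (h j i) (\<lambda>k. a (Suc j) k i')"
proof -
  have yR: "y \<in> carrier R" using y by (auto simp: augmentation rank)
  \<comment> \<open>In matrix form \<open>D j h\<close> is \<open>y - h a_(j+1)\<close>, the part of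
    \<open>y\<close> not yet accounted for by the homotopy. \<open>P\<close> states that its columns
    are cycles, \<open>Q\<close> that the next homotopy \<open>h'\<close> satisfies
    \<open>a_(j+2) h' = D j h\<close>.\<close>
  define D where "D j h i i' = (if i' = i then y else \<zero>) \<ominus>
    lin RM (r (Suc j)) (h i) (\<lambda>k. a (Suc j) k i')" for j and h :: "nat \<Rightarrow> nat \<Rightarrow> 'a" and i i'
  define P where "P j h \<longleftrightarrow> (\<forall>l<r (Suc (Suc j)). \<forall>i<r (Suc j). h l i \<in> carrier R) \<and>
    (\<forall>k<r (Suc j). \<forall>i'<r (Suc (Suc j)).
      bnd RM (Suc j) (\<lambda>i. D j h i i') k = \<zero>)" for j h
  define Q where "Q j h h' \<longleftrightarrow> (\<forall>i<r (Suc (Suc j)). \<forall>i'<r (Suc (Suc j)).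
    bnd RM (Suc (Suc j)) (\<lambda>l. h' l i') i = D j h i i')"
    for j and h h' :: "nat \<Rightarrow> nat \<Rightarrow> 'a"
  have DR: "D j h i i' \<in> carrier R"
    if "\<forall>l<r (Suc (Suc j)). \<forall>i<r (Suc j). h l i \<in> carrier R" "i < r (Suc (Suc j))" "i' < r (Suc (Suc j))"
    for j h i i'
    unfolding D_def using that yR by auto
  have "\<exists>h. \<forall>j. P j (h j) \<and> Q j (h j) (h (Suc j))"
  proof (rule dependent_nat_choice)
    show "\<exists>h. P 0 h" using rank by (auto simp: P_def)
  next
    fix h j assume P: "P j h"
    then have hR: "\<forall>l<r (Suc (Suc j)). \<forall>i<r (Suc j). h l i \<in> carrier R" by (simp add: P_def)
    have "\<exists>w. (\<forall>k<r (Suc (Suc (Suc j))). w k \<in> carrier R) \<and> (\<forall>i<r (Suc (Suc j)).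
        D j h i i' = bnd RM (Suc (Suc j)) w i)"
      if i': "i' < r (Suc (Suc j))" for i'
    proof (cases "j = 0")
      \<comment> \<open>The index excluded from \<open>exact\<close>. The image of
        \<open>a 2\<close> is \<open>b\<close> rather than the whole ring, and this is where
        \<open>y \<in> b\<close> enters.\<close>
      case True
      then have "i' = 0" "D j h 0 0 = y" using i' rank yR by (auto simp: D_def minus_eq)
      then show ?thesis using y augmentation[of y] True rank by auto
    next
      case False
      then show ?thesis
        using exact[of "Suc j" "\<lambda>i. D j h i i'"] P i' DR[OF hR] by (auto simp: P_def)
    qed
    then have "\<exists>W. \<forall>i'. i' < r (Suc (Suc j)) \<longrightarrow> (\<forall>k<r (Suc (Suc (Suc j))). W i' k \<in> carrier R) \<and>
        (\<forall>i<r (Suc (Suc j)).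
        D j h i i' = bnd RM (Suc (Suc j)) (W i') i)"
      by (intro choice allI) blast
    then obtain W where W: "\<And>i' k. i' < r (Suc (Suc j)) \<Longrightarrow> k < r (Suc (Suc (Suc j))) \<Longrightarrow> W i' k \<in> carrier R"
      and DW: "\<And>i i'. i < r (Suc (Suc j)) \<Longrightarrow> i' < r (Suc (Suc j)) \<Longrightarrow>
        bnd RM (Suc (Suc j)) (W i') i = D j h i i'"
      by (metis (no_types, lifting))
    define h' where "h' l i = W i l" for l i
    have Q: "Q j h h'" by (simp add: Q_def h'_def DW)
    have h'R: "\<forall>l<r (Suc (Suc (Suc j))). \<forall>i<r (Suc (Suc j)). h' l i \<in> carrier R"
      using W by (simp add: h'_def)
    \<comment> \<open>In matrix form: \<open>a_(j+2) (y - h' a_(j+2)) = y a_(j+2) - (y - h a_(j+1))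
      a_(j+2) = h a_(j+1) a_(j+2) = 0\<close>.\<close>
    have "bnd RM (Suc (Suc j)) (\<lambda>i. D (Suc j) h' i i') k = \<zero>"
      if k: "k < r (Suc (Suc j))" and i': "i' < r (Suc (Suc (Suc j)))" for k i'
    proof -
      let ?n = "r (Suc j)" and ?p = "r (Suc (Suc j))" and ?q = "r (Suc (Suc (Suc j)))"
      let ?L = "lin RM"
      have 1: "?L ?q (a (Suc (Suc j)) k) (\<lambda>i. if i' = i then y else \<zero>) = y \<otimes> a (Suc (Suc j)) k i'"
        using RR.lin_unit[of i' ?q "a (Suc (Suc j)) k" y, unfolded regular_module_simps] i' k yR by (simp add: eq_commute[of i'] m_comm)
      have 2: "?L ?q (a (Suc (Suc j)) k) (\<lambda>i. ?L ?p (h' i) (\<lambda>k'. a (Suc (Suc j)) k' i')) =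
          ?L ?p (\<lambda>k'. D j h k k') (\<lambda>k'. a (Suc (Suc j)) k' i')"
      proof -
        have "?L ?q (a (Suc (Suc j)) k) (\<lambda>i. ?L ?p (h' i) (\<lambda>k'. a (Suc (Suc j)) k' i')) =
          ?L ?p (\<lambda>k'. ?L ?q (a (Suc (Suc j)) k) (\<lambda>i. h' i k')) (\<lambda>k'. a (Suc (Suc j)) k' i')"
          by (rule RR.lin_lin) (use k i' h'R in auto)
        also have "\<dots> = ?L ?p (\<lambda>k'. D j h k k') (\<lambda>k'. a (Suc (Suc j)) k' i')"
          using Q k by (intro lin_cong) (auto simp: Q_def)
        finally show ?thesis .
      qed
      have 3: "?L ?p (\<lambda>k'. ?L ?n (h k) (\<lambda>l. a (Suc j) l k')) (\<lambda>k'. a (Suc (Suc j)) k' i') = \<zero>"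
      proof -
        have "?L ?p (\<lambda>k'. ?L ?n (h k) (\<lambda>l. a (Suc j) l k')) (\<lambda>k'. a (Suc (Suc j)) k' i') =
          ?L ?n (h k) (\<lambda>l. ?L ?p (a (Suc j) l) (\<lambda>k'. a (Suc (Suc j)) k' i'))"
          by (rule RR.lin_lin[symmetric]) (use k i' hR in auto)
        also have "\<dots> = ?L ?n (h k) (\<lambda>l. \<zero>)"
          using i' by (intro lin_cong) (auto intro: a_a)
        finally show ?thesis using RR.lin_zero_right[of ?n "h k"] hR k by simp
      qed
      have 4: "?L ?p (\<lambda>k'. D j h k k') (\<lambda>k'. a (Suc (Suc j)) k' i') = y \<otimes> a (Suc (Suc j)) k i'"
      proof -
        have c: "\<And>l. l < ?p \<Longrightarrow> ?L ?n (h k) (\<lambda>m. a (Suc j) m l) \<in> carrier R"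
          using hR k by auto
        have "?L ?p (\<lambda>k'. D j h k k') (\<lambda>k'. a (Suc (Suc j)) k' i') =
            ?L ?p (\<lambda>k'. a (Suc (Suc j)) k' i') (\<lambda>k'. D j h k k')"
          by (rule RR.lin_regular_commute) (use DR[OF hR k] i' in auto)
        also have "\<dots> = ?L ?p (\<lambda>k'. a (Suc (Suc j)) k' i') (\<lambda>k'. if k' = k then y else \<zero>) \<ominus>
            ?L ?p (\<lambda>k'. a (Suc (Suc j)) k' i') (\<lambda>k'. ?L ?n (h k) (\<lambda>l. a (Suc j) l k'))"
          using RR.lin_minus_right[of ?p "\<lambda>k'. a (Suc (Suc j)) k' i'" "\<lambda>k'. if k' = k then y else \<zero>"
              "\<lambda>k'. ?L ?n (h k) (\<lambda>l. a (Suc j) l k')"] i' yR c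
          by (simp add: D_def)
        also have "?L ?p (\<lambda>k'. a (Suc (Suc j)) k' i') (\<lambda>k'. ?L ?n (h k) (\<lambda>l. a (Suc j) l k')) = \<zero>"
          using 3 RR.lin_regular_commute[of ?p "\<lambda>k'. a (Suc (Suc j)) k' i'"
              "\<lambda>k'. ?L ?n (h k) (\<lambda>l. a (Suc j) l k')"] i' c by simp
        also have "?L ?p (\<lambda>k'. a (Suc (Suc j)) k' i') (\<lambda>k'. if k' = k then y else \<zero>) =
            y \<otimes> a (Suc (Suc j)) k i'"
          using RR.lin_unit[of k ?p "\<lambda>k'. a (Suc (Suc j)) k' i'" y, unfolded regular_module_simps] i' k yR by (simp add: m_comm)
        finally show ?thesis using yR k i' by (simp add: minus_eq)
      qed
      have c: "\<And>i. i < ?q \<Longrightarrow> ?L ?p (h' i) (\<lambda>k'. a (Suc (Suc j)) k' i') \<in> carrier R"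
        using h'R i' by auto
      show ?thesis
        using RR.lin_minus_right[of ?q "a (Suc (Suc j)) k" "\<lambda>i. if i' = i then y else \<zero>"
            "\<lambda>i. ?L ?p (h' i) (\<lambda>k'. a (Suc (Suc j)) k' i')"] k yR c 1 2 4 i'
        by (simp add: D_def r_right_minus_eq)
    qed
    then have "P (Suc j) h'" using h'R by (simp add: P_def)
    then show "\<exists>h'. P (Suc j) h' \<and> Q j h h'" using Q by blast
  qed
  then obtain h where "\<And>j. P j (h j)" "\<And>j. Q j (h j) (h (Suc j))" by blast
  then show thesis using that[of h] by (simp add: P_def Q_def D_def)
qed

text \<open>Multiplication by \<open>y\<close> is bijective on \<open>A/B\<close> and null homotopic
  on the resolution of \<open>R/b\<close>. It therefore acts on Tor both as an isomorphism and as
  zero.\<close>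

lemma tor_zero_divisible:
  assumes M: "module R M" and A: "submodule A R M" and B: "submodule B R M" and sub: "B \<subseteq> A"
    and y: "y \<in> b"
    and onto: "\<And>z. z \<in> A \<Longrightarrow> \<exists>z'\<in>A. z \<ominus>\<^bsub>M\<^esub> y \<odot>\<^bsub>M\<^esub> z' \<in> B"
    and inj: "\<And>z. z \<in> A \<Longrightarrow> y \<odot>\<^bsub>M\<^esub> z \<in> B \<Longrightarrow> z \<in> B"
  shows "tor_zero M A B j"
proof (cases j)
  case 0
  then show ?thesis using tor_zero_0 module.submoduleD(2)[OF M A] by blast
next
  case (Suc j')
  interpret M: module R M by fact
  have yR: "y \<in> carrier R" using y by (auto simp: augmentation rank)
  note carr = M.submoduleD(1)[OF A] M.submoduleD(1)[OF B]
  obtain h where hR: "\<And>j l i. l < r (Suc (Suc j)) \<Longrightarrow> i < r (Suc j) \<Longrightarrow> h j l i \<in> carrier R"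
    and h: "\<And>j i i'. i < r (Suc (Suc j)) \<Longrightarrow> i' < r (Suc (Suc j)) \<Longrightarrow>
      bnd RM (Suc (Suc j)) (\<lambda>l. h (Suc j) l i') i =
      (if i' = i then y else \<zero>) \<ominus> lin RM (r (Suc j)) (h j i) (\<lambda>k. a (Suc j) k i')"
    using null_homotopy[OF y] by blast
  let ?n = "r (Suc j')" and ?p = "r (Suc (Suc j'))" and ?q = "r (Suc (Suc (Suc j')))"
  have "tor_zero M A B (Suc j')"
  proof (rule tor_zeroI)
    fix z assume z: "\<And>i. i < ?p \<Longrightarrow> z i \<in> A"
      and dz: "\<And>i. i < ?n \<Longrightarrow> bnd M (Suc j') z i \<in> B"
    have "\<exists>z'. \<forall>i. i < ?p \<longrightarrow> z' i \<in> A \<and> z i \<ominus>\<^bsub>M\<^esub> y \<odot>\<^bsub>M\<^esub> z' i \<in> B"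
      using onto[OF z] by (intro choice allI) blast
    then obtain z' where z': "\<And>i. i < ?p \<Longrightarrow> z' i \<in> A" "\<And>i. i < ?p \<Longrightarrow> z i \<ominus>\<^bsub>M\<^esub> y \<odot>\<^bsub>M\<^esub> z' i \<in> B"
      by blast
    have dz': "bnd M (Suc j') z' i \<in> B" if i: "i < ?n" for i
    proof (rule inj)
      show "bnd M (Suc j') z' i \<in> A" using z' i by (intro M.lin_submodule[OF A]) auto
      have "bnd M (Suc j') (\<lambda>l. z l \<ominus>\<^bsub>M\<^esub> y \<odot>\<^bsub>M\<^esub> z' l) i \<in> B"
        using z' i by (intro M.lin_submodule[OF B]) auto
      then have "bnd M (Suc j') z i \<ominus>\<^bsub>M\<^esub> y \<odot>\<^bsub>M\<^esub> bnd M (Suc j') z' i \<in> B"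
        using z z' i yR M.lin_minus_right[of ?p "a (Suc j') i" z "\<lambda>l. y \<odot>\<^bsub>M\<^esub> z' l"]
          M.lin_smult_right[of ?p "a (Suc j') i" z' y] carr by auto
      then show "y \<odot>\<^bsub>M\<^esub> bnd M (Suc j') z' i \<in> B"
        using M.diff_mem_iff[OF B, of "bnd M (Suc j') z i" "y \<odot>\<^bsub>M\<^esub> bnd M (Suc j') z' i"]
          dz[OF i] z z' i yR carr by auto
    qed
    \<comment> \<open>The homotopy applied to \<open>z'\<close>. The boundary of \<open>w\<close>
      and the homotopy of the boundary of \<open>z'\<close> add up to \<open>y z'\<close>, which is
      \<open>z\<close> modulo \<open>B\<close>; the second summand lies in \<open>B\<close>.\<close>
    define w where "w l = lin M ?p (h (Suc j') l) z'" for l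
    have wA: "w l \<in> A" if "l < ?q" for l
      unfolding w_def using that z' hR by (intro M.lin_submodule[OF A]) auto
    have "z i \<ominus>\<^bsub>M\<^esub> bnd M (Suc (Suc j')) w i \<in> B" if i: "i < ?p" for i
    proof (rule M.diff_trans[OF B, of _ "y \<odot>\<^bsub>M\<^esub> z' i"])
      let ?u = "lin M ?n (h j' i) (\<lambda>k. bnd M (Suc j') z' k)"
      have uB: "?u \<in> B" by (rule M.lin_submodule[OF B]) (use dz' hR i in auto)
      have c: "\<And>i'. i' < ?p \<Longrightarrow> lin RM ?n (h j' i) (\<lambda>k. a (Suc j') k i') \<in> carrier R"
        using hR i by auto
      have "?u = lin M ?p (\<lambda>i'. lin RM ?n (h j' i) (\<lambda>k. a (Suc j') k i')) z'"
        by (rule M.lin_lin) (use hR i z' carr in auto)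
      moreover have "bnd M (Suc (Suc j')) w i =
          lin M ?p (\<lambda>i'. bnd RM (Suc (Suc j')) (\<lambda>l. h (Suc j') l i') i) z'"
        unfolding w_def by (rule M.lin_lin) (use hR i z' carr in auto)
      ultimately have "bnd M (Suc (Suc j')) w i \<oplus>\<^bsub>M\<^esub> ?u =
          lin M ?p (\<lambda>i'. bnd RM (Suc (Suc j')) (\<lambda>l. h (Suc j') l i') i \<oplus>
            lin RM ?n (h j' i) (\<lambda>k. a (Suc j') k i')) z'"
        using hR i z' carr by (subst M.lin_add_left) auto
      also have "\<dots> = lin M ?p (\<lambda>i'. if i' = i then y else \<zero>) z'"
        using h[OF i] c yR RR.add_minus_cancel(1) by (intro lin_cong) auto
      also have "\<dots> = y \<odot>\<^bsub>M\<^esub> z' i" using i yR z' carr by (intro M.lin_unit_left) auto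
      finally have "y \<odot>\<^bsub>M\<^esub> z' i = ?u \<oplus>\<^bsub>M\<^esub> bnd M (Suc (Suc j')) w i"
        using uB wA i carr by (simp add: M.M.a_comm)
      then show "y \<odot>\<^bsub>M\<^esub> z' i \<ominus>\<^bsub>M\<^esub> bnd M (Suc (Suc j')) w i \<in> B"
        using M.add_minus_cancel(2)[of ?u "bnd M (Suc (Suc j')) w i"] uB wA i carr by auto
    qed (use z z' i yR carr wA in auto)
    then show "\<exists>w. (\<forall>k<?q. w k \<in> A) \<and> (\<forall>i<?p. z i \<ominus>\<^bsub>M\<^esub> bnd M (Suc (Suc j')) w i \<in> B)"
      using wA by (intro exI[of _ w]) auto
  qed
  then show ?thesis by (simp add: Suc)
qed

lemma tor_zero_exact:
  assumes j: "j \<noteq> Suc 0"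
  shows "tor_zero RM (carrier R) {\<zero>} j"
proof (rule tor_zeroI)
  fix v assume v: "\<And>i. i < r (Suc j) \<Longrightarrow> v i \<in> carrier R"
    "\<And>i. i < r j \<Longrightarrow> bnd RM j v i \<in> {\<zero>}"
  then obtain w where w: "\<forall>k<r (Suc (Suc j)). w k \<in> carrier R"
    "\<forall>l<r (Suc j). v l = bnd RM (Suc j) w l"
    using exact[of j v] j by auto
  then have "v i \<ominus> bnd RM (Suc j) w i = \<zero>" if "i < r (Suc j)" for i
    using that v(1)[OF that] by (simp add: r_right_minus_eq)
  then show "\<exists>w. (\<forall>k<r (Suc (Suc j)). w k \<in> carrier R) \<and> (\<forall>i<r (Suc j).
      v i \<ominus>\<^bsub>RM\<^esub> bnd RM (Suc j) w i \<in> {\<zero>})"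
    using w by auto
qed

text \<open>The resolution is exact except at its end, where the cokernel is \<open>R/b\<close>,
  that is, at index one after the shift. There the vector with entry \<open>\<one>\<close> is a
  cycle and bounds only if \<open>\<one> \<in> b\<close>.\<close>

lemma tor_zero_regular:
  assumes "\<one> \<notin> b"
  shows "tor_zero RM (carrier R) {\<zero>} j \<longleftrightarrow> j \<noteq> Suc 0"
proof
  assume T: "tor_zero RM (carrier R) {\<zero>} j"
  show "j \<noteq> Suc 0"
  proof
    assume j: "j = Suc 0"
    obtain w where w: "\<And>k. k < r (Suc (Suc (Suc 0))) \<Longrightarrow> w k \<in> carrier R"
      "\<one> \<ominus> lin RM (r (Suc (Suc (Suc 0)))) (a (Suc (Suc 0)) 0) w = \<zero>"
      using tor_zeroE[OF T[unfolded j], of "\<lambda>_. \<one>"] rank by auto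
    then have "\<one> = lin RM (r (Suc (Suc (Suc 0)))) (a (Suc (Suc 0)) 0) w"
      using rank by (simp add: r_right_minus_eq)
    then show False using assms augmentation[of \<one>] w by auto
  qed
qed (rule tor_zero_exact)

end

section \<open>Finite powers of a module\<close>

text \<open>Injectivity and the cogenerator property concern single maps, so a tuple of maps
  \<open>M \<rightarrow> E\<close> has to be packaged as one map on a power of \<open>M\<close>.
  Tuples are extensional functions in order that the module laws hold as equations.\<close>

definition power_module :: "('r, 'm, 'y) module_scheme \<Rightarrow> nat \<Rightarrow> ('r, nat \<Rightarrow> 'm) module"
  where "power_module M n =
    \<lparr>carrier = {..<n} \<rightarrow>\<^sub>E carrier M, monoid.mult = undefined, one = undefined,
     zero = (\<lambda>i\<in>{..<n}. \<zero>\<^bsub>M\<^esub>), add = (\<lambda>u v. \<lambda>i\<in>{..<n}. u i \<oplus>\<^bsub>M\<^esub> v i),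
     smult = (\<lambda>s u. \<lambda>i\<in>{..<n}. s \<odot>\<^bsub>M\<^esub> u i)\<rparr>"

lemma power_module_simps:
  "carrier (power_module M n) = {..<n} \<rightarrow>\<^sub>E carrier M"
  "\<zero>\<^bsub>power_module M n\<^esub> = (\<lambda>i\<in>{..<n}. \<zero>\<^bsub>M\<^esub>)"
  "u \<oplus>\<^bsub>power_module M n\<^esub> v = (\<lambda>i\<in>{..<n}. u i \<oplus>\<^bsub>M\<^esub> v i)"
  "s \<odot>\<^bsub>power_module M n\<^esub> u = (\<lambda>i\<in>{..<n}. s \<odot>\<^bsub>M\<^esub> u i)"
  by (simp_all add: power_module_def)

lemma power_module_mem: "u \<in> carrier (power_module M n) \<Longrightarrow> i < n \<Longrightarrow> u i \<in> carrier M"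
  by (auto simp: power_module_simps)

definition unit_vector :: "('r, 'm, 'y) module_scheme \<Rightarrow> nat \<Rightarrow> nat \<Rightarrow> 'm \<Rightarrow> nat \<Rightarrow> 'm"
  where "unit_vector M n i m = (\<lambda>k\<in>{..<n}. if k = i then m else \<zero>\<^bsub>M\<^esub>)"

context module
begin

lemma power_module_is_module: "module R (power_module M n)"
proof (intro moduleI abelian_groupI)
  show "cring R" by (rule R.is_cring)
next
  fix u assume u: "u \<in> carrier (power_module M n)"
  have "(\<lambda>i\<in>{..<n}. \<ominus>\<^bsub>M\<^esub> u i) \<in> carrier (power_module M n)"
    "(\<lambda>i\<in>{..<n}. \<ominus>\<^bsub>M\<^esub> u i) \<oplus>\<^bsub>power_module M n\<^esub> u = \<zero>\<^bsub>power_module M n\<^esub>"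
    using u by (auto simp: power_module_simps PiE_def Pi_def M.l_neg fun_eq_iff)
  then show "\<exists>v\<in>carrier (power_module M n). v \<oplus>\<^bsub>power_module M n\<^esub> u = \<zero>\<^bsub>power_module M n\<^esub>" by blast
qed (auto simp: power_module_simps PiE_def Pi_def fun_eq_iff extensional_def M.add.m_ac
      smult_l_distr smult_r_distr smult_assoc1)

lemma unit_vector_hom:
  assumes "i < n"
  shows "unit_vector M n i \<in> module_homs R M (power_module M n)"
  using assms by (auto simp: module_homs_def unit_vector_def power_module_simps fun_eq_iff)

lemma power_module_hom_expand:
  assumes N: "module R N" and f: "f \<in> module_homs R (power_module M n) N"
    and u: "\<And>i. i < n \<Longrightarrow> u i \<in> carrier M"
  shows "f (\<lambda>i\<in>{..<n}. u i) = lin N n (\<lambda>_. \<one>) (\<lambda>i. f (unit_vector M n i (u i)))"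
proof -
  interpret P: module R "power_module M n" by (rule power_module_is_module)
  interpret N: module R N by fact
  have uv: "unit_vector M n i (u i) \<in> carrier (power_module M n)" if "i < n" for i
    using module_homsD(1)[OF unit_vector_hom[OF that]] u[OF that] by blast
  define t where "t q = (\<lambda>k\<in>{..<n}. if k < q then u k else \<zero>\<^bsub>M\<^esub>)" for q
  have "f (t q) = lin N q (\<lambda>_. \<one>) (\<lambda>i. f (unit_vector M n i (u i)))" if "q \<le> n" for q
    using that
  proof (induction q)
    case 0
    have "t 0 = \<zero>\<^bsub>power_module M n\<^esub>" by (simp add: t_def power_module_simps)
    then show ?case using module_homs_zero[OF P.module_axioms N f] by simp
  next
    case (Suc q)
    have "t (Suc q) = t q \<oplus>\<^bsub>power_module M n\<^esub> unit_vector M n q (u q)"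
      using u Suc.prems by (auto simp: t_def power_module_simps unit_vector_def fun_eq_iff less_Suc_eq)
    moreover have "t q \<in> carrier (power_module M n)"
      using u by (auto simp: t_def power_module_simps)
    ultimately show ?case using Suc uv[of q] module_homsD(1,2)[OF f] by simp
  qed
  moreover have "t n = (\<lambda>i\<in>{..<n}. u i)" by (auto simp: t_def fun_eq_iff)
  ultimately show ?thesis by (metis order_refl)
qed

text \<open>With \<open>v\<close> a column of a matrix, the right-hand side is the coboundary of the
  components of \<open>f\<close>, evaluated at \<open>m\<close>. This links maps on powers of
  \<open>M\<close> with the cochains of \<open>Hom(M, N)\<close>.\<close>

lemma power_module_hom_smult:
  assumes N: "module R N" and f: "f \<in> module_homs R (power_module M n) N"
    and v: "\<And>i. i < n \<Longrightarrow> v i \<in> carrier R" and m: "m \<in> carrier M"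
  shows "f (\<lambda>i\<in>{..<n}. v i \<odot>\<^bsub>M\<^esub> m) = lin N n v (\<lambda>i. f (unit_vector M n i m))"
proof -
  interpret N: module R N by fact
  have fu: "(\<lambda>m. f (unit_vector M n i m)) \<in> module_homs R M N" if "i < n" for i
    using module_homs_comp[OF unit_vector_hom[OF that] f] .
  have "f (\<lambda>i\<in>{..<n}. v i \<odot>\<^bsub>M\<^esub> m) = lin N n (\<lambda>_. \<one>) (\<lambda>i. f (unit_vector M n i (v i \<odot>\<^bsub>M\<^esub> m)))"
    by (rule power_module_hom_expand[OF N f]) (use v m in auto)
  also have "\<dots> = lin N n (\<lambda>_. \<one>) (\<lambda>i. v i \<odot>\<^bsub>N\<^esub> f (unit_vector M n i m))"
    using module_homsD(3)[OF fu] v m by (intro lin_cong) auto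
  also have "\<dots> = lin N n v (\<lambda>i. f (unit_vector M n i m))"
    by (rule N.lin_one) (use v module_homsD(1)[OF fu] m in auto)
  finally show ?thesis .
qed

lemma lin_unit_vector:
  assumes "l < n" "\<And>i. i < n \<Longrightarrow> v i \<in> carrier R" "m \<in> carrier M"
  shows "lin M n v (unit_vector M n l m) = v l \<odot>\<^bsub>M\<^esub> m"
proof -
  have "lin M n v (unit_vector M n l m) = lin M n v (\<lambda>i. if i = l then m else \<zero>\<^bsub>M\<^esub>)"
    by (rule lin_cong) (auto simp: unit_vector_def)
  then show ?thesis using lin_unit[OF assms] by simp
qed

lemma power_module_matrix_hom:
  assumes A: "\<And>i l. i < m \<Longrightarrow> l < n \<Longrightarrow> A i l \<in> carrier R"
  shows "(\<lambda>z. \<lambda>i\<in>{..<m}. lin M n (A i) z) \<in> module_homs R (power_module M n) (power_module M m)"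
  unfolding module_homs_def
proof (intro CollectI conjI ballI funcsetI)
  fix u assume u: "u \<in> carrier (power_module M n)"
  note uM = power_module_mem[OF u]
  show "(\<lambda>i\<in>{..<m}. lin M n (A i) u) \<in> carrier (power_module M m)"
    using A uM by (auto simp: power_module_simps)
  fix s assume s: "s \<in> carrier R"
  have "lin M n (A i) (\<lambda>l\<in>{..<n}. s \<odot>\<^bsub>M\<^esub> u l) = s \<odot>\<^bsub>M\<^esub> lin M n (A i) u" if "i < m" for i
    using that A s uM by (subst lin_smult_right[symmetric]) (auto intro!: lin_cong)
  then show "(\<lambda>i\<in>{..<m}. lin M n (A i) (s \<odot>\<^bsub>power_module M n\<^esub> u)) =
      s \<odot>\<^bsub>power_module M m\<^esub> (\<lambda>i\<in>{..<m}. lin M n (A i) u)"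
    by (auto simp: power_module_simps fun_eq_iff)
next
  fix u v
  assume u: "u \<in> carrier (power_module M n)" and v: "v \<in> carrier (power_module M n)"
  have "lin M n (A i) (\<lambda>l\<in>{..<n}. u l \<oplus>\<^bsub>M\<^esub> v l) = lin M n (A i) u \<oplus>\<^bsub>M\<^esub> lin M n (A i) v" if "i < m" for i
    using that A power_module_mem[OF u] power_module_mem[OF v]
    by (subst lin_add_right[symmetric]) (auto intro!: lin_cong)
  then show "(\<lambda>i\<in>{..<m}. lin M n (A i) (u \<oplus>\<^bsub>power_module M n\<^esub> v)) =
      (\<lambda>i\<in>{..<m}. lin M n (A i) u) \<oplus>\<^bsub>power_module M m\<^esub> (\<lambda>i\<in>{..<m}. lin M n (A i) v)"
    by (auto simp: power_module_simps fun_eq_iff)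
qed

lemma power_module_sum_hom:
  assumes N: "module R N" and \<phi>: "\<And>i. i < n \<Longrightarrow> \<phi> i \<in> module_homs R M N"
  shows "(\<lambda>z. lin N n (\<lambda>_. \<one>) (\<lambda>i. \<phi> i (z i))) \<in> module_homs R (power_module M n) N"
proof -
  interpret N: module R N by fact
  note \<phi>D = module_homsD[OF \<phi>]
  show ?thesis
    unfolding module_homs_def
  proof (intro CollectI conjI ballI funcsetI)
    fix u assume u: "u \<in> carrier (power_module M n)"
    note uM = power_module_mem[OF u]
    show "lin N n (\<lambda>_. \<one>) (\<lambda>i. \<phi> i (u i)) \<in> carrier N"
      using \<phi>D(1) uM by auto
    fix s assume s: "s \<in> carrier R"
    show "lin N n (\<lambda>_. \<one>) (\<lambda>i. \<phi> i ((s \<odot>\<^bsub>power_module M n\<^esub> u) i)) =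
        s \<odot>\<^bsub>N\<^esub> lin N n (\<lambda>_. \<one>) (\<lambda>i. \<phi> i (u i))"
      using \<phi>D uM s by (subst N.lin_smult_right[symmetric]) (auto intro!: lin_cong simp: power_module_simps)
  next
    fix u v
    assume u: "u \<in> carrier (power_module M n)" and v: "v \<in> carrier (power_module M n)"
    show "lin N n (\<lambda>_. \<one>) (\<lambda>i. \<phi> i ((u \<oplus>\<^bsub>power_module M n\<^esub> v) i)) =
        lin N n (\<lambda>_. \<one>) (\<lambda>i. \<phi> i (u i)) \<oplus>\<^bsub>N\<^esub> lin N n (\<lambda>_. \<one>) (\<lambda>i. \<phi> i (v i))"
      using \<phi>D power_module_mem[OF u] power_module_mem[OF v]
      by (subst N.lin_add_right[symmetric]) (auto intro!: lin_cong simp: power_module_simps)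
  qed
qed

lemma sum_hom_smult:
  assumes N: "module R N" and \<phi>: "\<And>i. i < n \<Longrightarrow> \<phi> i \<in> module_homs R M N"
    and v: "\<And>i. i < n \<Longrightarrow> v i \<in> carrier R" and m: "m \<in> carrier M"
  shows "lin N n (\<lambda>_. \<one>) (\<lambda>i. \<phi> i ((\<lambda>l\<in>{..<n}. v l \<odot>\<^bsub>M\<^esub> m) i)) = lin N n v (\<lambda>i. \<phi> i m)"
proof -
  interpret N: module R N by fact
  show ?thesis
    using module_homsD(1,3)[OF \<phi>] v m by (subst N.lin_one[symmetric]) (auto intro!: lin_cong)
qed

end

section \<open>Vanishing of Ext and duality\<close>

lemma Hom_module_simps:
  "carrier (Hom_module R M N) = module_homs R M N \<inter> extensional (carrier M)"
  "\<zero>\<^bsub>Hom_module R M N\<^esub> = (\<lambda>x\<in>carrier M. \<zero>\<^bsub>N\<^esub>)"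
  "f \<oplus>\<^bsub>Hom_module R M N\<^esub> g = (\<lambda>x\<in>carrier M. f x \<oplus>\<^bsub>N\<^esub> g x)"
  "s \<odot>\<^bsub>Hom_module R M N\<^esub> f = (\<lambda>x\<in>carrier M. s \<odot>\<^bsub>N\<^esub> f x)"
  by (simp_all add: Hom_module_def)

text \<open>Evaluation at \<open>x\<close> is a homomorphism, so coboundaries in
  \<open>Hom(M, N)\<close> may be computed pointwise.\<close>

lemma lin_Hom_module:
  assumes "module R M" "module R N" "x \<in> carrier M"
    and "\<And>l. l < n \<Longrightarrow> v l \<in> carrier R" "\<And>l. l < n \<Longrightarrow> f l \<in> carrier (Hom_module R M N)"
  shows "lin (Hom_module R M N) n v f x = lin N n v (\<lambda>l. f l x)"
proof -
  have "(\<lambda>f. f x) \<in> module_homs R (Hom_module R M N) N"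
    using assms(3) by (auto simp: module_homs_def Hom_module_simps)
  from module_homs_lin[OF Hom_module_is_module[OF assms(1,2)] assms(2) this] show ?thesis
    using assms by simp
qed

lemma restrict_in_Hom_module:
  assumes "module R M" "f \<in> module_homs R M N"
  shows "restrict f (carrier M) \<in> carrier (Hom_module R M N)"
proof -
  interpret M: module R M by fact
  show ?thesis using assms(2) by (auto simp: module_homs_def Hom_module_simps)
qed

lemma Hom_module_eqI:
  assumes "f \<in> carrier (Hom_module R M N)" "g \<in> carrier (Hom_module R M N)"
    "\<And>x. x \<in> carrier M \<Longrightarrow> f x = g x"
  shows "f = g"
  using assms by (auto simp: Hom_module_simps intro: extensionalityI)

context free_resolution
begin

text \<open>\<open>ext_zero M A (j + 1)\<close> says that \<open>Ext\<^sup>j(R/b, A) = 0\<close> for a submodule \<open>A\<close> of \<open>M\<close>.\<close>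

definition ext_zero :: "('a, 'm, 'y) module_scheme \<Rightarrow> 'm set \<Rightarrow> nat \<Rightarrow> bool"
  where "ext_zero M A j \<longleftrightarrow> (\<forall>z. (\<forall>i<r (Suc j). z i \<in> A) \<longrightarrow>
    (\<forall>k<r (Suc (Suc j)). cobnd M (Suc j) z k = \<zero>\<^bsub>M\<^esub>) \<longrightarrow>
    (\<exists>w. (\<forall>i<r j. w i \<in> A) \<and> (\<forall>l<r (Suc j). z l = cobnd M j w l)))"

lemma ext_zeroI:
  assumes "\<And>z. (\<And>i. i < r (Suc j) \<Longrightarrow> z i \<in> A) \<Longrightarrow>
    (\<And>k. k < r (Suc (Suc j)) \<Longrightarrow> cobnd M (Suc j) z k = \<zero>\<^bsub>M\<^esub>) \<Longrightarrow>
    \<exists>w. (\<forall>i<r j. w i \<in> A) \<and> (\<forall>l<r (Suc j). z l = cobnd M j w l)"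
  shows "ext_zero M A j"
  using assms unfolding ext_zero_def by blast

lemma ext_zeroE:
  assumes "ext_zero M A j" "\<And>i. i < r (Suc j) \<Longrightarrow> z i \<in> A"
    "\<And>k. k < r (Suc (Suc j)) \<Longrightarrow> cobnd M (Suc j) z k = \<zero>\<^bsub>M\<^esub>"
  obtains w where "\<And>i. i < r j \<Longrightarrow> w i \<in> A" "\<And>l. l < r (Suc j) \<Longrightarrow> z l = cobnd M j w l"
  using assms unfolding ext_zero_def by blast

text \<open>The cochain \<open>\<phi>\<close> is one map \<open>\<Phi>\<close> on a power of
  \<open>M\<close>, and being a cocycle means killing boundaries. Since Tor vanishes,
  \<open>\<Phi>\<close> kills all cycles, so it factors through the differential by injectivity of
  \<open>E\<close>; the components of the factor are \<open>\<psi>\<close>.\<close>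

lemma dual_exact:
  assumes E: "injective_module R E" and M: "module R M"
    and T: "tor_zero M (carrier M) {\<zero>\<^bsub>M\<^esub>} j"
    and \<phi>: "\<And>i. i < r (Suc j) \<Longrightarrow> \<phi> i \<in> module_homs R M E"
    and cocycle: "\<And>k m. k < r (Suc (Suc j)) \<Longrightarrow> m \<in> carrier M \<Longrightarrow>
      cobnd E (Suc j) (\<lambda>i. \<phi> i m) k = \<zero>\<^bsub>E\<^esub>"
  obtains \<psi> where "\<And>i. i < r j \<Longrightarrow> \<psi> i \<in> module_homs R M E"
    "\<And>l m. l < r (Suc j) \<Longrightarrow> m \<in> carrier M \<Longrightarrow> \<phi> l m = cobnd E j (\<lambda>i. \<psi> i m) l"
proof -
  interpret M: module R M by fact
  interpret E: module R E using E by (simp add: injective_module_def)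
  let ?n = "r (Suc j)" and ?p = "r (Suc (Suc j))"
  define \<Phi> where "\<Phi> z = lin E ?n (\<lambda>_. \<one>) (\<lambda>i. \<phi> i (z i))" for z
  have \<Phi>: "\<Phi> \<in> module_homs R (power_module M ?n) E"
    unfolding \<Phi>_def[abs_def] by (rule M.power_module_sum_hom[OF E.module_axioms \<phi>])
  define D where "D z = (\<lambda>i\<in>{..<r j}. bnd M j z i)" for z
  have D: "D \<in> module_homs R (power_module M ?n) (power_module M (r j))"
    unfolding D_def[abs_def] by (rule M.power_module_matrix_hom) simp
  define D' where "D' w = (\<lambda>i\<in>{..<?n}. bnd M (Suc j) w i)" for w
  have \<Phi>D': "(\<lambda>w. \<Phi> (D' w)) \<in> module_homs R (power_module M ?p) E"
    unfolding D'_def[abs_def] by (rule module_homs_comp[OF M.power_module_matrix_hom \<Phi>]) simp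
  have D'_unit: "\<Phi> (D' (unit_vector M ?p k m)) = \<zero>\<^bsub>E\<^esub>" if "k < ?p" "m \<in> carrier M" for k m
  proof -
    have "D' (unit_vector M ?p k m) = (\<lambda>i\<in>{..<?n}. a (Suc j) i k \<odot>\<^bsub>M\<^esub> m)"
      unfolding D'_def using that by (intro restrict_ext M.lin_unit_vector) auto
    then show ?thesis
      using M.sum_hom_smult[OF E.module_axioms, of ?n \<phi> "\<lambda>i. a (Suc j) i k" m] \<phi> cocycle[OF that] that
      by (simp add: \<Phi>_def)
  qed
  \<comment> \<open>A cycle is the boundary \<open>D' w\<close> of some \<open>w\<close>; expanding
    \<open>w\<close> into unit vectors reduces the claim to \<open>D'_unit\<close>.\<close>
  have ker: "\<Phi> z = \<zero>\<^bsub>E\<^esub>" if z: "z \<in> carrier (power_module M ?n)" "D z = \<zero>\<^bsub>power_module M (r j)\<^esub>" for z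
  proof -
    have zM: "z i \<in> carrier M" if "i < ?n" for i using z(1) that by (auto simp: power_module_simps)
    have "bnd M j z i = \<zero>\<^bsub>M\<^esub>" if "i < r j" for i
      using fun_cong[OF z(2), of i] that by (simp add: D_def power_module_simps)
    then obtain w where w: "\<And>k. k < ?p \<Longrightarrow> w k \<in> carrier M"
      "\<And>i. i < ?n \<Longrightarrow> z i \<ominus>\<^bsub>M\<^esub> bnd M (Suc j) w i = \<zero>\<^bsub>M\<^esub>"
      using tor_zeroE[OF T, of z] zM by auto
    have "z i = bnd M (Suc j) w i" if i: "i < ?n" for i
      using M.add_minus_cancel(4)[of "z i" "bnd M (Suc j) w i"] w i zM by auto
    moreover have "bnd M (Suc j) w i = bnd M (Suc j) (\<lambda>k\<in>{..<?p}. w k) i" for i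
      by (rule lin_cong) auto
    ultimately have "z = D' (\<lambda>k\<in>{..<?p}. w k)"
      using z(1) by (auto simp: D'_def fun_eq_iff power_module_simps PiE_def extensional_def)
    then have "\<Phi> z = lin E ?p (\<lambda>_. \<one>) (\<lambda>k. \<Phi> (D' (unit_vector M ?p k (w k))))"
      using M.power_module_hom_expand[OF E.module_axioms \<Phi>D' w(1)] by simp
    also have "\<dots> = lin E ?p (\<lambda>_. \<one>) (\<lambda>k. \<zero>\<^bsub>E\<^esub>)" using D'_unit w(1) by (intro lin_cong) auto
    finally show ?thesis by simp
  qed
  obtain h where h: "h \<in> module_homs R (power_module M (r j)) E"
    and hD: "\<And>z. z \<in> carrier (power_module M ?n) \<Longrightarrow> h (D z) = \<Phi> z"
    using injective_factor[OF E M.power_module_is_module M.power_module_is_module D \<Phi> ker] by blast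
  show thesis
  proof (rule that)
    show "(\<lambda>m. h (unit_vector M (r j) i m)) \<in> module_homs R M E" if "i < r j" for i
      using module_homs_comp[OF M.unit_vector_hom[OF that] h] .
    fix l m assume l: "l < ?n" and m: "m \<in> carrier M"
    have "\<Phi> (unit_vector M ?n l m) = lin E ?n (\<lambda>_. \<one>) (\<lambda>i. if i = l then \<phi> l m else \<zero>\<^bsub>E\<^esub>)"
      unfolding \<Phi>_def
      using module_homs_zero[OF M E.module_axioms \<phi>] by (intro lin_cong) (auto simp: unit_vector_def)
    also have "\<dots> = \<phi> l m" using E.lin_unit[of l ?n "\<lambda>_. \<one>" "\<phi> l m"] module_homsD(1)[OF \<phi>[OF l] m] l by simp
    finally have "\<phi> l m = h (D (unit_vector M ?n l m))"
      using hD module_homsD(1)[OF M.unit_vector_hom[OF l] m] by simp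
    also have "D (unit_vector M ?n l m) = (\<lambda>i\<in>{..<r j}. a j i l \<odot>\<^bsub>M\<^esub> m)"
      unfolding D_def using l m by (intro restrict_ext M.lin_unit_vector) auto
    also have "h \<dots> = cobnd E j (\<lambda>i. h (unit_vector M (r j) i m)) l"
      by (rule M.power_module_hom_smult[OF E.module_axioms h]) (use l m in auto)
    finally show "\<phi> l m = cobnd E j (\<lambda>i. h (unit_vector M (r j) i m)) l" .
  qed
qed

end

context free_resolution
begin

text \<open>If a cycle \<open>z\<close> were no boundary, a map \<open>\<phi>\<close> into
  \<open>E\<close> would kill all boundaries but not \<open>z\<close>. Its components form a cocycle
  of the dual, hence a coboundary, which means that \<open>\<phi>\<close> factors through the
  differential and kills \<open>z\<close> after all.\<close>

lemma tor_zero_if_ext_zero_dual: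
  assumes E: "module R E" and M: "module R M"
    and cogenerator: "\<And>S u. submodule S R (power_module M (r (Suc j))) \<Longrightarrow>
      u \<in> carrier (power_module M (r (Suc j))) \<Longrightarrow> u \<notin> S \<Longrightarrow>
      \<exists>\<phi>\<in>module_homs R (power_module M (r (Suc j))) E. (\<forall>x\<in>S. \<phi> x = \<zero>\<^bsub>E\<^esub>) \<and> \<phi> u \<noteq> \<zero>\<^bsub>E\<^esub>"
    and X: "ext_zero (Hom_module R M E) (carrier (Hom_module R M E)) j"
  shows "tor_zero M (carrier M) {\<zero>\<^bsub>M\<^esub>} j"
proof (rule tor_zeroI)
  interpret M: module R M by fact
  interpret E: module R E by fact
  interpret H: module R "Hom_module R M E" by (rule Hom_module_is_module) fact+
  let ?n = "r (Suc j)" and ?p = "r (Suc (Suc j))" and ?H = "Hom_module R M E"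
  let ?P = "power_module M ?n"
  interpret P: module R ?P by (rule M.power_module_is_module)
  fix z assume z: "\<And>i. i < ?n \<Longrightarrow> z i \<in> carrier M"
    and dz: "\<And>i. i < r j \<Longrightarrow> bnd M j z i \<in> {\<zero>\<^bsub>M\<^esub>}"
  define D where "D w = (\<lambda>i\<in>{..<?n}. bnd M (Suc j) w i)" for w
  have D: "D \<in> module_homs R (power_module M ?p) ?P"
    unfolding D_def[abs_def] by (rule M.power_module_matrix_hom) simp
  define S where "S = D ` carrier (power_module M ?p)"
  have S: "submodule S R ?P"
    unfolding S_def by (rule image_submodule[OF M.power_module_is_module P.module_axioms D
          module.carrier_is_submodule[OF M.power_module_is_module]])
  have zP: "(\<lambda>i\<in>{..<?n}. z i) \<in> carrier ?P" using z by (auto simp: power_module_simps)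
  have "(\<lambda>i\<in>{..<?n}. z i) \<in> S"
  proof (rule ccontr)
    assume "(\<lambda>i\<in>{..<?n}. z i) \<notin> S"
    then obtain \<phi> where \<phi>: "\<phi> \<in> module_homs R ?P E" and \<phi>S: "\<forall>x\<in>S. \<phi> x = \<zero>\<^bsub>E\<^esub>"
      and \<phi>z: "\<phi> (\<lambda>i\<in>{..<?n}. z i) \<noteq> \<zero>\<^bsub>E\<^esub>"
      using cogenerator[OF S zP] by blast
    define f where "f i = (\<lambda>m\<in>carrier M. \<phi> (unit_vector M ?n i m))" for i
    have f: "f i \<in> carrier ?H" if "i < ?n" for i
      unfolding f_def
      using module_homs_comp[OF M.unit_vector_hom[OF that] \<phi>] by (rule restrict_in_Hom_module[OF M])
    have "cobnd ?H (Suc j) f k = \<zero>\<^bsub>?H\<^esub>" if k: "k < ?p" for k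
    proof (rule Hom_module_eqI)
      fix m assume m: "m \<in> carrier M"
      have "D (unit_vector M ?p k m) = (\<lambda>i\<in>{..<?n}. a (Suc j) i k \<odot>\<^bsub>M\<^esub> m)"
        unfolding D_def using k m by (intro restrict_ext M.lin_unit_vector) auto
      then have "\<zero>\<^bsub>E\<^esub> = \<phi> (\<lambda>i\<in>{..<?n}. a (Suc j) i k \<odot>\<^bsub>M\<^esub> m)"
        using \<phi>S module_homsD(1)[OF M.unit_vector_hom[OF k] m] by (auto simp: S_def)
      also have "\<dots> = cobnd E (Suc j) (\<lambda>i. \<phi> (unit_vector M ?n i m)) k"
        by (rule M.power_module_hom_smult[OF E \<phi>]) (use k m in auto)
      finally show "cobnd ?H (Suc j) f k m = \<zero>\<^bsub>?H\<^esub> m"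
        using lin_Hom_module[OF M E m, of ?n "\<lambda>i. a (Suc j) i k" f] f k m
        by (simp add: Hom_module_simps f_def)
    qed (use f k in auto)
    then obtain w where w: "\<And>i. i < r j \<Longrightarrow> w i \<in> carrier ?H"
      and fw: "\<And>l. l < ?n \<Longrightarrow> f l = cobnd ?H j w l"
      using ext_zeroE[OF X, of f] f by auto
    have wh: "w i \<in> module_homs R M E" if "i < r j" for i
      using w[OF that] by (auto simp: Hom_module_simps)
    define B where "B u = (\<lambda>i\<in>{..<r j}. bnd M j u i)" for u
    define \<Psi> where "\<Psi> u = lin E (r j) (\<lambda>_. \<one>) (\<lambda>i. w i (u i))" for u
    have \<Psi>: "\<Psi> \<in> module_homs R (power_module M (r j)) E"
      unfolding \<Psi>_def[abs_def] by (rule M.power_module_sum_hom[OF E wh])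
    have \<Psi>B: "(\<lambda>u. \<Psi> (B u)) \<in> module_homs R ?P E"
      unfolding B_def[abs_def] by (rule module_homs_comp[OF M.power_module_matrix_hom \<Psi>]) simp
    have unit: "\<phi> (unit_vector M ?n l (z l)) = \<Psi> (B (unit_vector M ?n l (z l)))" if l: "l < ?n" for l
    proof -
      have "B (unit_vector M ?n l (z l)) = (\<lambda>i\<in>{..<r j}. a j i l \<odot>\<^bsub>M\<^esub> z l)"
        unfolding B_def using l z by (intro restrict_ext M.lin_unit_vector) auto
      then have "\<Psi> (B (unit_vector M ?n l (z l))) = cobnd E j (\<lambda>i. w i (z l)) l"
        using M.sum_hom_smult[OF E, of "r j" w "\<lambda>i. a j i l" "z l"] wh l z by (simp add: \<Psi>_def)
      also have "\<dots> = f l (z l)"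
        unfolding fw[OF l] by (rule lin_Hom_module[OF M E z[OF l], symmetric]) (use l w in auto)
      finally show ?thesis using z[OF l] by (simp add: f_def)
    qed
    have "\<phi> (\<lambda>i\<in>{..<?n}. z i) = lin E ?n (\<lambda>_. \<one>) (\<lambda>l. \<phi> (unit_vector M ?n l (z l)))"
      by (rule M.power_module_hom_expand[OF E \<phi> z])
    also have "\<dots> = lin E ?n (\<lambda>_. \<one>) (\<lambda>l. \<Psi> (B (unit_vector M ?n l (z l))))"
      using unit by (intro lin_cong) auto
    also have "\<dots> = \<Psi> (B (\<lambda>i\<in>{..<?n}. z i))"
      by (rule M.power_module_hom_expand[OF E \<Psi>B z, symmetric])
    also have "B (\<lambda>i\<in>{..<?n}. z i) = \<zero>\<^bsub>power_module M (r j)\<^esub>"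
    proof -
      have "bnd M j (\<lambda>i\<in>{..<?n}. z i) i = bnd M j z i" for i by (rule lin_cong) auto
      then show ?thesis using dz by (auto simp: B_def power_module_simps fun_eq_iff)
    qed
    also have "\<Psi> \<dots> = \<zero>\<^bsub>E\<^esub>" by (rule module_homs_zero[OF M.power_module_is_module E \<Psi>])
    finally show False using \<phi>z by contradiction
  qed
  then obtain w where w: "\<forall>k<?p. w k \<in> carrier M" and eq: "(\<lambda>i\<in>{..<?n}. z i) = D w"
    by (auto simp: S_def power_module_simps)
  have "z i \<ominus>\<^bsub>M\<^esub> bnd M (Suc j) w i = \<zero>\<^bsub>M\<^esub>" if i: "i < ?n" for i
    using fun_cong[OF eq, of i] i z[OF i] w M.add_minus_cancel(4) by (auto simp: D_def)
  then show "\<exists>w. (\<forall>k<?p. w k \<in> carrier M) \<and>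
      (\<forall>i<?n. z i \<ominus>\<^bsub>M\<^esub> bnd M (Suc j) w i \<in> {\<zero>\<^bsub>M\<^esub>})"
    using w by auto
qed

lemma ext_zero_dual_if_tor_zero:
  assumes E: "injective_module R E" and M: "module R M"
    and T: "tor_zero M (carrier M) {\<zero>\<^bsub>M\<^esub>} j"
  shows "ext_zero (Hom_module R M E) (carrier (Hom_module R M E)) j"
proof (rule ext_zeroI)
  let ?n = "r (Suc j)" and ?p = "r (Suc (Suc j))" and ?H = "Hom_module R M E"
  have modE: "module R E" using E by (simp add: injective_module_def)
  interpret H: module R ?H by (rule Hom_module_is_module) fact+
  fix f assume f: "\<And>i. i < ?n \<Longrightarrow> f i \<in> carrier ?H"
    and df: "\<And>k. k < ?p \<Longrightarrow> cobnd ?H (Suc j) f k = \<zero>\<^bsub>?H\<^esub>"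
  have fh: "\<And>i. i < ?n \<Longrightarrow> f i \<in> module_homs R M E" using f by (auto simp: Hom_module_simps)
  have "cobnd E (Suc j) (\<lambda>i. f i m) k = \<zero>\<^bsub>E\<^esub>" if "k < ?p" "m \<in> carrier M" for k m
    using lin_Hom_module[OF M modE that(2), of ?n "\<lambda>i. a (Suc j) i k" f] f df that
    by (simp add: Hom_module_simps)
  then obtain \<psi> where \<psi>: "\<And>i. i < r j \<Longrightarrow> \<psi> i \<in> module_homs R M E"
    and f\<psi>: "\<And>l m. l < ?n \<Longrightarrow> m \<in> carrier M \<Longrightarrow> f l m = cobnd E j (\<lambda>i. \<psi> i m) l"
    using dual_exact[OF E M T, of f] fh by blast
  define w where "w i = restrict (\<psi> i) (carrier M)" for i
  have w: "w i \<in> carrier ?H" if "i < r j" for i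
    unfolding w_def using \<psi>[OF that] by (rule restrict_in_Hom_module[OF M])
  have "f l = cobnd ?H j w l" if l: "l < ?n" for l
  proof (rule Hom_module_eqI)
    fix m assume m: "m \<in> carrier M"
    have "cobnd ?H j w l m = cobnd E j (\<lambda>i. w i m) l"
      by (rule lin_Hom_module[OF M modE m]) (use l w in auto)
    then show "f l m = cobnd ?H j w l m" using f\<psi>[OF l m] m by (simp add: w_def)
  qed (use f l w in auto)
  then show "\<exists>w. (\<forall>i<r j. w i \<in> carrier ?H) \<and> (\<forall>l<?n. f l = cobnd ?H j w l)"
    using w by (intro exI[of _ w]) auto
qed

text \<open>The case \<open>M = R\<close> of \<open>dual_exact\<close>: elements of \<open>J\<close>
  are maps from \<open>R\<close> to \<open>J\<close>, recovered by evaluation at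
  \<open>\<one>\<close>. The excluded index belongs to \<open>Ext^0\<close>.\<close>

lemma ext_zero_injective:
  assumes J: "injective_module R J" and j: "j \<noteq> Suc 0"
  shows "ext_zero J (carrier J) j"
proof (rule ext_zeroI)
  interpret J: module R J using J by (simp add: injective_module_def)
  let ?n = "r (Suc j)" and ?p = "r (Suc (Suc j))"
  fix z assume z: "\<And>i. i < ?n \<Longrightarrow> z i \<in> carrier J"
    and dz: "\<And>k. k < ?p \<Longrightarrow> cobnd J (Suc j) z k = \<zero>\<^bsub>J\<^esub>"
  have T: "tor_zero RM (carrier RM) {\<zero>\<^bsub>RM\<^esub>} j"
    using tor_zero_exact[OF j] by simp
  have hom: "\<And>i. i < ?n \<Longrightarrow> (\<lambda>s. s \<odot>\<^bsub>J\<^esub> z i) \<in> module_homs R RM J"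
    using z J.orbit_hom by blast
  obtain \<psi> where \<psi>: "\<And>i. i < r j \<Longrightarrow> \<psi> i \<in> module_homs R RM J"
    and z\<psi>: "\<And>l m. l < ?n \<Longrightarrow> m \<in> carrier RM \<Longrightarrow>
      m \<odot>\<^bsub>J\<^esub> z l = cobnd J j (\<lambda>i. \<psi> i m) l"
  proof (rule dual_exact[OF J RR.module_axioms T hom])
    fix k m assume "k < ?p" "m \<in> carrier RM"
    then show "cobnd J (Suc j) (\<lambda>i. m \<odot>\<^bsub>J\<^esub> z i) k = \<zero>\<^bsub>J\<^esub>"
      using J.lin_smult_right[of ?n "\<lambda>i. a (Suc j) i k" z m] z dz by simp
  qed blast+
  have "z l = cobnd J j (\<lambda>i. \<psi> i \<one>) l" if "l < ?n" for l
    using z\<psi>[OF that, of \<one>] z[OF that] by simp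
  then show "\<exists>w. (\<forall>i<r j. w i \<in> carrier J) \<and> (\<forall>l<?n. z l = cobnd J j w l)"
    using module_homsD(1)[OF \<psi>, of _ \<one>] by (intro exI[of _ "\<lambda>i. \<psi> i \<one>"]) auto
qed

lemma cobnd_cobnd:
  assumes M: "module R M" and k: "k < r (Suc (Suc j))" and w: "\<And>i. i < r j \<Longrightarrow> w i \<in> carrier M"
  shows "cobnd M (Suc j) (\<lambda>l. cobnd M j w l) k = \<zero>\<^bsub>M\<^esub>"
proof -
  interpret M: module R M by fact
  have "cobnd M (Suc j) (\<lambda>l. cobnd M j w l) k =
      lin M (r j) (\<lambda>i. cobnd RM (Suc j) (\<lambda>l. a j i l) k) w"
    by (rule M.lin_lin) (use assms in auto)
  also have "\<dots> = lin M (r j) (\<lambda>i. \<zero>) w"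
  proof (rule lin_cong)
    fix i assume i: "i < r j"
    show "cobnd RM (Suc j) (\<lambda>l. a j i l) k = \<zero>"
      using RR.lin_regular_commute[of "r (Suc j)" "\<lambda>l. a (Suc j) l k" "\<lambda>l. a j i l"] a_a[OF i k] i k by simp
  qed simp
  finally show ?thesis using w by simp
qed

text \<open>The entries of the only row of \<open>a 2\<close> generate \<open>b\<close>, so the
  cocycles of degree zero form \<open>Hom(R/b, M)\<close>, the part of \<open>M\<close> killed by
  \<open>b\<close>.\<close>

lemma killed_iff:
  assumes M: "module R M" and m: "m \<in> carrier M"
  shows "(\<forall>s\<in>b. s \<odot>\<^bsub>M\<^esub> m = \<zero>\<^bsub>M\<^esub>) \<longleftrightarrow>
    (\<forall>k<r (Suc (Suc (Suc 0))). a (Suc (Suc 0)) 0 k \<odot>\<^bsub>M\<^esub> m = \<zero>\<^bsub>M\<^esub>)"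
proof -
  interpret M: module R M by fact
  let ?n = "r (Suc (Suc (Suc 0)))" and ?a = "a (Suc (Suc 0)) 0"
  have aR: "\<And>k. k < ?n \<Longrightarrow> ?a k \<in> carrier R" using rank by auto
  show ?thesis
  proof
    assume k: "\<forall>s\<in>b. s \<odot>\<^bsub>M\<^esub> m = \<zero>\<^bsub>M\<^esub>"
    show "\<forall>k<?n. ?a k \<odot>\<^bsub>M\<^esub> m = \<zero>\<^bsub>M\<^esub>"
    proof (intro allI impI)
      fix k' assume k': "k' < ?n"
      have "lin RM ?n ?a (\<lambda>l. if l = k' then \<one> else \<zero>) = ?a k'"
        using RR.lin_unit[of k' ?n ?a \<one>, unfolded regular_module_simps] aR k' by simp
      then have "?a k' \<in> b"
        unfolding augmentation by (intro exI[of _ "\<lambda>l. if l = k' then \<one> else \<zero>"]) auto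
      then show "?a k' \<odot>\<^bsub>M\<^esub> m = \<zero>\<^bsub>M\<^esub>" using k by blast
    qed
  next
    assume k: "\<forall>k<?n. ?a k \<odot>\<^bsub>M\<^esub> m = \<zero>\<^bsub>M\<^esub>"
    show "\<forall>s\<in>b. s \<odot>\<^bsub>M\<^esub> m = \<zero>\<^bsub>M\<^esub>"
    proof
      fix s assume "s \<in> b"
      then obtain w where w: "\<forall>k<?n. w k \<in> carrier R" "s = lin RM ?n ?a w"
        by (auto simp: augmentation)
      then have "s = lin RM ?n w ?a"
        using RR.lin_regular_commute[of ?n ?a w] aR by simp
      then have "s \<odot>\<^bsub>M\<^esub> m = lin M ?n w (\<lambda>k. ?a k \<odot>\<^bsub>M\<^esub> m)"
        using M.lin_smult_lin[of ?n w ?a m] w aR m by simp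
      also have "\<dots> = lin M ?n w (\<lambda>k. \<zero>\<^bsub>M\<^esub>)" using k by (intro lin_cong) auto
      finally show "s \<odot>\<^bsub>M\<^esub> m = \<zero>\<^bsub>M\<^esub>" using w by simp
    qed
  qed
qed

text \<open>Along \<open>0 \<rightarrow> Z \<rightarrow> J \<rightarrow> Z' \<rightarrow> 0\<close>, the vanishing of Ext for \<open>Z\<close> and, one degree lower, for \<open>Z'\<close> both
  amount to lifting cocycles from \<open>Z'\<close> to \<open>J\<close>; the latter still makes sense in degree \<open>0\<close>.\<close>

context
  fixes J :: "('a, 'm, 'y) module_scheme" and J' :: "('a, 'n, 'z) module_scheme" and f Z Z'
  assumes J: "injective_module R J" and J': "module R J'" and f: "f \<in> module_homs R J J'"
    and Z: "Z = {z \<in> carrier J. f z = \<zero>\<^bsub>J'\<^esub>}" and Z': "Z' = f ` carrier J"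
begin

private lemma J_module: "module R J" using J by (simp add: injective_module_def)
interpretation J: module R J by (rule J_module)
interpretation J': module R J' by (rule J')

private lemma f_lin: "(\<And>l. l < n \<Longrightarrow> v l \<in> carrier R) \<Longrightarrow> (\<And>l. l < n \<Longrightarrow> z l \<in> carrier J) \<Longrightarrow>
    f (lin J n v z) = lin J' n v (\<lambda>l. f (z l))"
  by (rule module_homs_lin[OF J_module J' f])

private lemma f_minus: "x \<in> carrier J \<Longrightarrow> y \<in> carrier J \<Longrightarrow> f (x \<ominus>\<^bsub>J\<^esub> y) = f x \<ominus>\<^bsub>J'\<^esub> f y"
  by (rule module_homs_minus[OF J_module J' f])

private lemma f_closed: "x \<in> carrier J \<Longrightarrow> f x \<in> carrier J'"
  by (rule module_homsD(1)[OF f])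

private lemma lift: "(\<And>i. i < n \<Longrightarrow> z' i \<in> Z') \<Longrightarrow> \<exists>z. \<forall>i<n. z i \<in> carrier J \<and> z' i = f (z i)" for n :: nat
  unfolding Z' by (intro choice allI) blast

definition cocycles_lift :: "nat \<Rightarrow> bool"
  where "cocycles_lift j \<longleftrightarrow> (\<forall>z'. (\<forall>i<r (Suc j). z' i \<in> Z') \<longrightarrow>
    (\<forall>k<r (Suc (Suc j)). cobnd J' (Suc j) z' k = \<zero>\<^bsub>J'\<^esub>) \<longrightarrow>
    (\<exists>z. (\<forall>i<r (Suc j). z i \<in> carrier J \<and> z' i = f (z i)) \<and>
      (\<forall>k<r (Suc (Suc j)). cobnd J (Suc j) z k = \<zero>\<^bsub>J\<^esub>)))"

text \<open>The connecting map: an arbitrary lift to \<open>J\<close> of a cocycle of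
  \<open>Z'\<close> has its coboundary in \<open>Z\<close>, and vanishing of Ext for
  \<open>Z\<close> corrects the lift. Conversely a cocycle of \<open>Z\<close> is the coboundary of
  some \<open>w\<close> in \<open>J\<close>; if \<open>f w\<close> also lifts to a cocycle
  \<open>u\<close>, then \<open>w - u\<close> lies in \<open>Z\<close> and has the same
  coboundary.\<close>

lemma ext_zero_iff_cocycles_lift: "ext_zero J Z (Suc (Suc j)) \<longleftrightarrow> cocycles_lift (Suc j)"
proof
  let ?n = "r (Suc (Suc j))" and ?p = "r (Suc (Suc (Suc j)))"
  assume X: "ext_zero J Z (Suc (Suc j))"
  show "cocycles_lift (Suc j)"
    unfolding cocycles_lift_def
  proof (intro allI impI)
    fix z' assume z': "\<forall>i<?n. z' i \<in> Z'" and dz': "\<forall>k<?p. cobnd J' (Suc (Suc j)) z' k = \<zero>\<^bsub>J'\<^esub>"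
    obtain z where z: "\<And>i. i < ?n \<Longrightarrow> z i \<in> carrier J" "\<And>i. i < ?n \<Longrightarrow> z' i = f (z i)"
      using lift[of ?n z'] z' by blast
    have "cobnd J (Suc (Suc j)) z k \<in> Z" if k: "k < ?p" for k
    proof -
      have "cobnd J' (Suc (Suc j)) (\<lambda>i. f (z i)) k = cobnd J' (Suc (Suc j)) z' k"
        using z by (intro lin_cong) auto
      then show ?thesis using f_lin[of ?n "\<lambda>i. a (Suc (Suc j)) i k" z] z k dz' Z by auto
    qed
    then obtain w where w: "\<And>i. i < ?n \<Longrightarrow> w i \<in> Z"
      and zw: "\<And>l. l < ?p \<Longrightarrow> cobnd J (Suc (Suc j)) z l = cobnd J (Suc (Suc j)) w l"
      using ext_zeroE[OF X, of "\<lambda>k. cobnd J (Suc (Suc j)) z k"]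
        cobnd_cobnd[OF J_module, of _ "Suc (Suc j)" z] z by auto
    have wJ: "w i \<in> carrier J" "f (w i) = \<zero>\<^bsub>J'\<^esub>" if "i < ?n" for i using w[OF that] Z by auto
    have "cobnd J (Suc (Suc j)) (\<lambda>i. z i \<ominus>\<^bsub>J\<^esub> w i) k = \<zero>\<^bsub>J\<^esub>" if k: "k < ?p" for k
      using k z wJ zw[OF k] J.add_minus_cancel(4) by (subst J.lin_minus_right) auto
    moreover have "f (z i \<ominus>\<^bsub>J\<^esub> w i) = z' i" if "i < ?n" for i
      using f_minus[of "z i" "w i"] z wJ that f_closed[of "z i"] by (auto simp: a_minus_def)
    ultimately show "\<exists>z. (\<forall>i<?n. z i \<in> carrier J \<and> z' i = f (z i)) \<and>
        (\<forall>k<?p. cobnd J (Suc (Suc j)) z k = \<zero>\<^bsub>J\<^esub>)"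
      using z wJ by (intro exI[of _ "\<lambda>i. z i \<ominus>\<^bsub>J\<^esub> w i"]) auto
  qed
next
  let ?n = "r (Suc (Suc j))" and ?p = "r (Suc (Suc (Suc j)))" and ?q = "r (Suc (Suc (Suc (Suc j))))"
  assume lifts: "cocycles_lift (Suc j)"
  show "ext_zero J Z (Suc (Suc j))"
  proof (rule ext_zeroI)
    fix z assume z: "\<And>i. i < ?p \<Longrightarrow> z i \<in> Z"
      and dz: "\<And>k. k < ?q \<Longrightarrow> cobnd J (Suc (Suc (Suc j))) z k = \<zero>\<^bsub>J\<^esub>"
    obtain w where w: "\<And>i. i < ?n \<Longrightarrow> w i \<in> carrier J"
      and zw: "\<And>l. l < ?p \<Longrightarrow> z l = cobnd J (Suc (Suc j)) w l"
      by (rule ext_zeroE[OF ext_zero_injective[OF J, of "Suc (Suc j)"], of z]) (use z dz Z in auto)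
    have "cobnd J' (Suc (Suc j)) (\<lambda>i. f (w i)) k = \<zero>\<^bsub>J'\<^esub>" if "k < ?p" for k
      using f_lin[of ?n "\<lambda>i. a (Suc (Suc j)) i k" w] that w zw[OF that] z[OF that] Z by auto
    then obtain u where u: "\<forall>i<?n. u i \<in> carrier J \<and> f (w i) = f (u i)"
      "\<forall>k<?p. cobnd J (Suc (Suc j)) u k = \<zero>\<^bsub>J\<^esub>"
      using lifts[unfolded cocycles_lift_def, rule_format, of "\<lambda>i. f (w i)"] w Z' by blast
    have "w i \<ominus>\<^bsub>J\<^esub> u i \<in> Z" if i: "i < ?n" for i
      using f_minus[of "w i" "u i"] u(1) w i f_closed J'.add_minus_cancel(4) Z by auto
    moreover have "z l = cobnd J (Suc (Suc j)) (\<lambda>i. w i \<ominus>\<^bsub>J\<^esub> u i) l" if l: "l < ?p" for l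
      using l w u zw[OF l] by (subst J.lin_minus_right) (auto simp: a_minus_def)
    ultimately show "\<exists>w. (\<forall>i<?n. w i \<in> Z) \<and> (\<forall>l<?p. z l = cobnd J (Suc (Suc j)) w l)"
      by (intro exI[of _ "\<lambda>i. w i \<ominus>\<^bsub>J\<^esub> u i"]) auto
  qed
qed

text \<open>In positive degrees every cocycle of \<open>J\<close> is a coboundary, so lifting a
  cocycle of \<open>Z'\<close> to a cocycle of \<open>J\<close> amounts to its being a coboundary in
  \<open>Z'\<close>.\<close>

lemma cocycles_lift_iff_ext_zero: "cocycles_lift (Suc (Suc j)) \<longleftrightarrow> ext_zero J' Z' (Suc (Suc j))"
proof
  let ?n = "r (Suc (Suc j))" and ?p = "r (Suc (Suc (Suc j)))" and ?q = "r (Suc (Suc (Suc (Suc j))))"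
  assume lifts: "cocycles_lift (Suc (Suc j))"
  show "ext_zero J' Z' (Suc (Suc j))"
  proof (rule ext_zeroI)
    fix z' assume "\<And>i. i < ?p \<Longrightarrow> z' i \<in> Z'"
      "\<And>k. k < ?q \<Longrightarrow> cobnd J' (Suc (Suc (Suc j))) z' k = \<zero>\<^bsub>J'\<^esub>"
    then obtain z where z: "\<forall>i<?p. z i \<in> carrier J \<and> z' i = f (z i)"
      "\<forall>k<?q. cobnd J (Suc (Suc (Suc j))) z k = \<zero>\<^bsub>J\<^esub>"
      using lifts[unfolded cocycles_lift_def, rule_format, of z'] by blast
    then obtain u where u: "\<And>i. i < ?n \<Longrightarrow> u i \<in> carrier J"
      "\<And>l. l < ?p \<Longrightarrow> z l = cobnd J (Suc (Suc j)) u l"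
      using ext_zeroE[OF ext_zero_injective[OF J, of "Suc (Suc j)"], of z] by auto
    then have "z' l = cobnd J' (Suc (Suc j)) (\<lambda>i. f (u i)) l" if "l < ?p" for l
      using z(1) f_lin[of ?n "\<lambda>i. a (Suc (Suc j)) i l" u] that by auto
    then show "\<exists>w. (\<forall>i<?n. w i \<in> Z') \<and> (\<forall>l<?p. z' l = cobnd J' (Suc (Suc j)) w l)"
      using u Z' by (intro exI[of _ "\<lambda>i. f (u i)"]) auto
  qed
next
  let ?n = "r (Suc (Suc j))" and ?p = "r (Suc (Suc (Suc j)))" and ?q = "r (Suc (Suc (Suc (Suc j))))"
  assume X: "ext_zero J' Z' (Suc (Suc j))"
  show "cocycles_lift (Suc (Suc j))"
    unfolding cocycles_lift_def
  proof (intro allI impI)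
    fix z' assume "\<forall>i<?p. z' i \<in> Z'" "\<forall>k<?q. cobnd J' (Suc (Suc (Suc j))) z' k = \<zero>\<^bsub>J'\<^esub>"
    then obtain u' where u': "\<And>i. i < ?n \<Longrightarrow> u' i \<in> Z'"
      "\<And>l. l < ?p \<Longrightarrow> z' l = cobnd J' (Suc (Suc j)) u' l"
      using ext_zeroE[OF X, of z'] by auto
    obtain u where u: "\<And>i. i < ?n \<Longrightarrow> u i \<in> carrier J" "\<And>i. i < ?n \<Longrightarrow> u' i = f (u i)"
      using lift[of ?n u'] u' by blast
    have "z' l = f (cobnd J (Suc (Suc j)) u l)" if l: "l < ?p" for l
    proof -
      have "cobnd J' (Suc (Suc j)) u' l = cobnd J' (Suc (Suc j)) (\<lambda>i. f (u i)) l"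
        using u by (intro lin_cong) auto
      then show ?thesis using u'(2)[OF l] f_lin[of ?n "\<lambda>i. a (Suc (Suc j)) i l" u] u l by auto
    qed
    then show "\<exists>z. (\<forall>i<?p. z i \<in> carrier J \<and> z' i = f (z i)) \<and>
        (\<forall>k<?q. cobnd J (Suc (Suc (Suc j))) z k = \<zero>\<^bsub>J\<^esub>)"
      using u cobnd_cobnd[OF J_module, of _ "Suc (Suc j)" u]
      by (intro exI[of _ "\<lambda>l. cobnd J (Suc (Suc j)) u l"]) auto
  qed
qed

lemma cocycles_lift_1:
  "cocycles_lift (Suc 0) \<longleftrightarrow> (\<forall>z'\<in>Z'. (\<forall>s\<in>b. s \<odot>\<^bsub>J'\<^esub> z' = \<zero>\<^bsub>J'\<^esub>) \<longrightarrow>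
    (\<exists>z\<in>carrier J. (\<forall>s\<in>b. s \<odot>\<^bsub>J\<^esub> z = \<zero>\<^bsub>J\<^esub>) \<and> f z = z'))" (is "_ \<longleftrightarrow> ?Y")
proof
  assume lifts: "cocycles_lift (Suc 0)"
  show ?Y
  proof (intro ballI impI)
    fix z' assume z': "z' \<in> Z'" and kill: "\<forall>s\<in>b. s \<odot>\<^bsub>J'\<^esub> z' = \<zero>\<^bsub>J'\<^esub>"
    then have "z' \<in> carrier J'" using Z' f_closed by auto
    then obtain z where "z 0 \<in> carrier J" "z' = f (z 0)"
      "\<forall>k<r (Suc (Suc (Suc 0))). a (Suc (Suc 0)) 0 k \<odot>\<^bsub>J\<^esub> z 0 = \<zero>\<^bsub>J\<^esub>"
      using lifts[unfolded cocycles_lift_def, rule_format, of "\<lambda>_. z'"] z' kill killed_iff[OF J', of z'] rank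
      by auto
    then show "\<exists>z\<in>carrier J. (\<forall>s\<in>b. s \<odot>\<^bsub>J\<^esub> z = \<zero>\<^bsub>J\<^esub>) \<and> f z = z'"
      using killed_iff[OF J_module, of "z 0"] by blast
  qed
next
  assume Y: ?Y
  show "cocycles_lift (Suc 0)"
    unfolding cocycles_lift_def
  proof (intro allI impI)
    fix z' assume z': "\<forall>i<r (Suc (Suc 0)). z' i \<in> Z'"
      and dz': "\<forall>k<r (Suc (Suc (Suc 0))). cobnd J' (Suc (Suc 0)) z' k = \<zero>\<^bsub>J'\<^esub>"
    have z0: "z' 0 \<in> Z'" "z' 0 \<in> carrier J'" using z' rank Z' f_closed by auto
    then have "\<forall>s\<in>b. s \<odot>\<^bsub>J'\<^esub> z' 0 = \<zero>\<^bsub>J'\<^esub>" using dz' killed_iff[OF J', of "z' 0"] rank by simp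
    then obtain z where "z \<in> carrier J" "\<forall>s\<in>b. s \<odot>\<^bsub>J\<^esub> z = \<zero>\<^bsub>J\<^esub>" "f z = z' 0" using Y z0 by blast
    then show "\<exists>z. (\<forall>i<r (Suc (Suc 0)). z i \<in> carrier J \<and> z' i = f (z i)) \<and>
        (\<forall>k<r (Suc (Suc (Suc 0))). cobnd J (Suc (Suc 0)) z k = \<zero>\<^bsub>J\<^esub>)"
      using rank killed_iff[OF J_module, of z] by (intro exI[of _ "\<lambda>_. z"]) auto
  qed
qed

end

text \<open>In degree zero the only coboundary is the empty sum, because \<open>r 1 = 0\<close>, so
  every cocycle has to be zero.\<close>

lemma ext_zero_1:
  assumes M: "module R M" and A: "A \<subseteq> carrier M"
  shows "ext_zero M A (Suc 0) \<longleftrightarrow> (\<forall>z\<in>A. (\<forall>s\<in>b. s \<odot>\<^bsub>M\<^esub> z = \<zero>\<^bsub>M\<^esub>) \<longrightarrow> z = \<zero>\<^bsub>M\<^esub>)"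
proof -
  interpret M: module R M by fact
  let ?n = "r (Suc (Suc (Suc 0)))" and ?a = "a (Suc (Suc 0)) 0"
  have k: "(\<forall>s\<in>b. s \<odot>\<^bsub>M\<^esub> z = \<zero>\<^bsub>M\<^esub>) \<longleftrightarrow> (\<forall>k<?n. ?a k \<odot>\<^bsub>M\<^esub> z = \<zero>\<^bsub>M\<^esub>)" if "z \<in> A" for z
    using killed_iff[OF M] that A by blast
  show ?thesis
  proof
    assume X: "ext_zero M A (Suc 0)"
    show "\<forall>z\<in>A. (\<forall>s\<in>b. s \<odot>\<^bsub>M\<^esub> z = \<zero>\<^bsub>M\<^esub>) \<longrightarrow> z = \<zero>\<^bsub>M\<^esub>"
    proof (intro ballI impI)
      fix z assume z: "z \<in> A" "\<forall>s\<in>b. s \<odot>\<^bsub>M\<^esub> z = \<zero>\<^bsub>M\<^esub>"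
      then show "z = \<zero>\<^bsub>M\<^esub>" using ext_zeroE[OF X, of "\<lambda>_. z"] k[OF z(1)] rank by auto
    qed
  next
    assume Y: "\<forall>z\<in>A. (\<forall>s\<in>b. s \<odot>\<^bsub>M\<^esub> z = \<zero>\<^bsub>M\<^esub>) \<longrightarrow> z = \<zero>\<^bsub>M\<^esub>"
    show "ext_zero M A (Suc 0)"
    proof (rule ext_zeroI)
      fix z assume z: "\<And>i. i < r (Suc (Suc 0)) \<Longrightarrow> z i \<in> A"
        "\<And>k. k < ?n \<Longrightarrow> cobnd M (Suc (Suc 0)) z k = \<zero>\<^bsub>M\<^esub>"
      then have z0: "z 0 \<in> A" "z 0 \<in> carrier M" using rank A by auto
      moreover have "?a k \<odot>\<^bsub>M\<^esub> z 0 = \<zero>\<^bsub>M\<^esub>" if "k < ?n" for k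
        using z(2)[OF that] z0 rank that by simp
      ultimately have "z 0 = \<zero>\<^bsub>M\<^esub>" using Y k by blast
      then show "\<exists>w. (\<forall>i<r (Suc 0). w i \<in> A) \<and>
          (\<forall>l<r (Suc (Suc 0)). z l = cobnd M (Suc 0) w l)"
        using rank by auto
    qed
  qed
qed

lemma ext_zero_iso:
  assumes K: "module R K" and M: "module R M" and f: "f \<in> module_homs R K M"
    and inj: "inj_on f (carrier K)"
  shows "ext_zero K (carrier K) j \<longleftrightarrow> ext_zero M (f ` carrier K) j"
proof -
  interpret K: module R K by fact
  interpret M: module R M by fact
  let ?n = "r (Suc j)" and ?p = "r (Suc (Suc j))"
  have f_lin: "f (lin K n v z) = lin M n v (\<lambda>l. f (z l))"
    if "\<And>l. l < n \<Longrightarrow> v l \<in> carrier R" "\<And>l. l < n \<Longrightarrow> z l \<in> carrier K" for n v z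
    using module_homs_lin[OF K M f, of n v z] that by blast
  have f_eq: "x = y" if "f x = f y" "x \<in> carrier K" "y \<in> carrier K" for x y
    using inj that by (auto dest: inj_onD)
  have f0: "f \<zero>\<^bsub>K\<^esub> = \<zero>\<^bsub>M\<^esub>" by (rule module_homs_zero[OF K M f])
  have lift: "\<exists>z. \<forall>i<n. z i \<in> carrier K \<and> z' i = f (z i)" if "\<And>i. i < n \<Longrightarrow> z' i \<in> f ` carrier K"
    for z' and n :: nat
    using that by (intro choice allI) blast
  show ?thesis
  proof
    assume X: "ext_zero K (carrier K) j"
    show "ext_zero M (f ` carrier K) j"
    proof (rule ext_zeroI)
      fix z' assume z': "\<And>i. i < ?n \<Longrightarrow> z' i \<in> f ` carrier K"
        and dz': "\<And>k. k < ?p \<Longrightarrow> cobnd M (Suc j) z' k = \<zero>\<^bsub>M\<^esub>"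
      obtain z where z: "\<And>i. i < ?n \<Longrightarrow> z i \<in> carrier K" "\<And>i. i < ?n \<Longrightarrow> z' i = f (z i)"
        using lift[of ?n z'] z' by blast
      have "cobnd K (Suc j) z k = \<zero>\<^bsub>K\<^esub>" if k: "k < ?p" for k
      proof (rule f_eq)
        have "cobnd M (Suc j) (\<lambda>i. f (z i)) k = cobnd M (Suc j) z' k"
          using z by (intro lin_cong) auto
        then show "f (cobnd K (Suc j) z k) = f \<zero>\<^bsub>K\<^esub>"
          using f_lin[of ?n "\<lambda>i. a (Suc j) i k" z] z k dz'[OF k] f0 by simp
      qed (use z k in auto)
      then obtain w where w: "\<And>i. i < r j \<Longrightarrow> w i \<in> carrier K"
        "\<And>l. l < ?n \<Longrightarrow> z l = cobnd K j w l"
        using ext_zeroE[OF X, of z] z by blast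
      then have "z' l = cobnd M j (\<lambda>i. f (w i)) l" if "l < ?n" for l
        using z(2)[OF that] f_lin[of "r j" "\<lambda>i. a j i l" w] that by auto
      then show "\<exists>w. (\<forall>i<r j. w i \<in> f ` carrier K) \<and> (\<forall>l<?n. z' l = cobnd M j w l)"
        using w by (intro exI[of _ "\<lambda>i. f (w i)"]) auto
    qed
  next
    assume X: "ext_zero M (f ` carrier K) j"
    show "ext_zero K (carrier K) j"
    proof (rule ext_zeroI)
      fix z assume z: "\<And>i. i < ?n \<Longrightarrow> z i \<in> carrier K"
        and dz: "\<And>k. k < ?p \<Longrightarrow> cobnd K (Suc j) z k = \<zero>\<^bsub>K\<^esub>"
      have "cobnd M (Suc j) (\<lambda>i. f (z i)) k = \<zero>\<^bsub>M\<^esub>" if k: "k < ?p" for k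
        using f_lin[of ?n "\<lambda>i. a (Suc j) i k" z] z k dz[OF k] f0 by simp
      then obtain w' where w': "\<And>i. i < r j \<Longrightarrow> w' i \<in> f ` carrier K"
        "\<And>l. l < ?n \<Longrightarrow> f (z l) = cobnd M j w' l"
        using ext_zeroE[OF X, of "\<lambda>i. f (z i)"] z by auto
      obtain w where w: "\<And>i. i < r j \<Longrightarrow> w i \<in> carrier K" "\<And>i. i < r j \<Longrightarrow> w' i = f (w i)"
        using lift[of "r j" w'] w' by blast
      have "z l = cobnd K j w l" if l: "l < ?n" for l
      proof (rule f_eq)
        have "cobnd M j w' l = cobnd M j (\<lambda>i. f (w i)) l"
          using w by (intro lin_cong) auto
        then show "f (z l) = f (cobnd K j w l)"
          using w'(2)[OF l] f_lin[of "r j" "\<lambda>i. a j i l" w] w l by auto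
      qed (use z w l in auto)
      then show "\<exists>w. (\<forall>i<r j. w i \<in> carrier K) \<and> (\<forall>l<?n. z l = cobnd K j w l)"
        using w by blast
    qed
  qed
qed

section \<open>Ext computed from an injective resolution\<close>

context
  fixes K :: "('a, 'm, 'y) module_scheme" and J :: "nat \<Rightarrow> ('a, 'n, 'z) module_scheme" and \<delta> \<theta>
  assumes res: "injective_resolution R K J \<delta> \<theta>"
begin

private lemma K_module: "module R K" and res_injective: "injective_module R (J n)"
  and \<delta>_hom: "\<delta> n \<in> module_homs R (J n) (J (Suc n))" and \<theta>_hom: "\<theta> \<in> module_homs R K (J 0)"
  and \<theta>_inj: "inj_on \<theta> (carrier K)"
  and \<theta>_image: "\<theta> ` carrier K = {z \<in> carrier (J 0). \<delta> 0 z = \<zero>\<^bsub>J (Suc 0)\<^esub>}"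
  and \<delta>_image: "\<delta> n ` carrier (J n) = {z \<in> carrier (J (Suc n)). \<delta> (Suc n) z = \<zero>\<^bsub>J (Suc (Suc n))\<^esub>}"
  using res by (auto simp: injective_resolution_def a_kernel_def')

private lemma res_module: "module R (J n)"
  using res_injective by (simp add: injective_module_def)

lemma ext_zero_resolution_0:
  "ext_zero K (carrier K) (Suc 0) \<longleftrightarrow>
    (\<forall>z\<in>carrier (J 0). \<delta> 0 z = \<zero>\<^bsub>J (Suc 0)\<^esub> \<longrightarrow> (\<forall>s\<in>b. s \<odot>\<^bsub>J 0\<^esub> z = \<zero>\<^bsub>J 0\<^esub>) \<longrightarrow> z = \<zero>\<^bsub>J 0\<^esub>)"
proof -
  have "ext_zero K (carrier K) (Suc 0) \<longleftrightarrow>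
      ext_zero (J 0) {z \<in> carrier (J 0). \<delta> 0 z = \<zero>\<^bsub>J (Suc 0)\<^esub>} (Suc 0)"
    using ext_zero_iso[OF K_module res_module \<theta>_hom \<theta>_inj] \<theta>_image by simp
  also have "\<dots> \<longleftrightarrow> (\<forall>z\<in>{z \<in> carrier (J 0). \<delta> 0 z = \<zero>\<^bsub>J (Suc 0)\<^esub>}.
      (\<forall>s\<in>b. s \<odot>\<^bsub>J 0\<^esub> z = \<zero>\<^bsub>J 0\<^esub>) \<longrightarrow> z = \<zero>\<^bsub>J 0\<^esub>)"
    by (rule ext_zero_1[OF res_module]) auto
  finally show ?thesis by auto
qed

text \<open>Dimension shifting replaces \<open>Ext^(q+1)\<close> of \<open>K\<close> by
  \<open>Ext^1\<close> of the cocycles in \<open>J q\<close>. The latter vanishes iff elements of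
  \<open>Z (Suc q)\<close> killed by \<open>b\<close> lift to elements of \<open>J q\<close> killed
  by \<open>b\<close>, which is exactness of \<open>J[b]\<close> in degree
  \<open>q + 1\<close>.\<close>

lemma ext_zero_resolution_Suc:
  "ext_zero K (carrier K) (Suc (Suc q)) \<longleftrightarrow>
    (\<forall>z\<in>carrier (J (Suc q)). \<delta> (Suc q) z = \<zero>\<^bsub>J (Suc (Suc q))\<^esub> \<longrightarrow>
      (\<forall>s\<in>b. s \<odot>\<^bsub>J (Suc q)\<^esub> z = \<zero>\<^bsub>J (Suc q)\<^esub>) \<longrightarrow>
      (\<exists>w\<in>carrier (J q). (\<forall>s\<in>b. s \<odot>\<^bsub>J q\<^esub> w = \<zero>\<^bsub>J q\<^esub>) \<and> \<delta> q w = z))"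
proof -
  define Z where "Z n = {z \<in> carrier (J n). \<delta> n z = \<zero>\<^bsub>J (Suc n)\<^esub>}" for n
  have im: "Z (Suc n) = \<delta> n ` carrier (J n)" for n by (simp add: Z_def \<delta>_image)
  have shift: "ext_zero (J n) (Z n) (Suc (Suc (Suc j))) \<longleftrightarrow> ext_zero (J (Suc n)) (Z (Suc n)) (Suc (Suc j))" for n j
    using ext_zero_iff_cocycles_lift[OF res_injective res_module \<delta>_hom Z_def im]
      cocycles_lift_iff_ext_zero[OF res_injective res_module \<delta>_hom Z_def im] by simp
  \<comment> \<open>Each shift trades one degree of Ext for one step along the resolution, so
    \<open>n\<close> has to vary in the induction.\<close>
  have "ext_zero (J n) (Z n) (Suc (Suc q)) \<longleftrightarrow> ext_zero (J (n + q)) (Z (n + q)) (Suc (Suc 0))" for n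
  proof (induction q arbitrary: n)
    case (Suc q)
    then show ?case using shift[of n q] Suc[of "Suc n"] by simp
  qed simp
  from this[of 0] have "ext_zero K (carrier K) (Suc (Suc q)) \<longleftrightarrow> ext_zero (J q) (Z q) (Suc (Suc 0))"
    using ext_zero_iso[OF K_module res_module \<theta>_hom \<theta>_inj] \<theta>_image by (simp add: Z_def)
  also have "\<dots> \<longleftrightarrow> (\<forall>z\<in>Z (Suc q). (\<forall>s\<in>b. s \<odot>\<^bsub>J (Suc q)\<^esub> z = \<zero>\<^bsub>J (Suc q)\<^esub>) \<longrightarrow>
      (\<exists>w\<in>carrier (J q). (\<forall>s\<in>b. s \<odot>\<^bsub>J q\<^esub> w = \<zero>\<^bsub>J q\<^esub>) \<and> \<delta> q w = z))"
    using ext_zero_iff_cocycles_lift[OF res_injective res_module \<delta>_hom Z_def im]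
      cocycles_lift_1[OF res_injective res_module \<delta>_hom Z_def im] by simp
  finally show ?thesis by (auto simp: Z_def)
qed

end

end

section \<open>Quotients and extension of maps into injective modules\<close>

lemma quotient_projection:
  fixes R :: "('r, 'x) ring_scheme" and M :: "('r, 'm, 'y) module_scheme"
  assumes M: "module R M" and N: "submodule N R M"
  shows "(\<lambda>x. N +>\<^bsub>M\<^esub> x) \<in> module_homs R M (quotient_module M N)"
    and "carrier (quotient_module M N) = (\<lambda>x. N +>\<^bsub>M\<^esub> x) ` carrier M"
    and "x \<in> carrier M \<Longrightarrow> N +>\<^bsub>M\<^esub> x = \<zero>\<^bsub>quotient_module M N\<^esub> \<longleftrightarrow> x \<in> N"
proof -
  interpret M: module R M by fact
  interpret N: submodule N R M by fact
  have "additive_subgroup N M"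
    by (rule additive_subgroup.intro) (rule N.subgroup_axioms)
  then interpret S: abelian_subgroup N M
    by (rule abelian_subgroupI3) (rule M.M.abelian_group_axioms)
  show carr: "carrier (quotient_module M N) = (\<lambda>x. N +>\<^bsub>M\<^esub> x) ` carrier M"
    by (auto simp: quotient_module_def A_RCOSETS_def')
  show "N +>\<^bsub>M\<^esub> x = \<zero>\<^bsub>quotient_module M N\<^esub> \<longleftrightarrow> x \<in> N" if "x \<in> carrier M" for x
    using M.M.a_coset_join1[of N x] M.M.a_coset_join2[of x N] that N.subgroup_axioms
    by (auto simp: quotient_module_def)
  have eq: "N +>\<^bsub>M\<^esub> (s \<odot>\<^bsub>M\<^esub> z) = N +>\<^bsub>M\<^esub> (s \<odot>\<^bsub>M\<^esub> x)"
    if s: "s \<in> carrier R" and x: "x \<in> carrier M" and z: "z \<in> N +>\<^bsub>M\<^esub> x" for s x z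
  proof -
    obtain n where n: "n \<in> N" "z = n \<oplus>\<^bsub>M\<^esub> x" using z by (auto simp: a_r_coset_def')
    then have "s \<odot>\<^bsub>M\<^esub> z = s \<odot>\<^bsub>M\<^esub> n \<oplus>\<^bsub>M\<^esub> s \<odot>\<^bsub>M\<^esub> x"
      using s x M.submoduleD(1)[OF N] by (simp add: M.smult_r_distr)
    then have "s \<odot>\<^bsub>M\<^esub> z \<in> N +>\<^bsub>M\<^esub> (s \<odot>\<^bsub>M\<^esub> x)"
      using M.submoduleD(6)[OF N s n(1)] by (auto simp: a_r_coset_def')
    then show ?thesis
      using S.a_repr_independence' s x M.smult_closed S.a_subgroup by metis
  qed
  have "s \<odot>\<^bsub>quotient_module M N\<^esub> (N +>\<^bsub>M\<^esub> x) = N +>\<^bsub>M\<^esub> (s \<odot>\<^bsub>M\<^esub> x)"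
    if "s \<in> carrier R" "x \<in> carrier M" for s x
  proof -
    have "(\<Union>z\<in>N +>\<^bsub>M\<^esub> x. N +>\<^bsub>M\<^esub> (s \<odot>\<^bsub>M\<^esub> z)) = N +>\<^bsub>M\<^esub> (s \<odot>\<^bsub>M\<^esub> x)"
      using eq[OF that] S.a_rcos_self[OF that(2)] by blast
    then show ?thesis by (simp add: quotient_module_def)
  qed
  moreover have "N +>\<^bsub>M\<^esub> (x \<oplus>\<^bsub>M\<^esub> y) = (N +>\<^bsub>M\<^esub> x) \<oplus>\<^bsub>quotient_module M N\<^esub> (N +>\<^bsub>M\<^esub> y)"
    if "x \<in> carrier M" "y \<in> carrier M" for x y
    using S.a_rcos_sum[OF that] by (simp add: quotient_module_def)
  ultimately show "(\<lambda>x. N +>\<^bsub>M\<^esub> x) \<in> module_homs R M (quotient_module M N)"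
    using carr unfolding module_homs_def by simp
qed

text \<open>The condition on \<open>\<rho>\<close> makes \<open>s u \<mapsto> \<rho> s\<close> well
  defined on the cyclic submodule of \<open>M/S\<close> generated by the class of \<open>u\<close>;
  injectivity extends it to \<open>M/S\<close>.\<close>

lemma injective_extend_cyclic:
  fixes R :: "('r, 'x) ring_scheme"
  assumes E: "injective_module R E" and M: "module R M" and S: "submodule S R M" and u: "u \<in> carrier M"
    and \<rho>: "\<rho> \<in> module_homs R (regular_module R) E"
    and \<rho>S: "\<And>s. s \<in> carrier R \<Longrightarrow> s \<odot>\<^bsub>M\<^esub> u \<in> S \<Longrightarrow> \<rho> s = \<zero>\<^bsub>E\<^esub>"
  obtains \<phi> where "\<phi> \<in> module_homs R M E" "\<And>x. x \<in> S \<Longrightarrow> \<phi> x = \<zero>\<^bsub>E\<^esub>"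
    "\<And>s. s \<in> carrier R \<Longrightarrow> \<phi> (s \<odot>\<^bsub>M\<^esub> u) = \<rho> s"
proof -
  interpret M: module R M by fact
  note Q = quotient_module_is_module[OF M S] and proj = quotient_projection[OF M S]
  have f: "(\<lambda>s. S +>\<^bsub>M\<^esub> (s \<odot>\<^bsub>M\<^esub> u)) \<in> module_homs R (regular_module R) (quotient_module M S)"
    by (rule module_homs_comp[OF M.orbit_hom[OF u] proj(1)])
  have ker: "\<rho> s = \<zero>\<^bsub>E\<^esub>" if "s \<in> carrier (regular_module R)"
    "S +>\<^bsub>M\<^esub> (s \<odot>\<^bsub>M\<^esub> u) = \<zero>\<^bsub>quotient_module M S\<^esub>" for s
    using that proj(3)[of "s \<odot>\<^bsub>M\<^esub> u"] \<rho>S u by simp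
  obtain h where h: "h \<in> module_homs R (quotient_module M S) E"
    and h\<rho>: "\<And>s. s \<in> carrier (regular_module R) \<Longrightarrow> h (S +>\<^bsub>M\<^esub> (s \<odot>\<^bsub>M\<^esub> u)) = \<rho> s"
    using injective_factor[OF E M.regular Q f \<rho> ker] by blast
  show thesis
  proof (rule that[of "\<lambda>x. h (S +>\<^bsub>M\<^esub> x)"])
    show "(\<lambda>x. h (S +>\<^bsub>M\<^esub> x)) \<in> module_homs R M E" by (rule module_homs_comp[OF proj(1) h])
    have modE: "module R E" using E by (simp add: injective_module_def)
    show "h (S +>\<^bsub>M\<^esub> x) = \<zero>\<^bsub>E\<^esub>" if "x \<in> S" for x
      using proj(3)[of x] that M.submoduleD(1)[OF S that] module_homs_zero[OF Q modE h] by simp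
  qed (use h\<rho> in simp)
qed

text \<open>The hypothesis on \<open>v\<close> says precisely that \<open>x \<mapsto> v\<close>
  defines a map into \<open>J\<close> on the submodule of \<open>R/L\<close> generated by
  \<open>x\<close>. After extension to \<open>R/L\<close>, the image of \<open>\<one>\<close> is the
  solution.\<close>

lemma injective_solve:
  assumes J: "injective_module R J" and L: "ideal L R" and x: "x \<in> carrier R" and v: "v \<in> carrier J"
    and kill: "\<And>s. s \<in> carrier R \<Longrightarrow> s \<otimes>\<^bsub>R\<^esub> x \<in> L \<Longrightarrow> s \<odot>\<^bsub>J\<^esub> v = \<zero>\<^bsub>J\<^esub>"
  obtains v' where "v' \<in> carrier J" "x \<odot>\<^bsub>J\<^esub> v' = v" "\<And>t. t \<in> L \<Longrightarrow> t \<odot>\<^bsub>J\<^esub> v' = \<zero>\<^bsub>J\<^esub>"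
proof -
  interpret J: module R J using J by (simp add: injective_module_def)
  interpret RR: module R "regular_module R" by (rule J.regular)
  have Lsub: "submodule L R (regular_module R)"
    by (rule RR.submoduleI) (auto intro: J.R.idealD[OF L])
  obtain \<phi> where \<phi>: "\<phi> \<in> module_homs R (regular_module R) J" "\<And>t. t \<in> L \<Longrightarrow> \<phi> t = \<zero>\<^bsub>J\<^esub>"
    and \<phi>x: "\<And>s. s \<in> carrier R \<Longrightarrow> \<phi> (s \<odot>\<^bsub>regular_module R\<^esub> x) = s \<odot>\<^bsub>J\<^esub> v"
    by (rule injective_extend_cyclic[OF J RR.module_axioms Lsub _ J.orbit_hom[OF v], of x])
      (use x kill in auto)
  have \<phi>1: "t \<odot>\<^bsub>J\<^esub> \<phi> \<one>\<^bsub>R\<^esub> = \<phi> t" if "t \<in> carrier R" for t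
    using module_homsD(3)[OF \<phi>(1), of t "\<one>\<^bsub>R\<^esub>"] that by simp
  show thesis
  proof (rule that[of "\<phi> \<one>\<^bsub>R\<^esub>"])
    show "\<phi> \<one>\<^bsub>R\<^esub> \<in> carrier J" using module_homsD(1)[OF \<phi>(1), of "\<one>\<^bsub>R\<^esub>"] by simp
    show "x \<odot>\<^bsub>J\<^esub> \<phi> \<one>\<^bsub>R\<^esub> = v" using \<phi>1[OF x] \<phi>x[of "\<one>\<^bsub>R\<^esub>"] x v by simp
    show "t \<odot>\<^bsub>J\<^esub> \<phi> \<one>\<^bsub>R\<^esub> = \<zero>\<^bsub>J\<^esub>" if "t \<in> L" for t
      using \<phi>1[of t] \<phi>(2)[OF that] J.R.idealD(1)[OF L that] by simp
  qed
qed

lemma (in module) annihilator_ideal: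
  assumes "m \<in> carrier M"
  shows "ideal {s \<in> carrier R. s \<odot>\<^bsub>M\<^esub> m = \<zero>\<^bsub>M\<^esub>} R"
  using assms by (intro R.ideal_if_closed) (auto simp: smult_l_distr smult_assoc1)

text \<open>The annihilators \<open>c k\<close> of \<open>y^k m\<close> ascend, so
  \<open>c (k+1) = c k\<close> for some \<open>k\<close>, and then \<open>y^(k+1) m' = y^k m\<close>
  is solvable. Solving modulo the annihilator of \<open>m\<close> gives the last clause, which keeps
  \<open>m'\<close> inside every torsion submodule that contains \<open>m\<close>.\<close>

lemma (in noetherian_cring) injective_divide:
  assumes J: "injective_module R J" and m: "m \<in> carrier J" and y: "y \<in> carrier R"
  obtains m' k where "m' \<in> carrier J" "(y [^] (k::nat)) \<odot>\<^bsub>J\<^esub> (m \<ominus>\<^bsub>J\<^esub> y \<odot>\<^bsub>J\<^esub> m') = \<zero>\<^bsub>J\<^esub>"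
    "\<And>s. s \<in> carrier R \<Longrightarrow> s \<odot>\<^bsub>J\<^esub> m = \<zero>\<^bsub>J\<^esub> \<Longrightarrow> s \<odot>\<^bsub>J\<^esub> m' = \<zero>\<^bsub>J\<^esub>"
proof -
  interpret J: module R J using J by (simp add: injective_module_def)
  define c where "c k = {s \<in> carrier R. s \<odot>\<^bsub>J\<^esub> (y [^] (k::nat) \<odot>\<^bsub>J\<^esub> m) = \<zero>\<^bsub>J\<^esub>}" for k
  have cid: "ideal (c k) R" for k
    unfolding c_def using y m by (intro J.annihilator_ideal) simp
  obtain L where L: "L \<in> range c" "\<And>L'. L' \<in> range c \<Longrightarrow> L \<subseteq> L' \<Longrightarrow> L' = L"
    using exists_maximal_ideal_in[of "range c"] cid by blast
  then obtain k where k: "L = c k" by blast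
  have "c k \<subseteq> c (Suc k)"
  proof
    fix s assume s: "s \<in> c k"
    then have "s \<in> carrier R" by (simp add: c_def)
    then have "s \<odot>\<^bsub>J\<^esub> (y [^] Suc k \<odot>\<^bsub>J\<^esub> m) = y \<odot>\<^bsub>J\<^esub> (s \<odot>\<^bsub>J\<^esub> (y [^] k \<odot>\<^bsub>J\<^esub> m))"
      using y m by (simp add: J.smult_assoc1[symmetric] m_ac)
    then show "s \<in> c (Suc k)" using s y by (simp add: c_def)
  qed
  then have ck: "c (Suc k) = c k" using L k by blast
  define A where "A = {s \<in> carrier R. s \<odot>\<^bsub>J\<^esub> m = \<zero>\<^bsub>J\<^esub>}"
  have A: "ideal A R" unfolding A_def using m by (rule J.annihilator_ideal)
  have kill: "s \<odot>\<^bsub>J\<^esub> (y [^] k \<odot>\<^bsub>J\<^esub> m) = \<zero>\<^bsub>J\<^esub>" if s: "s \<in> carrier R" "s \<otimes> y [^] Suc k \<in> A" for s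
  proof -
    have "s \<in> c (Suc k)" using s y m J.smult_assoc1[of s "y [^] Suc k" m] by (simp add: A_def c_def)
    then show ?thesis unfolding ck by (simp add: c_def)
  qed
  obtain m' where m': "m' \<in> carrier J" "y [^] Suc k \<odot>\<^bsub>J\<^esub> m' = y [^] k \<odot>\<^bsub>J\<^esub> m"
    "\<And>t. t \<in> A \<Longrightarrow> t \<odot>\<^bsub>J\<^esub> m' = \<zero>\<^bsub>J\<^esub>"
    by (rule injective_solve[OF J A, of "y [^] Suc k" "y [^] k \<odot>\<^bsub>J\<^esub> m"]) (use kill y m in auto)
  have "y [^] k \<odot>\<^bsub>J\<^esub> (m \<ominus>\<^bsub>J\<^esub> y \<odot>\<^bsub>J\<^esub> m') = \<zero>\<^bsub>J\<^esub>"
    using m' y m J.smult_minus[of "y [^] k" m "y \<odot>\<^bsub>J\<^esub> m'"] J.smult_assoc1[of "y [^] k" y m']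
      J.add_minus_cancel(4) by simp
  then show thesis using that[of m' k] m' by (simp add: A_def)
qed

text \<open>The scalars that move \<open>u\<close> into \<open>S\<close> form a proper ideal, which
  by locality lies in \<open>\<mm>\<close>. Hence the cyclic module generated by \<open>u\<close> in
  \<open>M/S\<close> maps onto the residue field and from there into \<open>E\<close>, with
  \<open>u\<close> not going to zero.\<close>

lemma local_cogenerator:
  fixes R :: "('r, 'x) ring_scheme" (structure)
  assumes loc: "noetherian_local_ring R \<mm>" and hull: "injective_hull R (residue_field R \<mm>) E \<epsilon>"
    and M: "module R M" and S: "submodule S R M" and u: "u \<in> carrier M" "u \<notin> S"
  shows "\<exists>\<phi>\<in>module_homs R M E. (\<forall>x\<in>S. \<phi> x = \<zero>\<^bsub>E\<^esub>) \<and> \<phi> u \<noteq> \<zero>\<^bsub>E\<^esub>"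
proof -
  interpret noetherian_cring R
    using loc by (simp add: noetherian_local_ring_def noetherian_cring_def)
  interpret M: module R M by fact
  have max: "maximalideal \<mm> R" and uniq: "\<And>\<nn>. maximalideal \<nn> R \<Longrightarrow> \<nn> = \<mm>"
    using loc by (auto simp: noetherian_local_ring_def)
  interpret m: maximalideal \<mm> R by fact
  have E: "injective_module R E" and \<epsilon>: "\<epsilon> \<in> module_homs R (residue_field R \<mm>) E"
    and \<epsilon>_inj: "inj_on \<epsilon> (carrier (residue_field R \<mm>))" and res: "module R (residue_field R \<mm>)"
    using hull by (auto simp: injective_hull_def)
  have modE: "module R E" using E by (simp add: injective_module_def)
  have msub: "submodule \<mm> R (regular_module R)"
    by (rule RR.submoduleI) (auto intro: idealD[OF m.is_ideal])
  note proj = quotient_projection[OF RR.module_axioms msub, folded residue_field_def]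
  define \<rho> where "\<rho> s = \<epsilon> (\<mm> +>\<^bsub>regular_module R\<^esub> s)" for s
  have \<rho>: "\<rho> \<in> module_homs R (regular_module R) E"
    using proj(1) \<epsilon> by (auto simp: module_homs_def \<rho>_def Pi_def)
  have \<rho>0: "\<rho> s = \<zero>\<^bsub>E\<^esub> \<longleftrightarrow> s \<in> \<mm>" if s: "s \<in> carrier R" for s
  proof -
    have "\<rho> s = \<zero>\<^bsub>E\<^esub> \<longleftrightarrow> \<epsilon> (\<mm> +>\<^bsub>regular_module R\<^esub> s) = \<epsilon> \<zero>\<^bsub>residue_field R \<mm>\<^esub>"
      using module_homs_zero[OF res modE \<epsilon>] by (simp add: \<rho>_def)
    also have "\<dots> \<longleftrightarrow> \<mm> +>\<^bsub>regular_module R\<^esub> s = \<zero>\<^bsub>residue_field R \<mm>\<^esub>"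
    proof (rule inj_on_eq_iff[OF \<epsilon>_inj])
      show "\<mm> +>\<^bsub>regular_module R\<^esub> s \<in> carrier (residue_field R \<mm>)" using proj(2) s by auto
      interpret Q: module R "residue_field R \<mm>" by (rule res)
      show "\<zero>\<^bsub>residue_field R \<mm>\<^esub> \<in> carrier (residue_field R \<mm>)" by simp
    qed
    also have "\<dots> \<longleftrightarrow> s \<in> \<mm>" using proj(3)[of s] s by simp
    finally show ?thesis .
  qed
  define c where "c = {s \<in> carrier R. s \<odot>\<^bsub>M\<^esub> u \<in> S}"
  have c: "ideal c R"
    unfolding c_def using u M.submoduleD[OF S]
    by (intro ideal_if_closed) (auto simp: M.smult_l_distr M.smult_assoc1)
  have c1: "\<one> \<notin> c" using u by (simp add: c_def)
  define F where "F = {L. ideal L R \<and> c \<subseteq> L \<and> \<one> \<notin> L}"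
  have "c \<in> F" using c c1 by (simp add: F_def)
  then obtain L where "L \<in> F" and Lmax: "\<And>L'. L' \<in> F \<Longrightarrow> L \<subseteq> L' \<Longrightarrow> L' = L"
    using exists_maximal_ideal_in[of F] unfolding F_def by blast
  then have L: "ideal L R" "c \<subseteq> L" "\<one> \<notin> L" by (auto simp: F_def)
  have "maximalideal L R"
  proof (rule maximalidealI)
    show "carrier R \<noteq> L" using L(3) by auto
    fix K assume K: "ideal K R" "L \<subseteq> K" "K \<subseteq> carrier R"
    show "K = L \<or> K = carrier R"
      using Lmax[OF _ K(2)] K L(2) ideal.one_imp_carrier[OF K(1)] by (auto simp: F_def)
  qed (rule L)
  then have "L = \<mm>" by (rule uniq)
  then have \<rho>c: "\<rho> s = \<zero>\<^bsub>E\<^esub>" if "s \<in> carrier R" "s \<odot>\<^bsub>M\<^esub> u \<in> S" for s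
    using \<rho>0 L(2) that by (auto simp: c_def)
  obtain \<phi> where \<phi>: "\<phi> \<in> module_homs R M E" "\<And>x. x \<in> S \<Longrightarrow> \<phi> x = \<zero>\<^bsub>E\<^esub>"
    "\<And>s. s \<in> carrier R \<Longrightarrow> \<phi> (s \<odot>\<^bsub>M\<^esub> u) = \<rho> s"
    using injective_extend_cyclic[OF E M S u(1) \<rho> \<rho>c] by blast
  have "\<one> \<notin> \<mm>" using L(3) \<open>L = \<mm>\<close> by simp
  then have "\<phi> u \<noteq> \<zero>\<^bsub>E\<^esub>" using \<phi>(3)[of \<one>] \<rho>0[of \<one>] u by simp
  then show ?thesis using \<phi> by blast
qed

section \<open>Torsion\<close>

context noetherian_cring
begin

lemma power_mem_ideal_power:
  assumes "x \<in> \<aa>" "ideal \<aa> R"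
  shows "x [^] n \<in> ideal_power \<aa> n"
proof (induction n)
  case 0
  then show ?case by (simp add: ideals_set_def)
next
  case (Suc n)
  then show ?case using assms(1) by (auto simp: ideals_set_def intro: ideal_prod.prod)
qed

lemma ideal_power_ideal: "ideal \<aa> R \<Longrightarrow> ideal (ideal_power \<aa> n) R"
  using monoid.nat_pow_closed[OF comm_monoid.axioms(1)[OF ideals_set_is_comm_monoid], of \<aa> n]
  by (simp add: ideals_set_def)

lemma ideal_power_1: "ideal \<aa> R \<Longrightarrow> ideal_power \<aa> 1 = \<aa>"
  using monoid.nat_pow_eone[OF comm_monoid.axioms(1)[OF ideals_set_is_comm_monoid], of \<aa>]
  by (simp add: ideals_set_def)

text \<open>In place of a multinomial expansion: an ideal \<open>L\<close> that contains
  \<open>c\<close> and is maximal among those containing no power of \<open>\<aa>\<close> is prime.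
  Being prime it contains every \<open>x l\<close>, hence \<open>\<aa>\<close>, a
  contradiction.\<close>

lemma ideal_power_subset:
  assumes \<aa>: "ideal \<aa> R" and c: "ideal c R" and x: "\<And>l. l < p \<Longrightarrow> x l \<in> \<aa>"
    and gen: "\<And>y. y \<in> \<aa> \<Longrightarrow> \<exists>w. (\<forall>l<p. w l \<in> carrier R) \<and> y = lin RM p w x"
    and nil: "\<And>l. l < p \<Longrightarrow> \<exists>n::nat. x l [^] n \<in> c"
  obtains n :: nat where "ideal_power \<aa> n \<subseteq> c"
proof (rule ccontr)
  assume "\<not> thesis"
  then have none: "\<forall>n::nat. \<not> ideal_power \<aa> n \<subseteq> c" using that by blast
  define F where "F = {L. ideal L R \<and> c \<subseteq> L \<and> (\<forall>n::nat. \<not> ideal_power \<aa> n \<subseteq> L)}"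
  have "c \<in> F" using none c by (simp add: F_def)
  then obtain L where "L \<in> F" and Lmax: "\<And>L'. L' \<in> F \<Longrightarrow> L \<subseteq> L' \<Longrightarrow> L' = L"
    using exists_maximal_ideal_in[of F] unfolding F_def by blast
  then have L: "ideal L R" "c \<subseteq> L" "\<And>n::nat. \<not> ideal_power \<aa> n \<subseteq> L" by (auto simp: F_def)
  note LD = idealD[OF L(1)]
  have big: "\<exists>n::nat. ideal_power \<aa> n \<subseteq> K" if K: "ideal K R" "L \<subseteq> K" "K \<noteq> L" for K
  proof (rule ccontr)
    assume "\<not> ?thesis"
    then have "K \<in> F" using K L(2) by (auto simp: F_def)
    then show False using Lmax K by blast
  qed
  have prime: "u \<in> L \<or> v \<in> L" if uv: "u \<in> carrier R" "v \<in> carrier R" "u \<otimes> v \<in> L" for u v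
  proof (rule ccontr)
    assume "\<not> (u \<in> L \<or> v \<in> L)"
    then have nL: "u \<notin> L" "v \<notin> L" by simp_all
    define A where "A = {t \<in> carrier R. t \<otimes> v \<in> L}"
    \<comment> \<open>\<open>A\<close> is the colon ideal of \<open>L\<close> by \<open>v\<close>,
      and \<open>B\<close> is \<open>L + Rv\<close>. Both are strictly larger than \<open>L\<close>
      and so contain powers of \<open>\<aa>\<close>, while their product lies in
      \<open>L\<close>.\<close>
    define B where "B = {l \<oplus> s \<otimes> v | l s. l \<in> L \<and> s \<in> carrier R}"
    have A: "ideal A R"
      using uv LD by (intro ideal_if_closed) (auto simp: A_def l_distr m_assoc)
    have AL: "L \<subseteq> A"
      using LD(1) LD(4)[OF uv(2)] uv by (auto simp: A_def m_comm)
    have BI: "l \<oplus> s \<otimes> v \<in> B" if "l \<in> L" "s \<in> carrier R" for l s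
      using that unfolding B_def by blast
    have B: "ideal B R"
    proof (rule ideal_if_closed)
      show "B \<subseteq> carrier R" using LD(1) uv by (auto simp: B_def)
      show "\<zero> \<in> B" using BI[OF LD(2), of \<zero>] uv by simp
    next
      fix t t' assume "t \<in> B" "t' \<in> B"
      then obtain l s l' s' where *: "l \<in> L" "s \<in> carrier R" "l' \<in> L" "s' \<in> carrier R"
        "t = l \<oplus> s \<otimes> v" "t' = l' \<oplus> s' \<otimes> v" by (auto simp: B_def)
      have "t \<oplus> t' = (l \<oplus> l') \<oplus> (s \<oplus> s') \<otimes> v"
        using * LD(1) uv by (simp add: l_distr a_ac)
      then show "t \<oplus> t' \<in> B" using * LD(3) BI by simp
    next
      fix q t assume "q \<in> carrier R" "t \<in> B"
      then obtain l s where *: "q \<in> carrier R" "l \<in> L" "s \<in> carrier R" "t = l \<oplus> s \<otimes> v" by (auto simp: B_def)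
      have "q \<otimes> t = q \<otimes> l \<oplus> (q \<otimes> s) \<otimes> v" using * LD(1) uv by (simp add: r_distr m_assoc)
      then show "q \<otimes> t \<in> B" using * LD(4) BI by simp
    qed
    have BL: "L \<subseteq> B" using BI[of _ \<zero>] LD(1) uv by auto
    have "u \<in> A" "v \<in> B" using uv BI[OF LD(2), of \<one>] by (auto simp: A_def)
    then have "A \<noteq> L" "B \<noteq> L" using nL by auto
    then obtain m n :: nat where mn: "ideal_power \<aa> m \<subseteq> A" "ideal_power \<aa> n \<subseteq> B"
      using big[OF A AL] big[OF B BL] by meson
    have GG: "t \<otimes> t' \<in> L" if tt: "t \<in> A" "t' \<in> B" for t t'
    proof -
      obtain l s where *: "l \<in> L" "s \<in> carrier R" "t' = l \<oplus> s \<otimes> v" using tt by (auto simp: B_def)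
      have t: "t \<in> carrier R" "t \<otimes> v \<in> L" using tt by (auto simp: A_def)
      have "t \<otimes> t' = t \<otimes> l \<oplus> s \<otimes> (t \<otimes> v)"
        using * t LD(1) uv by (simp add: r_distr m_ac)
      then show ?thesis using * t LD(3,4) by simp
    qed
    have "t \<in> L" if "t \<in> ideal_power \<aa> m \<cdot> ideal_power \<aa> n" for t
      using that by (induction rule: ideal_prod.induct) (use GG mn LD(3) in auto)
    moreover have "ideal_power \<aa> (m + n) = ideal_power \<aa> m \<cdot> ideal_power \<aa> n"
      using monoid.nat_pow_mult[OF comm_monoid.axioms(1)[OF ideals_set_is_comm_monoid], of \<aa> m n] \<aa>
      by (simp add: ideals_set_def)
    ultimately show False using L(3)[of "m + n"] by blast
  qed
  have x_in: "x l \<in> L" if l: "l < p" for l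
  proof -
    have xR: "x l \<in> carrier R" using x[OF l] idealD(1)[OF \<aa>] by blast
    obtain n :: nat where "x l [^] n \<in> L" using nil[OF l] L(2) by blast
    then show ?thesis
    proof (induction n)
      case 0
      then show ?case using LD(4)[of "x l" \<one>] xR by simp
    next
      case (Suc n)
      then show ?case using prime[of "x l [^] n" "x l"] xR by auto
    qed
  qed
  have Lsub: "submodule L R RM"
    by (rule RR.submoduleI) (auto intro: LD)
  have "\<aa> \<subseteq> L"
  proof
    fix y assume "y \<in> \<aa>"
    then obtain w where "\<forall>l<p. w l \<in> carrier R" "y = lin RM p w x" using gen by blast
    then show "y \<in> L" using RR.lin_submodule[OF Lsub, of p w x] x_in by simp
  qed
  then show False using L(3)[of 1] ideal_power_1[OF \<aa>] by simp
qed

text \<open>Torsion can be tested on one generator at a time, by the preceding lemma with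
  \<open>c\<close> the annihilator of \<open>z\<close>. This permits introducing the generators
  successively.\<close>

lemma torsion_submodule_eq:
  assumes M: "module R M" and \<aa>: "ideal \<aa> R" and x: "\<And>l. l < p \<Longrightarrow> x l \<in> \<aa>"
    and gen: "\<And>y. y \<in> \<aa> \<Longrightarrow> \<exists>w. (\<forall>l<p. w l \<in> carrier R) \<and> y = lin RM p w x"
  shows "carrier (torsion_submodule R \<aa> M) =
    {z \<in> carrier M. \<forall>l<p. \<exists>n::nat. x l [^] n \<odot>\<^bsub>M\<^esub> z = \<zero>\<^bsub>M\<^esub>}"
proof -
  interpret M: module R M by fact
  have xR: "x l \<in> carrier R" if "l < p" for l using x[OF that] idealD(1)[OF \<aa>] by blast
  have 1: "\<exists>n::nat. \<forall>s\<in>ideal_power \<aa> n. s \<odot>\<^bsub>M\<^esub> z = \<zero>\<^bsub>M\<^esub>"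
    if z: "z \<in> carrier M" "\<forall>l<p. \<exists>n::nat. x l [^] n \<odot>\<^bsub>M\<^esub> z = \<zero>\<^bsub>M\<^esub>" for z
  proof -
    obtain n :: nat where "ideal_power \<aa> n \<subseteq> {s \<in> carrier R. s \<odot>\<^bsub>M\<^esub> z = \<zero>\<^bsub>M\<^esub>}"
      by (rule ideal_power_subset[OF \<aa> M.annihilator_ideal[OF z(1)], of p x]) (use x gen z xR in auto)
    then show ?thesis by blast
  qed
  have 2: "x l [^] n \<odot>\<^bsub>M\<^esub> z = \<zero>\<^bsub>M\<^esub>"
    if "\<forall>s\<in>ideal_power \<aa> n. s \<odot>\<^bsub>M\<^esub> z = \<zero>\<^bsub>M\<^esub>" "l < p" for z l and n :: nat
    using that power_mem_ideal_power[OF x[OF that(2)] \<aa>] by blast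
  show ?thesis
  proof (intro equalityI subsetI)
    fix z assume "z \<in> carrier (torsion_submodule R \<aa> M)"
    then obtain n :: nat where "z \<in> carrier M" "\<forall>s\<in>ideal_power \<aa> n. s \<odot>\<^bsub>M\<^esub> z = \<zero>\<^bsub>M\<^esub>"
      by (auto simp: torsion_submodule_def)
    then show "z \<in> {z \<in> carrier M. \<forall>l<p. \<exists>n::nat. x l [^] n \<odot>\<^bsub>M\<^esub> z = \<zero>\<^bsub>M\<^esub>}"
      using 2[of n z] by (intro CollectI conjI allI impI exI[of _ n])
  qed (use 1 in \<open>simp add: torsion_submodule_def\<close>)
qed

end

text \<open>The resolved module \<open>K\<close> is left open since two resolutions are treated:
  that of the ring, and that of the dual of its local cohomology.\<close>

locale torsion_filtration = noetherian_cring R for R (structure) +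
  fixes K :: "('a, 'm, 'y) module_scheme"
    and I :: "nat \<Rightarrow> ('a, 'i, 'z) module_scheme" and d :: "nat \<Rightarrow> 'i \<Rightarrow> 'i" and \<eta> :: "'m \<Rightarrow> 'i"
    and x :: "nat \<Rightarrow> 'a" and p :: nat
  assumes res: "injective_resolution R K I d \<eta>"
    and x_closed: "l < p \<Longrightarrow> x l \<in> carrier R"
begin

lemma I_injective: "injective_module R (I q)" and d_hom: "d q \<in> module_homs R (I q) (I (Suc q))"
  and \<eta>_hom: "\<eta> \<in> module_homs R K (I 0)" and \<eta>_inj: "inj_on \<eta> (carrier K)"
  and \<eta>_image: "\<eta> ` carrier K = {z \<in> carrier (I 0). d 0 z = \<zero>\<^bsub>I (Suc 0)\<^esub>}"
  and d_image: "d q ` carrier (I q) = {z \<in> carrier (I (Suc q)). d (Suc q) z = \<zero>\<^bsub>I (Suc (Suc q))\<^esub>}"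
  using res by (auto simp: injective_resolution_def a_kernel_def')

lemma I_module: "module R (I q)"
  using I_injective[of q] by (simp add: injective_module_def)

sublocale I: module R "I q" for q
  by (rule I_module)

lemma d_closed [simp]: "z \<in> carrier (I q) \<Longrightarrow> d q z \<in> carrier (I (Suc q))"
  by (rule module_homsD(1)[OF d_hom])

lemma d_minus: "z \<in> carrier (I q) \<Longrightarrow> w \<in> carrier (I q) \<Longrightarrow>
    d q (z \<ominus>\<^bsub>I q\<^esub> w) = d q z \<ominus>\<^bsub>I (Suc q)\<^esub> d q w"
  by (rule module_homs_minus[OF I_module I_module d_hom])

lemma d_smult: "s \<in> carrier R \<Longrightarrow> z \<in> carrier (I q) \<Longrightarrow> d q (s \<odot>\<^bsub>I q\<^esub> z) = s \<odot>\<^bsub>I (Suc q)\<^esub> d q z"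
  by (rule module_homsD(3)[OF d_hom])

lemma d_zero: "d q \<zero>\<^bsub>I q\<^esub> = \<zero>\<^bsub>I (Suc q)\<^esub>"
  by (rule module_homs_zero[OF I_module I_module d_hom])

lemma d_d: "z \<in> carrier (I q) \<Longrightarrow> d (Suc q) (d q z) = \<zero>\<^bsub>I (Suc (Suc q))\<^esub>"
  using d_image[of q] by blast

definition C :: "nat \<Rightarrow> nat \<Rightarrow> 'i set"
  where "C k q = {z \<in> carrier (I q). \<forall>l<k. \<exists>n::nat. x l [^] n \<odot>\<^bsub>I q\<^esub> z = \<zero>\<^bsub>I q\<^esub>}"

definition Z :: "nat \<Rightarrow> 'i set"
  where "Z q = {z \<in> carrier (I q). d q z = \<zero>\<^bsub>I (Suc q)\<^esub>}"

lemma C_carrier: "z \<in> C k q \<Longrightarrow> z \<in> carrier (I q)"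
  by (simp add: C_def)

lemma C_Suc: "C (Suc k) q \<subseteq> C k q"
  by (auto simp: C_def)

lemma C_submodule:
  assumes k: "k \<le> p"
  shows "submodule (C k q) R (I q)"
proof -
  have xk: "x l \<in> carrier R" if "l < k" for l using that k x_closed by simp
  have add: "z \<oplus>\<^bsub>I q\<^esub> w \<in> C k q" if zw: "z \<in> C k q" "w \<in> C k q" for z w
  proof -
    have "\<exists>n::nat. x l [^] n \<odot>\<^bsub>I q\<^esub> (z \<oplus>\<^bsub>I q\<^esub> w) = \<zero>\<^bsub>I q\<^esub>" if l: "l < k" for l
    proof -
      obtain m n :: nat where mn: "x l [^] m \<odot>\<^bsub>I q\<^esub> z = \<zero>\<^bsub>I q\<^esub>" "x l [^] n \<odot>\<^bsub>I q\<^esub> w = \<zero>\<^bsub>I q\<^esub>"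
        using zw l unfolding C_def by blast
      have c: "z \<in> carrier (I q)" "w \<in> carrier (I q)" using zw by (auto intro: C_carrier)
      have "x l [^] (m + n) \<odot>\<^bsub>I q\<^esub> z = x l [^] n \<odot>\<^bsub>I q\<^esub> (x l [^] m \<odot>\<^bsub>I q\<^esub> z)"
        using xk[OF l] c by (simp add: nat_pow_mult[symmetric] m_comm I.smult_assoc1[symmetric])
      moreover have "x l [^] (m + n) \<odot>\<^bsub>I q\<^esub> w = x l [^] m \<odot>\<^bsub>I q\<^esub> (x l [^] n \<odot>\<^bsub>I q\<^esub> w)"
        using xk[OF l] c by (simp add: nat_pow_mult[symmetric] I.smult_assoc1[symmetric])
      ultimately show ?thesis
        using mn xk[OF l] c by (intro exI[of _ "m + n"]) (simp add: I.smult_r_distr)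
    qed
    then show ?thesis using zw by (auto simp: C_def)
  qed
  have sm: "s \<odot>\<^bsub>I q\<^esub> z \<in> C k q" if s: "s \<in> carrier R" and z: "z \<in> C k q" for s z
    unfolding C_def
  proof (intro CollectI conjI allI impI)
    fix l assume l: "l < k"
    then obtain n :: nat where "x l [^] n \<odot>\<^bsub>I q\<^esub> z = \<zero>\<^bsub>I q\<^esub>" using z unfolding C_def by blast
    moreover have "x l [^] n \<odot>\<^bsub>I q\<^esub> (s \<odot>\<^bsub>I q\<^esub> z) = s \<odot>\<^bsub>I q\<^esub> (x l [^] n \<odot>\<^bsub>I q\<^esub> z)"
      using s xk[OF l] C_carrier[OF z] by (simp add: I.smult_assoc1[symmetric] m_comm)
    ultimately show "\<exists>n::nat. x l [^] n \<odot>\<^bsub>I q\<^esub> (s \<odot>\<^bsub>I q\<^esub> z) = \<zero>\<^bsub>I q\<^esub>"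
      using s by (intro exI[of _ n]) simp
  qed (use s C_carrier[OF z] in simp)
  show ?thesis
  proof (rule I.submodule_if_closed)
    show "\<zero>\<^bsub>I q\<^esub> \<in> C k q" using xk by (auto simp: C_def intro!: exI[of _ 0])
  qed (use add sm in \<open>auto simp: C_def\<close>)
qed

lemmas C_D = I.submoduleD[OF C_submodule]

lemma Z_submodule: "submodule (Z q) R (I q)"
  by (rule I.submodule_if_closed) (auto simp: Z_def d_zero d_smult module_homsD(2)[OF d_hom])

lemma d_C:
  assumes "k \<le> p" "z \<in> C k q"
  shows "d q z \<in> C k (Suc q)"
  unfolding C_def
proof (intro CollectI conjI allI impI)
  fix l assume l: "l < k"
  then obtain n :: nat where "x l [^] n \<odot>\<^bsub>I q\<^esub> z = \<zero>\<^bsub>I q\<^esub>" using assms(2) unfolding C_def by blast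
  then have "x l [^] n \<odot>\<^bsub>I (Suc q)\<^esub> d q z = \<zero>\<^bsub>I (Suc q)\<^esub>"
    using d_smult[of "x l [^] n" z q] d_zero[of q] l assms(1) x_closed[of l] C_carrier[OF assms(2)] by simp
  then show "\<exists>n::nat. x l [^] n \<odot>\<^bsub>I (Suc q)\<^esub> d q z = \<zero>\<^bsub>I (Suc q)\<^esub>" ..
qed (use C_carrier[OF assms(2)] in simp)

text \<open>Injectivity of the powers of \<open>x k\<close> on \<open>C k / C (k+1)\<close>:
  exponents of annihilating powers add.\<close>

lemma C_torsion_free:
  assumes k: "k < p" and z: "z \<in> C k q" and xz: "x k [^] (n::nat) \<odot>\<^bsub>I q\<^esub> z \<in> C (Suc k) q"
  shows "z \<in> C (Suc k) q"
proof -
  obtain m :: nat where "x k [^] m \<odot>\<^bsub>I q\<^esub> (x k [^] n \<odot>\<^bsub>I q\<^esub> z) = \<zero>\<^bsub>I q\<^esub>"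
    using xz unfolding C_def by blast
  then have "x k [^] (m + n) \<odot>\<^bsub>I q\<^esub> z = \<zero>\<^bsub>I q\<^esub>"
    using x_closed[OF k] C_carrier[OF z] by (simp add: nat_pow_mult[symmetric] I.smult_assoc1)
  then show ?thesis using z by (auto simp: C_def less_Suc_eq)
qed

text \<open>Surjectivity of the powers of \<open>x k\<close> on \<open>C k / C (k+1)\<close>. The
  annihilator clause of \<open>injective_divide\<close> ensures that the quotient \<open>z'\<close>
  stays torsion for the earlier generators.\<close>

lemma C_divide:
  assumes k: "k < p" and z: "z \<in> C k q"
  obtains z' where "z' \<in> C k q" "z \<ominus>\<^bsub>I q\<^esub> x k [^] (n::nat) \<odot>\<^bsub>I q\<^esub> z' \<in> C (Suc k) q"
proof -
  have xk: "x k \<in> carrier R" using x_closed k by simp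
  obtain z' m where z': "z' \<in> carrier (I q)"
    and m: "((x k [^] n) [^] (m::nat)) \<odot>\<^bsub>I q\<^esub> (z \<ominus>\<^bsub>I q\<^esub> x k [^] n \<odot>\<^bsub>I q\<^esub> z') = \<zero>\<^bsub>I q\<^esub>"
    and ann: "\<And>s. s \<in> carrier R \<Longrightarrow> s \<odot>\<^bsub>I q\<^esub> z = \<zero>\<^bsub>I q\<^esub> \<Longrightarrow> s \<odot>\<^bsub>I q\<^esub> z' = \<zero>\<^bsub>I q\<^esub>"
    by (rule injective_divide[OF I_injective C_carrier[OF z], of "x k [^] n"]) (use xk in auto)
  have z'C: "z' \<in> C k q"
    unfolding C_def
  proof (intro CollectI conjI allI impI z')
    fix l assume l: "l < k"
    then obtain n' :: nat where "x l [^] n' \<odot>\<^bsub>I q\<^esub> z = \<zero>\<^bsub>I q\<^esub>" using z unfolding C_def by blast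
    then show "\<exists>n::nat. x l [^] n \<odot>\<^bsub>I q\<^esub> z' = \<zero>\<^bsub>I q\<^esub>"
      using ann[of "x l [^] n'"] l k x_closed[of l] by auto
  qed
  have "z \<ominus>\<^bsub>I q\<^esub> x k [^] n \<odot>\<^bsub>I q\<^esub> z' \<in> C k q"
    using C_D(5)[of k z q "x k [^] n \<odot>\<^bsub>I q\<^esub> z'"] C_D(6)[of k "x k [^] n" z' q] k z z'C xk by simp
  then have "z \<ominus>\<^bsub>I q\<^esub> x k [^] n \<odot>\<^bsub>I q\<^esub> z' \<in> C (Suc k) q"
    using m nat_pow_pow[OF xk, of n m] unfolding C_def by (auto simp: less_Suc_eq)
  then show thesis using that z'C by blast
qed

text \<open>\<open>C k\<close> is acyclic in degrees above \<open>k\<close>. A primitive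
  \<open>w\<close> in \<open>C k\<close> is corrected to one in \<open>C (k+1)\<close>; this applies
  the induction hypothesis twice, to \<open>z\<close> and to a multiple of \<open>w\<close> one
  degree lower, so each new generator costs one degree.\<close>

lemma C_exact:
  assumes "k \<le> p" "k \<le> q" "z \<in> C k (Suc q)" "d (Suc q) z = \<zero>\<^bsub>I (Suc (Suc q))\<^esub>"
  shows "\<exists>w\<in>C k q. d q w = z"
  using assms
proof (induction k arbitrary: q z)
  case 0
  then have "z \<in> d q ` carrier (I q)" unfolding d_image by (simp add: C_def)
  then show ?case by (auto simp: C_def)
next
  case (Suc k)
  then obtain q' where q: "q = Suc q'" "k \<le> q'" by (cases q) auto
  have kp: "k < p" "k \<le> p" and xk: "x k \<in> carrier R" using Suc.prems x_closed[of k] by auto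
  have zk: "z \<in> C k (Suc q)" using Suc.prems C_Suc by blast
  obtain w where w: "w \<in> C k q" "d q w = z"
    using Suc.IH[of q z] Suc.prems zk kp q by auto
  obtain n :: nat where n: "x k [^] n \<odot>\<^bsub>I (Suc q)\<^esub> z = \<zero>\<^bsub>I (Suc q)\<^esub>"
    using Suc.prems(3) unfolding C_def by blast
  have xw: "x k [^] n \<odot>\<^bsub>I q\<^esub> w \<in> C k q" using C_D(6)[OF kp(2)] w xk by simp
  have "d q (x k [^] n \<odot>\<^bsub>I q\<^esub> w) = \<zero>\<^bsub>I (Suc q)\<^esub>"
    using d_smult[of "x k [^] n" w q] w n xk C_carrier[OF w(1)] by simp
  then obtain v where v: "v \<in> C k q'" "d q' v = x k [^] n \<odot>\<^bsub>I q\<^esub> w"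
    using Suc.IH[of q' "x k [^] n \<odot>\<^bsub>I q\<^esub> w"] kp q xw by auto
  \<comment> \<open>By the choice of \<open>v'\<close>, the multiple of \<open>w - d v'\<close> by
    \<open>x k [^] n\<close> is the image under \<open>d\<close> of an element of
    \<open>C (k+1)\<close>. Torsion-freeness then strips the power of \<open>x k\<close>.\<close>
  obtain v' where v': "v' \<in> C k q'" "v \<ominus>\<^bsub>I q'\<^esub> x k [^] n \<odot>\<^bsub>I q'\<^esub> v' \<in> C (Suc k) q'"
    by (rule C_divide[OF kp(1) v(1)])
  have c: "v \<in> carrier (I q')" "v' \<in> carrier (I q')" "w \<in> carrier (I q)"
    using v v' w by (auto intro: C_carrier)
  have wd: "w \<ominus>\<^bsub>I q\<^esub> d q' v' \<in> C k q"
    using C_D(5)[OF kp(2)] w(1) d_C[OF kp(2) v'(1)] q by simp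
  have "d q' (v \<ominus>\<^bsub>I q'\<^esub> x k [^] n \<odot>\<^bsub>I q'\<^esub> v') = x k [^] n \<odot>\<^bsub>I q\<^esub> (w \<ominus>\<^bsub>I q\<^esub> d q' v')"
    using c xk v(2) q by (simp add: d_minus d_smult I.smult_minus)
  then have "x k [^] n \<odot>\<^bsub>I q\<^esub> (w \<ominus>\<^bsub>I q\<^esub> d q' v') \<in> C (Suc k) q"
    using d_C[of "Suc k", OF _ v'(2)] Suc.prems(1) q by simp
  then have "w \<ominus>\<^bsub>I q\<^esub> d q' v' \<in> C (Suc k) q" using C_torsion_free[OF kp(1) wd] by blast
  moreover have "d q (w \<ominus>\<^bsub>I q\<^esub> d q' v') = z"
    using c q d_minus[of w q "d q' v'"] d_d[of v' q'] w(2) I.add_minus_cancel(1)[of z "Suc q" "\<zero>\<^bsub>I (Suc q)\<^esub>"]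
      C_carrier[OF zk] by simp
  ultimately show ?case by blast
qed

definition BC :: "nat \<Rightarrow> 'i set"
  where "BC q = (case q of 0 \<Rightarrow> {\<zero>\<^bsub>I 0\<^esub>} | Suc q' \<Rightarrow> d q' ` C p q')"

lemma BC_simps: "BC 0 = {\<zero>\<^bsub>I 0\<^esub>}" "BC (Suc q) = d q ` C p q"
  by (simp_all add: BC_def)

lemma BC_subset: "BC q \<subseteq> Z q \<inter> C p q"
proof (cases q)
  case 0
  then show ?thesis using C_D(2)[of p 0] d_zero[of 0] by (auto simp: BC_def Z_def)
next
  case (Suc q')
  then show ?thesis using d_C[of p _ q'] d_d[of _ q'] C_carrier[of _ p q'] by (auto simp: BC_def Z_def)
qed

lemma BC_submodule: "submodule (BC q) R (I q)"
proof (cases q)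
  case 0
  then show ?thesis using I.submodule_zero[of 0] by (simp add: BC_def)
next
  case (Suc q')
  then show ?thesis
    using image_submodule[OF I_module I_module d_hom C_submodule[OF order_refl]] by (simp add: BC_def)
qed

lemma cocycle_module: "module R ((I q)\<lparr>carrier := Z q \<inter> C p q\<rparr>)"
  using submodule.submodule_is_module[OF I.submodule_inter[OF Z_submodule C_submodule[OF order_refl]] I_module] .

lemma BC_submodule_cocycles: "submodule (BC q) R ((I q)\<lparr>carrier := Z q \<inter> C p q\<rparr>)"
proof -
  interpret N: module R "(I q)\<lparr>carrier := Z q \<inter> C p q\<rparr>" by (rule cocycle_module)
  note B = I.submoduleD[OF BC_submodule[of q]]
  show ?thesis
    by (rule N.submodule_if_closed) (use B BC_subset[of q] in auto)
qed

section \<open>Local cohomology in terms of the filtration\<close>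

context
  fixes \<aa> :: "'a set"
  assumes torsion: "\<And>q. carrier (torsion_submodule R \<aa> (I q)) = C p q"
begin

lemma local_cohomology_eq:
  "local_cohomology R \<aa> I d q = quotient_module ((I q)\<lparr>carrier := Z q \<inter> C p q\<rparr>) (BC q)"
proof -
  have "a_kernel (torsion_submodule R \<aa> (I q)) (torsion_submodule R \<aa> (I (Suc q))) (d q) = Z q \<inter> C p q"
    unfolding a_kernel_def' torsion by (auto simp: Z_def C_carrier torsion_submodule_def)
  moreover have "coboundaries (\<lambda>n. torsion_submodule R \<aa> (I n)) d q = BC q"
    by (cases q) (simp_all add: BC_simps torsion, simp add: torsion_submodule_def)
  ultimately show ?thesis
    by (simp add: local_cohomology_def cohomology_def torsion_submodule_def)
qed

lemma zero_module_local_cohomology: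
  "zero_module (local_cohomology R \<aa> I d q) \<longleftrightarrow> Z q \<inter> C p q = BC q"
proof -
  let ?N = "(I q)\<lparr>carrier := Z q \<inter> C p q\<rparr>" and ?H = "quotient_module ((I q)\<lparr>carrier := Z q \<inter> C p q\<rparr>) (BC q)"
  note proj = quotient_projection[OF cocycle_module[of q] BC_submodule_cocycles[of q]]
  interpret H: module R ?H
    by (rule quotient_module_is_module[OF cocycle_module[of q] BC_submodule_cocycles[of q]])
  have "zero_module ?H \<longleftrightarrow> (\<forall>X\<in>carrier ?H. X = \<zero>\<^bsub>?H\<^esub>)"
    unfolding zero_module_def using H.M.zero_closed by blast
  also have "\<dots> \<longleftrightarrow> (\<forall>z\<in>Z q \<inter> C p q. BC q +>\<^bsub>?N\<^esub> z = \<zero>\<^bsub>?H\<^esub>)"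
    unfolding proj(2) by simp
  also have "\<dots> \<longleftrightarrow> (\<forall>z\<in>Z q \<inter> C p q. z \<in> BC q)" using proj(3) by (intro ball_cong) simp_all
  finally show ?thesis using BC_subset[of q] unfolding local_cohomology_eq by blast
qed

lemma local_cohomology_module: "module R (local_cohomology R \<aa> I d q)"
  unfolding local_cohomology_eq
  by (rule quotient_module_is_module[OF cocycle_module BC_submodule_cocycles])

end

end

text \<open>An injective resolution of the ring meets a free resolution of \<open>R/b\<close>. The
  hypothesis on \<open>N\<close> is the form in which an inclusion of \<open>\<aa>^N\<close> in
  \<open>b\<close> is used.\<close>

locale torsion_tor = torsion_filtration R "regular_module R" I d \<eta> x p + free_resolution R b r a
  for R (structure) and I :: "nat \<Rightarrow> ('a, 'i, 'z) module_scheme" and d \<eta> x p b r a +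
  fixes N :: nat
  assumes x_power: "l < p \<Longrightarrow> x l [^] N \<in> b"
begin

lemma tor_zero_trivial:
  assumes "submodule A R (I q)"
  shows "tor_zero (I q) A A j"
proof (rule tor_zeroI)
  fix z assume "\<And>i. i < r (Suc j) \<Longrightarrow> z i \<in> A"
  then show "\<exists>w. (\<forall>k<r (Suc (Suc j)). w k \<in> A) \<and>
      (\<forall>i<r (Suc j). z i \<ominus>\<^bsub>I q\<^esub> bnd (I q) (Suc j) w i \<in> A)"
    using I.submoduleD(2,5)[OF assms] by (intro exI[of _ "\<lambda>_. \<zero>\<^bsub>I q\<^esub>"]) auto
qed

text \<open>Each layer \<open>C k / C (k+1)\<close> has no Tor, because \<open>x k [^] N\<close>
  lies in \<open>b\<close> and acts bijectively; the layers are put together by extension.\<close>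

lemma tor_zero_I: "tor_zero (I q) (carrier (I q)) (C p q) j"
proof -
  have "tor_zero (I q) (carrier (I q)) (C k q) j" if "k \<le> p" for k
    using that
  proof (induction k)
    case 0
    have "C 0 q = carrier (I q)" by (auto simp: C_def)
    then show ?case using tor_zero_trivial[OF I.carrier_is_submodule] by simp
  next
    case (Suc k)
    then have k: "k < p" "k \<le> p" by auto
    have "tor_zero (I q) (C k q) (C (Suc k) q) j"
    proof (rule tor_zero_divisible[OF I_module C_submodule C_submodule C_Suc x_power])
      show "\<exists>z'\<in>C k q. z \<ominus>\<^bsub>I q\<^esub> x k [^] N \<odot>\<^bsub>I q\<^esub> z' \<in> C (Suc k) q" if "z \<in> C k q" for z
        by (rule C_divide[OF k(1) that, of N]) blast
      show "z \<in> C (Suc k) q" if "z \<in> C k q" "x k [^] N \<odot>\<^bsub>I q\<^esub> z \<in> C (Suc k) q" for z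
        using C_torsion_free[OF k(1) that] .
    qed (use Suc.prems k in auto)
    then show ?case
      using Suc k C_Suc C_carrier
      by (intro tor_zero_extension[OF I_module I.carrier_is_submodule C_submodule[of k] C_submodule[of "Suc k"]]) auto
  qed
  then show ?thesis by simp
qed

lemma tor_zero_Z_high:
  assumes q: "p \<le> q"
  shows "tor_zero (I q) (Z q) (Z q \<inter> C p q) j"
proof -
  have sub: "submodule (Z q \<inter> C k q) R (I q)" if "k \<le> p" for k
    using I.submodule_inter[OF Z_submodule C_submodule[OF that]] .
  have "tor_zero (I q) (Z q) (Z q \<inter> C k q) j" if "k \<le> p" for k
    using that
  proof (induction k)
    case 0
    have "Z q \<inter> C 0 q = Z q" by (auto simp: C_def Z_def)
    then show ?case using tor_zero_trivial[OF Z_submodule] by simp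
  next
    case (Suc k)
    then have k: "k < p" "k \<le> p" by auto
    have xk: "x k [^] N \<in> carrier R" using x_closed[OF k(1)] by simp
    have "tor_zero (I q) (Z q \<inter> C k q) (Z q \<inter> C (Suc k) q) j"
    proof (rule tor_zero_divisible[OF I_module sub sub _ x_power])
      fix z assume z: "z \<in> Z q \<inter> C k q"
      then have zk: "z \<in> C k q" by blast
      obtain m where m: "m \<in> C k q" "z \<ominus>\<^bsub>I q\<^esub> x k [^] N \<odot>\<^bsub>I q\<^esub> m \<in> C (Suc k) q"
        by (rule C_divide[OF k(1) zk])
      have c: "z \<in> carrier (I q)" "m \<in> carrier (I q)" using zk m by (auto intro: C_carrier)
      have "d q (z \<ominus>\<^bsub>I q\<^esub> x k [^] N \<odot>\<^bsub>I q\<^esub> m) = \<zero>\<^bsub>I (Suc q)\<^esub> \<ominus>\<^bsub>I (Suc q)\<^esub> x k [^] N \<odot>\<^bsub>I (Suc q)\<^esub> d q m"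
        using c xk z by (simp add: d_minus d_smult Z_def)
      then have "\<zero>\<^bsub>I (Suc q)\<^esub> \<ominus>\<^bsub>I (Suc q)\<^esub> x k [^] N \<odot>\<^bsub>I (Suc q)\<^esub> d q m \<in> C (Suc k) (Suc q)"
        using d_C[OF Suc.prems m(2)] by simp
      then have "x k [^] N \<odot>\<^bsub>I (Suc q)\<^esub> d q m \<in> C (Suc k) (Suc q)"
        using I.diff_mem_iff[OF C_submodule[OF Suc.prems], of "\<zero>\<^bsub>I (Suc q)\<^esub>" "Suc q" "x k [^] N \<odot>\<^bsub>I (Suc q)\<^esub> d q m"]
          C_D(2)[OF Suc.prems] c xk by simp
      then have "d q m \<in> C (Suc k) (Suc q)"
        using C_torsion_free[OF k(1) d_C[OF k(2) m(1)]] by blast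
      \<comment> \<open>The quotient \<open>m\<close> from \<open>C_divide\<close> need not be a
        cocycle. In degrees \<open>q \<ge> p\<close>, however, \<open>C (k+1)\<close> is acyclic at
        \<open>d q m\<close>, and the primitive \<open>w\<close> found there turns \<open>m\<close>
        into the cocycle \<open>m - w\<close> of the same class modulo
        \<open>C (k+1)\<close>.\<close>
      then obtain w where w: "w \<in> C (Suc k) q" "d q w = d q m"
        using C_exact[of "Suc k" q "d q m"] d_d[OF c(2)] Suc.prems q by auto
      have wc: "w \<in> carrier (I q)" using w by (auto intro: C_carrier)
      have wk: "w \<in> C k q" using w C_Suc by blast
      have "m \<ominus>\<^bsub>I q\<^esub> w \<in> C k q" using C_D(5)[OF k(2) m(1) wk] .
      moreover have "d q (m \<ominus>\<^bsub>I q\<^esub> w) = \<zero>\<^bsub>I (Suc q)\<^esub>"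
        using d_minus[OF c(2) wc] w(2) I.add_minus_cancel(4)[of "d q m" "Suc q" "d q m"] c by simp
      ultimately have mw: "m \<ominus>\<^bsub>I q\<^esub> w \<in> Z q \<inter> C k q" by (auto simp: Z_def C_carrier)
      have "z \<ominus>\<^bsub>I q\<^esub> x k [^] N \<odot>\<^bsub>I q\<^esub> (m \<ominus>\<^bsub>I q\<^esub> w) \<in> C (Suc k) q"
      proof (rule I.diff_trans[OF C_submodule[OF Suc.prems] _ _ _ m(2)])
        have "x k [^] N \<odot>\<^bsub>I q\<^esub> m \<ominus>\<^bsub>I q\<^esub> x k [^] N \<odot>\<^bsub>I q\<^esub> (m \<ominus>\<^bsub>I q\<^esub> w) = x k [^] N \<odot>\<^bsub>I q\<^esub> w"
          using I.smult_minus[of "x k [^] N" m q "m \<ominus>\<^bsub>I q\<^esub> w"] I.add_minus_cancel(3)[of m q w] c wc xk by simp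
        then show "x k [^] N \<odot>\<^bsub>I q\<^esub> m \<ominus>\<^bsub>I q\<^esub> x k [^] N \<odot>\<^bsub>I q\<^esub> (m \<ominus>\<^bsub>I q\<^esub> w) \<in> C (Suc k) q"
          using C_D(6)[OF Suc.prems xk w(1)] by simp
      qed (use c wc xk in auto)
      moreover have "z \<ominus>\<^bsub>I q\<^esub> x k [^] N \<odot>\<^bsub>I q\<^esub> (m \<ominus>\<^bsub>I q\<^esub> w) \<in> Z q"
        using I.submoduleD(5,6)[OF Z_submodule] z mw xk by blast
      ultimately show "\<exists>z'\<in>Z q \<inter> C k q. z \<ominus>\<^bsub>I q\<^esub> x k [^] N \<odot>\<^bsub>I q\<^esub> z' \<in> Z q \<inter> C (Suc k) q"
        using mw by blast
    next
      show "z \<in> Z q \<inter> C (Suc k) q"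
        if "z \<in> Z q \<inter> C k q" "x k [^] N \<odot>\<^bsub>I q\<^esub> z \<in> Z q \<inter> C (Suc k) q" for z
        using C_torsion_free[OF k(1)] that by blast
    qed (use Suc.prems k C_Suc in auto)
    then show ?case
      using Suc k C_Suc
      by (intro tor_zero_extension[OF I_module Z_submodule sub[of k] sub[of "Suc k"]]) auto
  qed
  then show ?thesis by simp
qed

text \<open>Since \<open>I q / C p q\<close> has no Tor, the connecting map for
  \<open>C p q \<subseteq> W \<subseteq> I q\<close> is bijective. The differential identifies
  \<open>I q / W\<close> with \<open>Z (q+1) / BC (q+1)\<close>, and the inclusion identifies
  \<open>Z q / (Z q \<inter> C p q)\<close> with \<open>W / C p q\<close>.\<close>

lemma tor_zero_shift:
  "tor_zero (I (Suc q)) (Z (Suc q)) (BC (Suc q)) (Suc j) \<longleftrightarrow> tor_zero (I q) (Z q) (Z q \<inter> C p q) j"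
proof -
  \<comment> \<open>\<open>W\<close> is \<open>Z q + C p q\<close>, described as a preimage under
    the differential.\<close>
  define W where "W = {z \<in> carrier (I q). d q z \<in> d q ` C p q}"
  note C = C_submodule[OF order_refl, of q] and CD = C_D[OF order_refl]
  have W: "submodule W R (I q)"
  proof -
    note B = I.submoduleD[OF BC_submodule[of "Suc q"], unfolded BC_simps]
    show ?thesis
      by (rule I.submodule_if_closed)
        (use B in \<open>auto simp: W_def d_zero d_smult module_homsD(2)[OF d_hom]\<close>)
  qed
  have CW: "C p q \<subseteq> W" by (auto simp: W_def C_carrier)
  have "tor_zero (I q) (Z q) (Z q \<inter> C p q) j \<longleftrightarrow> tor_zero (I q) W (C p q) j"
  proof (rule tor_zero_iso[OF I_module I_module _ Z_submodule W C])
    show "(\<lambda>z. z) \<in> module_homs R (I q) (I q)" by (auto simp: module_homs_def)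
    show "z \<in> W" if "z \<in> Z q" for z
      using that d_zero[of q] CD(2) by (auto simp: Z_def W_def intro!: image_eqI[of _ _ "\<zero>\<^bsub>I q\<^esub>"])
    show "\<exists>z\<in>Z q. z' \<ominus>\<^bsub>I q\<^esub> z \<in> C p q" if z'W: "z' \<in> W" for z'
    proof -
      obtain w where w: "w \<in> C p q" "d q z' = d q w" "z' \<in> carrier (I q)" using z'W by (auto simp: W_def)
      have wc: "w \<in> carrier (I q)" using w by (auto intro: C_carrier)
      have "z' \<ominus>\<^bsub>I q\<^esub> w \<in> Z q"
        using w wc d_minus[of z' q w] I.add_minus_cancel(4)[of "d q w" "Suc q" "d q w"] by (simp add: Z_def)
      moreover have "z' \<ominus>\<^bsub>I q\<^esub> (z' \<ominus>\<^bsub>I q\<^esub> w) \<in> C p q"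
        using I.add_minus_cancel(3)[of z' q w] w wc by simp
      ultimately show ?thesis by blast
    qed
  qed auto
  moreover have "tor_zero (I q) (carrier (I q)) W (Suc j) \<longleftrightarrow>
      tor_zero (I (Suc q)) (Z (Suc q)) (BC (Suc q)) (Suc j)"
  proof (rule tor_zero_iso[OF I_module I_module d_hom I.carrier_is_submodule Z_submodule BC_submodule])
    show "d q z \<in> Z (Suc q)" if "z \<in> carrier (I q)" for z using that d_d by (simp add: Z_def)
    show "\<exists>z\<in>carrier (I q). z' \<ominus>\<^bsub>I (Suc q)\<^esub> d q z \<in> BC (Suc q)" if z': "z' \<in> Z (Suc q)" for z'
    proof -
      obtain z where z: "z \<in> carrier (I q)" "z' = d q z" using z' d_image[of q] by (auto simp: Z_def)
      then have "z' \<ominus>\<^bsub>I (Suc q)\<^esub> d q z = \<zero>\<^bsub>I (Suc q)\<^esub>"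
        using I.add_minus_cancel(4)[of z' "Suc q" z'] by simp
      then show ?thesis using I.submoduleD(2)[OF BC_submodule[of "Suc q"]] z by (intro bexI[of _ z]) auto
    qed
    show "z \<in> W \<longleftrightarrow> d q z \<in> BC (Suc q)" if "z \<in> carrier (I q)" for z
      using that by (simp add: W_def BC_simps)
  qed
  moreover have "tor_zero (I q) (carrier (I q)) W (Suc j) \<longleftrightarrow> tor_zero (I q) W (C p q) j"
  proof
    have Wc: "W \<subseteq> carrier (I q)" by (auto simp: W_def)
    show "tor_zero (I q) W (C p q) j" if "tor_zero (I q) (carrier (I q)) W (Suc j)"
      using tor_zero_sub[OF I_module I.carrier_is_submodule W C CW Wc tor_zero_I that] .
    show "tor_zero (I q) (carrier (I q)) W (Suc j)" if "tor_zero (I q) W (C p q) j"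
      using tor_zero_quotient[OF I_module I.carrier_is_submodule W C CW Wc tor_zero_I that] .
  qed
  ultimately show ?thesis by simp
qed

lemma tor_zero_Z_0: "tor_zero (I 0) (Z 0) (BC 0) j \<longleftrightarrow> tor_zero RM (carrier R) {\<zero>} j"
proof -
  have \<eta>0: "\<eta> \<zero> = \<zero>\<^bsub>I 0\<^esub>" using module_homs_zero[OF RR.module_axioms I_module \<eta>_hom] by simp
  have "tor_zero RM (carrier RM) {\<zero>} j \<longleftrightarrow> tor_zero (I 0) (Z 0) (BC 0) j"
  proof (rule tor_zero_iso[OF RR.module_axioms I_module \<eta>_hom RR.carrier_is_submodule Z_submodule BC_submodule])
    show "\<eta> z \<in> Z 0" if "z \<in> carrier RM" for z
      using that \<eta>_image by (auto simp: Z_def)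
    show "\<exists>z\<in>carrier RM. z' \<ominus>\<^bsub>I 0\<^esub> \<eta> z \<in> BC 0" if z'Z: "z' \<in> Z 0" for z'
    proof -
      obtain z where z: "z \<in> carrier RM" "z' = \<eta> z" using z'Z unfolding Z_def \<eta>_image[symmetric] by blast
      then have "z' \<ominus>\<^bsub>I 0\<^esub> \<eta> z = \<zero>\<^bsub>I 0\<^esub>" using I.add_minus_cancel(4)[of z' 0 z'] z'Z by (simp add: Z_def)
      then show ?thesis using z by (auto simp: BC_simps intro!: bexI[of _ z])
    qed
    show "z \<in> {\<zero>} \<longleftrightarrow> \<eta> z \<in> BC 0" if "z \<in> carrier RM" for z
      using that \<eta>0 inj_onD[OF \<eta>_inj, of z \<zero>] by (auto simp: BC_simps)
  qed
  then show ?thesis by simp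
qed

section \<open>Tor of the local cohomology concentrated in degree \<open>c\<close>\<close>

context
  fixes c :: nat
  assumes exact_C: "\<And>q. q \<noteq> c \<Longrightarrow> Z q \<inter> C p q = BC q"
begin

text \<open>Descending induction from the degrees \<open>q \<ge> p\<close>: above \<open>c\<close>
  the torsion cocycles are coboundaries, so that \<open>tor_zero_shift\<close> leads from
  \<open>q + 1\<close> to \<open>q\<close>. The number \<open>n\<close> bounds the distance from
  \<open>q\<close> to \<open>p\<close>.\<close>

lemma tor_zero_Z_above:
  assumes "c \<le> q"
  shows "tor_zero (I q) (Z q) (Z q \<inter> C p q) j"
proof -
  have "tor_zero (I q) (Z q) (Z q \<inter> C p q) j" if "c \<le> q" "p \<le> q + n" for n q j
    using that
  proof (induction n arbitrary: q j)
    case 0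
    then show ?case using tor_zero_Z_high by simp
  next
    case (Suc n q j)
    then have "tor_zero (I (Suc q)) (Z (Suc q)) (BC (Suc q)) (Suc j)"
      using Suc.IH[of "Suc q" "Suc j"] exact_C[of "Suc q"] by simp
    then show ?case by (simp add: tor_zero_shift)
  qed
  then show ?thesis using assms le_add2 by meson
qed

text \<open>Ascending induction from \<open>Z 0\<close>, which is the ring. Below \<open>c\<close>
  torsion cocycles are coboundaries, so each shift raises both the cohomological degree and the
  degree of Tor by one. The disjunct \<open>j < q\<close> stands for the degrees of
  \<open>Tor(R/b, R)\<close> below -1.\<close>

lemma tor_zero_Z_BC:
  assumes "q \<le> c"
  shows "tor_zero (I q) (Z q) (BC q) j \<longleftrightarrow> j < q \<or> tor_zero RM (carrier R) {\<zero>} (j - q)"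
  using assms
proof (induction q arbitrary: j)
  case 0
  then show ?case by (simp add: tor_zero_Z_0)
next
  case (Suc q)
  show ?case
  proof (cases j)
    case 0
    then show ?thesis using tor_zero_0[OF I.submoduleD(2)[OF Z_submodule]] by simp
  next
    case (Suc j')
    then show ?thesis using Suc.IH[of j'] Suc.prems exact_C[of q] by (simp add: tor_zero_shift)
  qed
qed

text \<open>The cohomology in degree \<open>c\<close> is a submodule of \<open>Z c / BC c\<close>
  whose quotient \<open>Z c / (Z c \<inter> C p c)\<close> has no Tor in any degree.\<close>

lemma tor_zero_cohomology:
  "tor_zero (I c) (Z c \<inter> C p c) (BC c) j \<longleftrightarrow>
    j < c \<or> tor_zero RM (carrier R) {\<zero>} (j - c)"
proof -
  note ZC = I.submodule_inter[OF Z_submodule C_submodule[OF order_refl]]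
  have "tor_zero (I c) (Z c \<inter> C p c) (BC c) j \<longleftrightarrow> tor_zero (I c) (Z c) (BC c) j"
  proof
    show "tor_zero (I c) (Z c) (BC c) j" if "tor_zero (I c) (Z c \<inter> C p c) (BC c) j"
      using tor_zero_extension[OF I_module Z_submodule ZC BC_submodule BC_subset _ that tor_zero_Z_above] by simp
    show "tor_zero (I c) (Z c \<inter> C p c) (BC c) j" if "tor_zero (I c) (Z c) (BC c) j"
      using tor_zero_sub[OF I_module Z_submodule ZC BC_submodule BC_subset _ that tor_zero_Z_above] by simp
  qed
  then show ?thesis using tor_zero_Z_BC[of c j] by simp
qed

lemma tor_zero_local_cohomology:
  assumes torsion: "\<And>q. carrier (torsion_submodule R \<aa> (I q)) = C p q"
  shows "tor_zero (local_cohomology R \<aa> I d c) (carrier (local_cohomology R \<aa> I d c))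
      {\<zero>\<^bsub>local_cohomology R \<aa> I d c\<^esub>} j \<longleftrightarrow>
    j < c \<or> tor_zero RM (carrier R) {\<zero>} (j - c)"
proof -
  let ?N = "(I c)\<lparr>carrier := Z c \<inter> C p c\<rparr>" and ?H = "quotient_module ((I c)\<lparr>carrier := Z c \<inter> C p c\<rparr>) (BC c)"
  note N = cocycle_module[of c] and B = BC_submodule_cocycles[of c]
  note ZC = I.submodule_inter[OF Z_submodule C_submodule[OF order_refl]]
  interpret N: module R ?N by (rule N)
  interpret H: module R ?H by (rule quotient_module_is_module[OF N B])
  note proj = quotient_projection[OF N B]
  have "tor_zero ?N (carrier ?N) (BC c) j \<longleftrightarrow> tor_zero ?H (carrier ?H) {\<zero>\<^bsub>?H\<^esub>} j"
  proof (rule tor_zero_iso[OF N H.module_axioms proj(1) N.carrier_is_submodule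
        H.carrier_is_submodule H.submodule_zero])
    show "BC c +>\<^bsub>?N\<^esub> z \<in> carrier ?H" if "z \<in> carrier ?N" for z
      using proj(2) that by blast
    show "\<exists>z\<in>carrier ?N. z' \<ominus>\<^bsub>?H\<^esub> (BC c +>\<^bsub>?N\<^esub> z) \<in> {\<zero>\<^bsub>?H\<^esub>}" if z': "z' \<in> carrier ?H" for z'
    proof -
      obtain z where z: "z \<in> carrier ?N" "z' = BC c +>\<^bsub>?N\<^esub> z" using z' proj(2) by blast
      then have "z' \<ominus>\<^bsub>?H\<^esub> (BC c +>\<^bsub>?N\<^esub> z) = \<zero>\<^bsub>?H\<^esub>" using H.add_minus_cancel(4)[of z' z'] z' by simp
      then show ?thesis using z(1) by blast
    qed
    show "z \<in> BC c \<longleftrightarrow> BC c +>\<^bsub>?N\<^esub> z \<in> {\<zero>\<^bsub>?H\<^esub>}" if "z \<in> carrier ?N" for z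
      using proj(3)[OF that] by blast
  qed
  moreover have "tor_zero ?N (carrier ?N) (BC c) j \<longleftrightarrow> tor_zero (I c) (Z c \<inter> C p c) (BC c) j"
  proof (rule tor_zero_iso[OF N I_module _ N.carrier_is_submodule ZC BC_submodule])
    show "(\<lambda>z. z) \<in> module_homs R ?N (I c)" by (auto simp: module_homs_def C_carrier)
    show "\<exists>z\<in>carrier ?N. z' \<ominus>\<^bsub>I c\<^esub> z \<in> BC c" if "z' \<in> Z c \<inter> C p c" for z'
      using that I.add_minus_cancel(4)[of z' c z'] C_carrier[of z' p c] I.submoduleD(2)[OF BC_submodule[of c]]
      by (intro bexI[of _ z']) auto
  qed auto
  ultimately show ?thesis using tor_zero_cohomology by (simp add: local_cohomology_eq[OF torsion])
qed

end

end

section \<open>Local cohomology of the dual\<close>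

lemma zero_module_Hom_module:
  assumes M: "module R M" and N: "module R N" and zero: "zero_module M"
  shows "zero_module (Hom_module R M N)"
proof -
  interpret H: module R "Hom_module R M N" by (rule Hom_module_is_module[OF M N])
  have "f = \<zero>\<^bsub>Hom_module R M N\<^esub>" if f: "f \<in> carrier (Hom_module R M N)" for f
  proof (rule Hom_module_eqI[OF f])
    fix z assume "z \<in> carrier M"
    then have "z = \<zero>\<^bsub>M\<^esub>" using zero by (simp add: zero_module_def)
    moreover have "f \<zero>\<^bsub>M\<^esub> = \<zero>\<^bsub>N\<^esub>"
      using f module_homs_zero[OF M N, of f] by (simp add: Hom_module_simps)
    ultimately show "f z = \<zero>\<^bsub>Hom_module R M N\<^esub> z"
      using \<open>z \<in> carrier M\<close> by (simp add: Hom_module_simps)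
  qed simp
  then show ?thesis using H.M.zero_closed by (auto simp: zero_module_def)
qed

text \<open>If \<open>J[\<aa>]\<close> has cohomology in degree \<open>c\<close>, then so has \<open>\<Gamma>\<^sub>\<aa>(J)\<close>: a solution \<open>w\<close> of \<open>\<delta> w = z\<close> in
  \<open>\<Gamma>\<^sub>\<aa>(J)\<close> with maximal annihilator is already annihilated by \<open>\<aa>\<close>.\<close>

lemma (in torsion_filtration) torsion_coboundary_killed:
  fixes \<aa> :: "'a set" and n :: nat
  assumes \<aa>: "ideal \<aa> R"
    and z: "z \<in> carrier (I (Suc q))" "\<And>s. s \<in> \<aa> \<Longrightarrow> s \<odot>\<^bsub>I (Suc q)\<^esub> z = \<zero>\<^bsub>I (Suc q)\<^esub>"
    and w0: "w0 \<in> carrier (I q)" "d q w0 = z"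
      "\<And>s. s \<in> ideal_power \<aa> n \<Longrightarrow> s \<odot>\<^bsub>I q\<^esub> w0 = \<zero>\<^bsub>I q\<^esub>"
    and ex: "\<And>b u. ideal b R \<Longrightarrow> ideal_power \<aa> n \<subseteq> b \<Longrightarrow> u \<in> Z q \<Longrightarrow>
      (\<And>s. s \<in> b \<Longrightarrow> s \<odot>\<^bsub>I q\<^esub> u = \<zero>\<^bsub>I q\<^esub>) \<Longrightarrow>
      u = \<zero>\<^bsub>I q\<^esub> \<or> (\<exists>q' v. q = Suc q' \<and> v \<in> carrier (I q') \<and> d q' v = u \<and> (\<forall>s\<in>b. s \<odot>\<^bsub>I q'\<^esub> v = \<zero>\<^bsub>I q'\<^esub>))"
  obtains w where "w \<in> carrier (I q)" "d q w = z" "\<And>s. s \<in> \<aa> \<Longrightarrow> s \<odot>\<^bsub>I q\<^esub> w = \<zero>\<^bsub>I q\<^esub>"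
proof -
  let ?P = "ideal_power \<aa> n"
  define ann where "ann w = {s \<in> carrier R. s \<odot>\<^bsub>I q\<^esub> w = \<zero>\<^bsub>I q\<^esub>}" for w
  have ann: "ideal (ann w) R" if "w \<in> carrier (I q)" for w
    unfolding ann_def by (rule I.annihilator_ideal[OF that])
  have PR: "?P \<subseteq> carrier R" using idealD(1)[OF ideal_power_ideal[OF \<aa>, of n]] by blast
  \<comment> \<open>The bound \<open>?P \<subseteq> ann w\<close> keeps all these annihilators, and
    those of multiples of \<open>w\<close>, among the ideals to which \<open>ex\<close>
    applies.\<close>
  define F where "F = {ann w | w. w \<in> carrier (I q) \<and> d q w = z \<and> ?P \<subseteq> ann w}"
  have "ann w0 \<in> F" unfolding F_def using w0 PR by (auto simp: ann_def)
  moreover have "\<And>L. L \<in> F \<Longrightarrow> ideal L R" unfolding F_def using ann by blast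
  ultimately obtain L where "L \<in> F" and max: "\<And>L'. L' \<in> F \<Longrightarrow> L \<subseteq> L' \<Longrightarrow> L' = L"
    using exists_maximal_ideal_in[of F] by blast
  then obtain w where L: "L = ann w" and w: "w \<in> carrier (I q)" "d q w = z" "?P \<subseteq> ann w"
    unfolding F_def by blast
  have "y \<in> ann w" if y: "y \<in> \<aa>" for y
  proof (rule ccontr)
    assume ny: "y \<notin> ann w"
    have yR: "y \<in> carrier R" using y idealD(1)[OF \<aa>] by blast
    have yw: "y \<odot>\<^bsub>I q\<^esub> w \<in> carrier (I q)" using yR w by simp
    have yw0: "y \<odot>\<^bsub>I q\<^esub> w \<noteq> \<zero>\<^bsub>I q\<^esub>" using ny yR by (simp add: ann_def)
    have ywZ: "y \<odot>\<^bsub>I q\<^esub> w \<in> Z q" using yw d_smult[OF yR w(1)] w(2) z(2)[OF y] by (simp add: Z_def)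
    have sub: "?P \<subseteq> ann (y \<odot>\<^bsub>I q\<^esub> w)"
    proof
      fix s assume s: "s \<in> ?P"
      then have sR: "s \<in> carrier R" and sw: "s \<odot>\<^bsub>I q\<^esub> w = \<zero>\<^bsub>I q\<^esub>" using w(3) by (auto simp: ann_def)
      have "s \<odot>\<^bsub>I q\<^esub> (y \<odot>\<^bsub>I q\<^esub> w) = y \<odot>\<^bsub>I q\<^esub> (s \<odot>\<^bsub>I q\<^esub> w)"
        using sR yR w(1) by (simp add: I.smult_assoc1[symmetric] m_comm)
      then show "s \<in> ann (y \<odot>\<^bsub>I q\<^esub> w)" using sR sw yR by (simp add: ann_def)
    qed
    \<comment> \<open>If \<open>y\<close> does not kill \<open>w\<close>, then \<open>y w\<close> is
      a nonzero cocycle, and \<open>ex\<close> is applied with \<open>b\<close> its full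
      annihilator.\<close>
    obtain q' v where q: "q = Suc q'" and v: "v \<in> carrier (I q')" "d q' v = y \<odot>\<^bsub>I q\<^esub> w"
      and kv: "\<And>s. s \<in> ann (y \<odot>\<^bsub>I q\<^esub> w) \<Longrightarrow> s \<odot>\<^bsub>I q'\<^esub> v = \<zero>\<^bsub>I q'\<^esub>"
      using ex[OF ann[OF yw] sub ywZ] yw0 by (auto simp: ann_def)
    \<comment> \<open>The annihilator of \<open>y w\<close> is the colon ideal of
      \<open>ann w\<close> by \<open>y\<close>. That it kills \<open>v\<close> is the solvability
      condition for \<open>y v' = v\<close> with \<open>v'\<close> killed by
      \<open>ann w\<close>.\<close>
    have "s \<odot>\<^bsub>I q'\<^esub> v = \<zero>\<^bsub>I q'\<^esub>" if s: "s \<in> carrier R" "s \<otimes> y \<in> ann w" for s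
      using s yR w(1) by (intro kv) (simp add: ann_def I.smult_assoc1)
    then obtain v' where v': "v' \<in> carrier (I q')" "y \<odot>\<^bsub>I q'\<^esub> v' = v"
      "\<And>t. t \<in> ann w \<Longrightarrow> t \<odot>\<^bsub>I q'\<^esub> v' = \<zero>\<^bsub>I q'\<^esub>"
      using injective_solve[OF I_injective ann[OF w(1)] yR v(1)] by metis
    \<comment> \<open>Another solution, whose annihilator contains \<open>ann w\<close> because
      \<open>v'\<close> is killed by it, and also contains \<open>y\<close> because
      \<open>d v = y w\<close>. This contradicts maximality.\<close>
    define w' where "w' = w \<ominus>\<^bsub>I q\<^esub> d q' v'"
    have dv': "d q' v' \<in> carrier (I q)" using v' q by simp
    have w'c: "w' \<in> carrier (I q)" using w dv' by (simp add: w'_def)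
    have "d q w' = z"
      using d_minus[OF w(1) dv'] d_d[OF v'(1)] w(2) q z(1)
        I.add_minus_cancel(1)[of z "Suc q" "\<zero>\<^bsub>I (Suc q)\<^esub>"] by (simp add: w'_def)
    moreover have kill: "s \<in> ann w'" if s: "s \<in> carrier R" "s \<odot>\<^bsub>I q\<^esub> w = d q' (s \<odot>\<^bsub>I q'\<^esub> v')" for s
    proof -
      have "s \<odot>\<^bsub>I q\<^esub> w' = s \<odot>\<^bsub>I q\<^esub> w \<ominus>\<^bsub>I q\<^esub> s \<odot>\<^bsub>I q\<^esub> d q' v'"
        unfolding w'_def using s(1) w(1) dv' by (rule I.smult_minus)
      also have "s \<odot>\<^bsub>I q\<^esub> d q' v' = s \<odot>\<^bsub>I q\<^esub> w" using d_smult[OF s(1) v'(1)] s(2) q by simp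
      finally show ?thesis
        using I.add_minus_cancel(4)[of "s \<odot>\<^bsub>I q\<^esub> w" q "s \<odot>\<^bsub>I q\<^esub> w"] s(1) w(1) by (simp add: ann_def)
    qed
    have Lw': "L \<subseteq> ann w'"
    proof
      fix s assume "s \<in> L"
      then show "s \<in> ann w'"
        using kill[of s] v'(3)[of s] d_zero[of q'] q by (simp add: L ann_def)
    qed
    ultimately have "ann w' \<in> F" unfolding F_def using w'c w(3) L by blast
    then have "ann w' = L" using max Lw' by blast
    moreover have "y \<in> ann w'" using kill[OF yR] v' v by simp
    ultimately show False using ny L by simp
  qed
  then show thesis using that[of w] w by (auto simp: ann_def)
qed

theorem proposition3p6:
  fixes R :: "('r, 'x) ring_scheme"
    and \<mm> \<aa> :: "'r set"
    and E :: "('r, 'e) module" and \<epsilon> :: "'r set \<Rightarrow> 'e"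
    and I :: "nat \<Rightarrow> ('r, 'i) module" and d :: "nat \<Rightarrow> 'i \<Rightarrow> 'i" and \<eta> :: "'r \<Rightarrow> 'i"
    and J :: "nat \<Rightarrow> ('r, 'j) module" and \<delta> :: "nat \<Rightarrow> 'j \<Rightarrow> 'j" and \<theta> :: "('i set \<Rightarrow> 'e) \<Rightarrow> 'j"
    and c i :: nat
  assumes "noetherian_local_ring R \<mm>"
    and "ideal \<aa> R" and "\<aa> \<noteq> carrier R"
    and "injective_hull R (residue_field R \<mm>) E \<epsilon>"
    and "injective_resolution R (regular_module R) I d \<eta>"
    and "relative_Cohen_Macaulay R \<aa> I d"
    and "cohomological_dimension R \<aa> I d = ereal (real c)"
    and "i \<le> c"
    and "injective_resolution R (dual_local_cohomology R \<aa> E I d i) J \<delta> \<theta>"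
  shows "zero_module (dual_local_cohomology R \<aa> E I d i) \<or>
    (cohomological_dimension R \<aa> J \<delta> = ereal (real i) \<and> relative_Cohen_Macaulay R \<aa> J \<delta>)"
proof -
  note \<aa> = assms(2)
  interpret noetherian_cring R
    using assms(1) by (simp add: noetherian_local_ring_def noetherian_cring_def)
  have E: "injective_module R E" using assms(4) by (simp add: injective_hull_def)
  then have modE: "module R E" by (simp add: injective_module_def)
  obtain p x where x: "\<And>l. l < p \<Longrightarrow> x l \<in> \<aa>"
    and gen: "\<And>y. y \<in> \<aa> \<Longrightarrow> \<exists>w. (\<forall>l<p. w l \<in> carrier R) \<and> y = lin RM p w x"
    using ideal_generators[OF \<aa>] by blast
  have xR: "x l \<in> carrier R" if "l < p" for l using x[OF that] idealD(1)[OF \<aa>] by blast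
  interpret T: torsion_filtration R "regular_module R" I d \<eta> x p
    by unfold_locales (use assms(5) xR in auto)
  have TI: "carrier (torsion_submodule R \<aa> (I q)) = T.C p q" for q
    unfolding T.C_def using torsion_submodule_eq[OF T.I_module \<aa>, of p x q] x gen by blast
  \<comment> \<open>The set of degrees with nonzero local cohomology is a singleton, so its supremum
    is its only element.\<close>
  have zeroI: "zero_module (local_cohomology R \<aa> I d q) \<longleftrightarrow> q \<noteq> c" for q
  proof -
    obtain k where k: "\<And>j. \<not> zero_module (local_cohomology R \<aa> I d j) \<longleftrightarrow> j = k"
      using assms(6) unfolding relative_Cohen_Macaulay_def by metis
    then have "cohomological_dimension R \<aa> I d = ereal (real k)"
      by (simp add: cohomological_dimension_def)
    then have "k = c" using assms(7) by simp
    then show ?thesis using k by blast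
  qed
  then have exact_C: "T.Z q \<inter> T.C p q = T.BC q" if "q \<noteq> c" for q
    using T.zero_module_local_cohomology[OF TI, of q] that by simp
  show ?thesis
  proof (cases "i = c")
    case False
    then have "zero_module (dual_local_cohomology R \<aa> E I d i)"
      unfolding dual_local_cohomology_def
      using zero_module_Hom_module[OF T.local_cohomology_module[OF TI] modE] zeroI by blast
    then show ?thesis ..
  next
    case True
    let ?H = "local_cohomology R \<aa> I d c"
    let ?K = "dual_local_cohomology R \<aa> E I d c"
    have res: "injective_resolution R ?K J \<delta> \<theta>" using assms(9) True by simp
    have H: "module R ?H" by (rule T.local_cohomology_module[OF TI])
    interpret S: torsion_filtration R ?K J \<delta> \<theta> x p
      by unfold_locales (use res xR in auto)
    have SI: "carrier (torsion_submodule R \<aa> (J q)) = S.C p q" for q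
      unfolding S.C_def using torsion_submodule_eq[OF S.I_module \<aa>, of p x q] x gen by blast
    \<comment> \<open>\<open>ex b q\<close> says that the complex \<open>J[b]\<close> of elements
      killed by \<open>b\<close> is exact in degree \<open>q\<close>. By dimension shifting this is
      vanishing of \<open>Ext^q(R/b, K)\<close>.\<close>
    define ex where "ex b q \<longleftrightarrow> (\<forall>z\<in>S.Z q. (\<forall>s\<in>b. s \<odot>\<^bsub>J q\<^esub> z = \<zero>\<^bsub>J q\<^esub>) \<longrightarrow> (case q of
        0 \<Rightarrow> z = \<zero>\<^bsub>J q\<^esub>
      | Suc q' \<Rightarrow> \<exists>w\<in>carrier (J q'). (\<forall>s\<in>b. s \<odot>\<^bsub>J q'\<^esub> w = \<zero>\<^bsub>J q'\<^esub>) \<and> \<delta> q' w = z))" for b q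
    have ex: "(q \<noteq> c \<longrightarrow> ex b q) \<and> (\<one>\<^bsub>R\<^esub> \<notin> b \<longrightarrow> \<not> ex b c)"
      if b: "ideal b R" "ideal_power \<aa> n \<subseteq> b" for b q and n :: nat
    proof -
      obtain r a where "free_resolution R b r a" using free_resolution_exists[OF b(1)] by blast
      then interpret F: free_resolution R b r a .
      have "torsion_tor R I d \<eta> x p b r a n"
        by unfold_locales (use power_mem_ideal_power[OF x \<aa>] b(2) in blast)
      then interpret TT: torsion_tor R I d \<eta> x p b r a n .
      have tor: "F.tor_zero ?H (carrier ?H) {\<zero>\<^bsub>?H\<^esub>} j \<longleftrightarrow>
          j < c \<or> F.tor_zero RM (carrier R) {\<zero>\<^bsub>R\<^esub>} (j - c)" for j
        using TT.tor_zero_local_cohomology[OF exact_C TI] by blast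
      have "F.ext_zero ?K (carrier ?K) j \<longleftrightarrow> F.tor_zero ?H (carrier ?H) {\<zero>\<^bsub>?H\<^esub>} j" for j
        unfolding dual_local_cohomology_def
        using F.ext_zero_dual_if_tor_zero[OF E H]
          F.tor_zero_if_ext_zero_dual[OF modE H local_cogenerator[OF assms(1,4) module.power_module_is_module[OF H]]]
        by blast
      moreover have "ex b q \<longleftrightarrow> F.ext_zero ?K (carrier ?K) (Suc q)" for q
        by (cases q) (auto simp: ex_def S.Z_def F.ext_zero_resolution_0[OF res] F.ext_zero_resolution_Suc[OF res])
      ultimately have eq: "ex b q \<longleftrightarrow> Suc q < c \<or> F.tor_zero RM (carrier R) {\<zero>\<^bsub>R\<^esub>} (Suc q - c)" for q
        using tor by simp
      \<comment> \<open>For the ring, Tor survives only at index one, and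
        \<open>Suc q - c = 1\<close> holds exactly for \<open>q = c\<close>.\<close>
      have "ex b q" if "q \<noteq> c"
        unfolding eq using that by (cases "Suc q < c") (auto intro!: F.tor_zero_exact)
      moreover have "\<not> ex b c" if "\<one>\<^bsub>R\<^esub> \<notin> b"
        unfolding eq using F.tor_zero_regular[OF that] by simp
      ultimately show ?thesis by blast
    qed
    have kill_iff: "z \<in> S.C p q \<longleftrightarrow>
        z \<in> carrier (J q) \<and> (\<exists>n::nat. \<forall>s\<in>ideal_power \<aa> n. s \<odot>\<^bsub>J q\<^esub> z = \<zero>\<^bsub>J q\<^esub>)" for z q
      unfolding SI[symmetric] by (simp add: torsion_submodule_def)
    \<comment> \<open>A torsion cocycle is killed by some \<open>\<aa>^n\<close>, so exactness of
      \<open>J[\<aa>^n]\<close> provides a primitive, which is again torsion.\<close>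
    have vanish: "S.Z q \<inter> S.C p q = S.BC q" if q: "q \<noteq> c" for q
    proof (intro equalityI S.BC_subset subsetI)
      fix z assume z: "z \<in> S.Z q \<inter> S.C p q"
      then obtain n :: nat where n: "\<forall>s\<in>ideal_power \<aa> n. s \<odot>\<^bsub>J q\<^esub> z = \<zero>\<^bsub>J q\<^esub>"
        using kill_iff by blast
      have "ex (ideal_power \<aa> n) q" using ex[OF ideal_power_ideal[OF \<aa>] order_refl] q by blast
      then have ex_z: "case q of 0 \<Rightarrow> z = \<zero>\<^bsub>J q\<^esub>
        | Suc q' \<Rightarrow> \<exists>w\<in>carrier (J q'). (\<forall>s\<in>ideal_power \<aa> n. s \<odot>\<^bsub>J q'\<^esub> w = \<zero>\<^bsub>J q'\<^esub>) \<and> \<delta> q' w = z"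
        using z n unfolding ex_def by blast
      show "z \<in> S.BC q"
      proof (cases q)
        case 0
        then show ?thesis using ex_z by (simp add: S.BC_simps)
      next
        case (Suc q')
        then obtain w where "w \<in> carrier (J q')" "\<forall>s\<in>ideal_power \<aa> n. s \<odot>\<^bsub>J q'\<^esub> w = \<zero>\<^bsub>J q'\<^esub>"
          "\<delta> q' w = z" using ex_z by auto
        then have "w \<in> S.C p q'" "z = \<delta> q' w" using kill_iff by blast+
        then show ?thesis by (simp add: Suc S.BC_simps)
      qed
    qed
    have "S.Z c \<inter> S.C p c \<noteq> S.BC c"
    proof
      assume zero: "S.Z c \<inter> S.C p c = S.BC c"
      note \<aa>1 = ideal_power_1[OF \<aa>]
      have "\<one>\<^bsub>R\<^esub> \<notin> \<aa>" using assms(3) ideal.one_imp_carrier[OF \<aa>] by blast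
      \<comment> \<open>Properness of \<open>\<aa>\<close> enters here: \<open>J[\<aa>]\<close> has
        a nonzero class in degree \<open>c\<close>, and it remains to see that the class survives in
        the torsion complex.\<close>
      then have "\<not> ex \<aa> c" using ex[OF \<aa>, of 1] \<aa>1 by blast
      then obtain z where z: "z \<in> S.Z c" "\<forall>s\<in>\<aa>. s \<odot>\<^bsub>J c\<^esub> z = \<zero>\<^bsub>J c\<^esub>"
        and nz: "\<not> (case c of 0 \<Rightarrow> z = \<zero>\<^bsub>J c\<^esub>
          | Suc q' \<Rightarrow> \<exists>w\<in>carrier (J q'). (\<forall>s\<in>\<aa>. s \<odot>\<^bsub>J q'\<^esub> w = \<zero>\<^bsub>J q'\<^esub>) \<and> \<delta> q' w = z)"
        unfolding ex_def by blast
      have zc: "z \<in> carrier (J c)" using z(1) by (simp add: S.Z_def)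
      have "z \<in> S.C p c" unfolding kill_iff using zc z(2) \<aa>1 by (intro conjI exI[of _ 1]) auto
      then have zB: "z \<in> S.BC c" using z(1) zero by blast
      show False
      proof (cases c)
        case 0
        then show ?thesis using zB nz by (simp add: S.BC_simps)
      next
        case (Suc q)
        then obtain w0 where w0: "w0 \<in> S.C p q" "\<delta> q w0 = z" using zB by (auto simp: S.BC_simps)
        then obtain n :: nat where n: "\<forall>s\<in>ideal_power \<aa> n. s \<odot>\<^bsub>J q\<^esub> w0 = \<zero>\<^bsub>J q\<^esub>"
          using kill_iff by blast
        have w0c: "w0 \<in> carrier (J q)" using w0(1) by (rule S.C_carrier)
        have ex_q: "u = \<zero>\<^bsub>J q\<^esub> \<or> (\<exists>q' v. q = Suc q' \<and> v \<in> carrier (J q') \<and> \<delta> q' v = u \<and>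
            (\<forall>s\<in>b. s \<odot>\<^bsub>J q'\<^esub> v = \<zero>\<^bsub>J q'\<^esub>))"
          if b: "ideal b R" "ideal_power \<aa> n \<subseteq> b"
            and u: "u \<in> S.Z q" "\<And>s. s \<in> b \<Longrightarrow> s \<odot>\<^bsub>J q\<^esub> u = \<zero>\<^bsub>J q\<^esub>" for b u
        proof -
          have "q \<noteq> c" using Suc by simp
          then have "ex b q" using ex[OF b, of q] by blast
          then show ?thesis using u unfolding ex_def by (cases q) auto
        qed
        \<comment> \<open>A torsion primitive \<open>w0\<close> of \<open>z\<close> is improved to
          one killed by \<open>\<aa>\<close> itself, against the choice of \<open>z\<close>.\<close>
        obtain w where "w \<in> carrier (J q)" "\<delta> q w = z" "\<And>s. s \<in> \<aa> \<Longrightarrow> s \<odot>\<^bsub>J q\<^esub> w = \<zero>\<^bsub>J q\<^esub>"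
          by (rule S.torsion_coboundary_killed[OF \<aa> _ _ w0c w0(2) _ ex_q]) (use zc z(2) n Suc in auto)
        then show False using nz Suc by auto
      qed
    qed
    then have nonzero: "\<not> zero_module (local_cohomology R \<aa> J \<delta> q) \<longleftrightarrow> q = c" for q
      using vanish[of q] S.zero_module_local_cohomology[OF SI, of q] by blast
    then have "relative_Cohen_Macaulay R \<aa> J \<delta>" "cohomological_dimension R \<aa> J \<delta> = ereal (real c)"
      by (simp_all add: relative_Cohen_Macaulay_def cohomological_dimension_def)
    then show ?thesis using True by simp
  qed
qed

end
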